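(* Let $\eta$ be a Borel probability measure on $SU(2)$ such that the group generated by $\operatorname{supp}\eta$ is dense in $SU(2)$. Then there is a constant $C>0$, independent of $d$ and $\varepsilon$, such that for every integer $d\ge 3$, every $0<\varepsilon<\frac12$ and every integer $\ell\ge C\left(d\log\frac1\varepsilon\right)^C$, the $\ell$-step distribution $\nu^{(\ell)}$ of the random walk on $SU(d)$ governed by $\nu=\frac1d\sum_{i=0}^{d-1}\nu_{i,i+1}$ is an $\varepsilon$-approximation of the uniform measure on $SU(d)$; that is, $$\left|\int_{SU(d)} f\,d\nu^{(\ell)}-\int_{SU(d)} f\,dm\right|\le\varepsilon$$ for every $f:SU(d)\to\mathbb{R}$ which is $1$-Lipschitz with respect to the operator-norm distance, where $m$ is the normalized Haar measure on $SU(d)$.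
   Context: Let $e_0,\dots,e_{d-1}$ be the standard orthonormal basis of $\mathbb{C}^d$, with the index set $\{0,1,\dots,d-1\}$ identified with the cyclic group $\mathbb{Z}/d\mathbb{Z}$ (so $e_d=e_0$). For $\gamma\in SU(2)$ and $i\in\mathbb{Z}/d\mathbb{Z}$, let $\gamma_{i,i+1}\in SU(d)$ be the element that fixes $e_k$ for all $k\notin\{i,i+1\}$ and acts as $\gamma$ on the span $[e_i,e_{i+1}]$ in the ordered basis $(e_i,e_{i+1})$. The measure $\nu_{i,i+1}$ on $SU(d)$ is the push-forward of $\eta$ under $\gamma\mapsto\gamma_{i,i+1}$. The corresponding averaging operator is $$Tf(x)=\int f(gx)\,\nu(dg)=\frac1d\sum_{i=0}^{d-1}\int f(gx)\,\nu_{i,i+1}(dg),$$ and $\nu^{(\ell)}$ is the $\ell$-fold convolution power of $\nu$, i.e. the law of a product of $\ell$ independent $\nu$-distributed elements. The operator-norm distance on $SU(d)$ is $\|g-h\|$, with $\|\cdot\|$ the operator norm on $d\times d$ complex matrices. *)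

theory Defs
  imports
    "HOL-Probability.Probability"
    "HOL-Algebra.Generated_Groups"
    "Jordan_Normal_Form.Schur_Decomposition"
begin

text \<open>
  The dimension \<open>d\<close> is quantified inside the theorem (the constant must not depend on it),
  so matrices are those of \<^theory>\<open>Jordan_Normal_Form.Matrix\<close>, of type \<^typ>\<open>complex mat\<close>, whose
  dimension is a natural number.
\<close>

hide_const (open) Determinants.det

subsection \<open>Operator norm\<close>

definition l2_norm :: "complex vec \<Rightarrow> real" where
  "l2_norm v = L2_set (\<lambda>i. norm (vec_index v i)) {..<dim_vec v}"

definition op_norm :: "complex mat \<Rightarrow> real" where
  "op_norm A = (SUP v \<in> {v \<in> carrier_vec (dim_col A). l2_norm v \<le> 1}. l2_norm (A *\<^sub>v v))"

text \<open>The case distinction makes \<open>op_dist\<close> symmetric on the whole type, as required by \<^locale>\<open>Metric_space\<close>.\<close>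

definition op_dist :: "complex mat \<Rightarrow> complex mat \<Rightarrow> real" where
  "op_dist g h =
     (if dim_row g = dim_row h \<and> dim_col g = dim_col h then op_norm (g - h) else 0)"

subsection \<open>The special unitary group\<close>

definition SU :: "nat \<Rightarrow> complex mat set" where
  "SU d = {g \<in> carrier_mat d d. mat_adjoint g * g = 1\<^sub>m d \<and> det g = 1}"

definition SU_group :: "nat \<Rightarrow> complex mat monoid" where
  "SU_group d = \<lparr>carrier = SU d, mult = (*), one = 1\<^sub>m d\<rparr>"

definition SU_topology :: "nat \<Rightarrow> complex mat topology" where
  "SU_topology d = Metric_space.mtopology (SU d) op_dist"

definition borel_SU :: "nat \<Rightarrow> complex mat measure" where
  "borel_SU d = sigma (SU d) {U. openin (SU_topology d) U}"

text \<open>Left invariance suffices: \<open>SU(d)\<close> is compact, so this determines \<open>m\<close> and makes it bi-invariant.\<close>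

definition normalized_haar_SU :: "nat \<Rightarrow> complex mat measure \<Rightarrow> bool" where
  "normalized_haar_SU d m \<longleftrightarrow>
     prob_space m \<and> sets m = sets (borel_SU d) \<and>
     (\<forall>g\<in>SU d. distr m (borel_SU d) (\<lambda>h. g * h) = m)"

definition measure_support :: "'a topology \<Rightarrow> 'a measure \<Rightarrow> 'a set" where
  "measure_support X \<mu> = {x \<in> topspace X. \<forall>U. openin X U \<and> x \<in> U \<longrightarrow> emeasure \<mu> U > 0}"

subsection \<open>The random walk\<close>

text \<open>
  \<open>embed_SU2 d i \<gamma>\<close> is \<open>\<gamma>\<^sub>i\<^sub>,\<^sub>i\<^sub>+\<^sub>1\<close> with \<open>i + 1\<close> read modulo \<open>d\<close>; for \<open>i = d - 1\<close> the ordered basis is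
  \<open>(e\<^sub>d\<^sub>-\<^sub>1, e\<^sub>0)\<close>. It is intended for \<open>i < d\<close> and \<open>d \<ge> 2\<close>.
\<close>

definition embed_SU2 :: "nat \<Rightarrow> nat \<Rightarrow> complex mat \<Rightarrow> complex mat" where
  "embed_SU2 d i \<gamma> =
     (let j = Suc i mod d in
      mat d d (\<lambda>(r, c).
        if r \<in> {i, j} \<and> c \<in> {i, j}
        then \<gamma> $$ (if r = i then 0 else 1, if c = i then 0 else 1)
        else if r = c then 1 else 0))"

definition pair_measure_SU :: "complex mat measure \<Rightarrow> nat \<Rightarrow> nat \<Rightarrow> complex mat measure" where
  "pair_measure_SU \<eta> d i = distr \<eta> (borel_SU d) (embed_SU2 d i)"

definition walk_measure :: "complex mat measure \<Rightarrow> nat \<Rightarrow> complex mat measure" where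
  "walk_measure \<eta> d =
     measure_of (SU d) (sets (borel_SU d))
       (\<lambda>A. ennreal (1 / real d) * (\<Sum>i<d. emeasure (pair_measure_SU \<eta> d i) A))"

definition convolution_SU ::
  "nat \<Rightarrow> complex mat measure \<Rightarrow> complex mat measure \<Rightarrow> complex mat measure" where
  "convolution_SU d \<mu> \<nu> = distr (\<mu> \<Otimes>\<^sub>M \<nu>) (borel_SU d) (\<lambda>(g, h). g * h)"

primrec convolution_power_SU ::
  "nat \<Rightarrow> complex mat measure \<Rightarrow> nat \<Rightarrow> complex mat measure" where
  "convolution_power_SU d \<nu> 0 = return (borel_SU d) (1\<^sub>m d)"
| "convolution_power_SU d \<nu> (Suc l) = convolution_SU d \<nu> (convolution_power_SU d \<nu> l)"

subsection \<open>Well-formedness of the definitions\<close>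

lemma l2_norm_nonneg: "0 \<le> l2_norm v"
  by (simp add: l2_norm_def L2_set_nonneg)

lemma l2_norm_triangle:
  assumes "dim_vec v = dim_vec w"
  shows "l2_norm (v + w) \<le> l2_norm v + l2_norm w"
proof -
  let ?A = "{..<dim_vec w}"
  have "l2_norm (v + w) = L2_set (\<lambda>i. norm (vec_index v i + vec_index w i)) ?A"
    using assms by (auto simp: l2_norm_def intro!: L2_set_cong)
  also have "\<dots> \<le> L2_set (\<lambda>i. norm (vec_index v i) + norm (vec_index w i)) ?A"
    by (intro L2_set_mono norm_triangle_ineq) auto
  also have "\<dots> \<le> l2_norm v + l2_norm w"
    unfolding l2_norm_def using assms by (simp add: L2_set_triangle_ineq)
  finally show ?thesis .
qed

lemma l2_norm_smult: "l2_norm (a \<cdot>\<^sub>v v) = norm a * l2_norm v"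
proof -
  have "l2_norm (a \<cdot>\<^sub>v v) = L2_set (\<lambda>i. norm a * norm (vec_index v i)) {..<dim_vec v}"
    by (auto simp: l2_norm_def norm_mult intro!: L2_set_cong)
  then show ?thesis by (simp add: l2_norm_def L2_set_right_distrib)
qed

lemma l2_norm_component: "i < dim_vec v \<Longrightarrow> norm (vec_index v i) \<le> l2_norm v"
  unfolding l2_norm_def by (rule member_le_L2_set) auto

lemma bdd_above_op_norm:
  "bdd_above ((\<lambda>v. l2_norm (A *\<^sub>v v)) ` {v \<in> carrier_vec (dim_col A). l2_norm v \<le> 1})"
proof (rule bdd_aboveI2)
  fix v assume v: "v \<in> {v \<in> carrier_vec (dim_col A). l2_norm v \<le> 1}"
  have comp: "norm (vec_index v j) \<le> 1" if "j < dim_col A" for j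
    using l2_norm_component[of j v] v that by auto
  have "l2_norm (A *\<^sub>v v) \<le> (\<Sum>i<dim_row A. norm (vec_index (A *\<^sub>v v) i))"
    unfolding l2_norm_def dim_mult_mat_vec by (rule L2_set_le_sum) simp
  also have "\<dots> \<le> (\<Sum>i<dim_row A. \<Sum>j<dim_col A. norm (A $$ (i, j)))"
  proof (rule sum_mono)
    fix i assume i: "i \<in> {..<dim_row A}"
    have "vec_index (A *\<^sub>v v) i = (\<Sum>j<dim_col A. A $$ (i, j) * vec_index v j)"
      using i v by (auto simp: scalar_prod_def atLeast0LessThan intro!: sum.cong)
    also have "norm \<dots> \<le> (\<Sum>j<dim_col A. norm (A $$ (i, j)))"
      by (rule sum_norm_le) (auto simp: norm_mult intro!: mult_left_le comp)
    finally show "norm (vec_index (A *\<^sub>v v) i) \<le> (\<Sum>j<dim_col A. norm (A $$ (i, j)))" .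
  qed
  finally show "l2_norm (A *\<^sub>v v) \<le> (\<Sum>i<dim_row A. \<Sum>j<dim_col A. norm (A $$ (i, j)))" .
qed

lemma l2_norm_zero: "l2_norm (0\<^sub>v n) = 0"
  by (simp add: l2_norm_def L2_set_def)

lemma op_norm_bound:
  "v \<in> carrier_vec (dim_col A) \<Longrightarrow> l2_norm v \<le> 1 \<Longrightarrow> l2_norm (A *\<^sub>v v) \<le> op_norm A"
  unfolding op_norm_def by (rule cSUP_upper[OF _ bdd_above_op_norm]) auto

lemma op_norm_leI:
  assumes "\<And>v. v \<in> carrier_vec (dim_col A) \<Longrightarrow> l2_norm v \<le> 1 \<Longrightarrow> l2_norm (A *\<^sub>v v) \<le> c"
  shows "op_norm A \<le> c"
  unfolding op_norm_def
proof (rule cSUP_least)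
  have "0\<^sub>v (dim_col A) \<in> {v \<in> carrier_vec (dim_col A). l2_norm v \<le> 1}"
    by (simp add: l2_norm_zero)
  then show "{v \<in> carrier_vec (dim_col A). l2_norm v \<le> 1} \<noteq> {}" by blast
qed (use assms in auto)

lemma op_norm_nonneg: "0 \<le> op_norm A"
  using op_norm_bound[of "0\<^sub>v (dim_col A)" A] l2_norm_nonneg[of "A *\<^sub>v 0\<^sub>v (dim_col A)"]
  by (simp add: l2_norm_zero)

lemma op_norm_eq_0D:
  assumes "op_norm A = 0" "i < dim_row A" "j < dim_col A"
  shows "A $$ (i, j) = 0"
proof -
  have "l2_norm (unit_vec (dim_col A) j) = norm (1::complex)"
  proof -
    have "(\<Sum>i<dim_col A. (norm (vec_index (unit_vec (dim_col A) j :: complex vec) i))\<^sup>2) =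
        (\<Sum>i<dim_col A. if i = j then 1 else 0)"
      by (rule sum.cong) (auto simp: unit_vec_def)
    then show ?thesis using assms(3) by (simp add: l2_norm_def L2_set_def)
  qed
  then have "l2_norm (A *\<^sub>v unit_vec (dim_col A) j) \<le> 0"
    using op_norm_bound[of "unit_vec (dim_col A) j" A] assms(1) by simp
  then have "norm (vec_index (A *\<^sub>v unit_vec (dim_col A) j) i) \<le> 0"
    using l2_norm_component[of i "A *\<^sub>v unit_vec (dim_col A) j"] assms(2)
    by (auto simp del: index_mult_mat_vec dest: order_trans)
  moreover have "vec_index (A *\<^sub>v unit_vec (dim_col A) j) i = A $$ (i, j)"
    using assms by (simp add: scalar_prod_right_unit)
  ultimately show ?thesis by (simp del: index_mult_mat_vec)
qed

lemma op_norm_zero: "op_norm (0\<^sub>m m n) = 0"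
proof (rule antisym[OF op_norm_leI op_norm_nonneg])
  fix v :: "complex vec" assume "v \<in> carrier_vec (dim_col (0\<^sub>m m n :: complex mat))"
  then have "0\<^sub>m m n *\<^sub>v v = 0\<^sub>v m" by (intro eq_vecI) auto
  then show "l2_norm (0\<^sub>m m n *\<^sub>v v) \<le> 0" by (simp add: l2_norm_zero)
qed

lemma op_norm_triangle:
  assumes "A \<in> carrier_mat m n" "B \<in> carrier_mat m n"
  shows "op_norm (A + B) \<le> op_norm A + op_norm B"
proof (rule op_norm_leI)
  fix v assume v: "v \<in> carrier_vec (dim_col (A + B))" "l2_norm v \<le> 1"
  then have "(A + B) *\<^sub>v v = A *\<^sub>v v + B *\<^sub>v v"
    using assms by (intro add_mult_distrib_mat_vec) auto
  then have "l2_norm ((A + B) *\<^sub>v v) \<le> l2_norm (A *\<^sub>v v) + l2_norm (B *\<^sub>v v)"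
    using l2_norm_triangle[of "A *\<^sub>v v" "B *\<^sub>v v"] assms by simp
  also have "\<dots> \<le> op_norm A + op_norm B"
    using v assms by (intro add_mono op_norm_bound) auto
  finally show "l2_norm ((A + B) *\<^sub>v v) \<le> op_norm A + op_norm B" .
qed

lemma op_norm_uminus_le:
  assumes "A \<in> carrier_mat m n"
  shows "op_norm (- A) \<le> op_norm A"
proof (rule op_norm_leI)
  fix v assume v: "v \<in> carrier_vec (dim_col (- A))" "l2_norm v \<le> 1"
  have "- A *\<^sub>v v = (- 1) \<cdot>\<^sub>v (A *\<^sub>v v)"
    using assms v by (intro eq_vecI) auto
  then show "l2_norm (- A *\<^sub>v v) \<le> op_norm A"
    using op_norm_bound[of v A] v by (simp add: l2_norm_smult)
qed

lemma SU_carrier: "g \<in> SU d \<Longrightarrow> g \<in> carrier_mat d d"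
  by (simp add: SU_def)

lemma op_dist_SU: "g \<in> SU d \<Longrightarrow> h \<in> SU d \<Longrightarrow> op_dist g h = op_norm (g - h)"
  using SU_carrier[of g d] SU_carrier[of h d] by (simp add: op_dist_def)

lemma Metric_space_SU: "Metric_space (SU d) op_dist"
proof
  fix x y :: "complex mat"
  show "0 \<le> op_dist x y" by (simp add: op_dist_def op_norm_nonneg)
  have *: "op_norm (a - b) \<le> op_norm (b - a)"
    if "dim_row a = dim_row b" "dim_col a = dim_col b" for a b :: "complex mat"
  proof -
    have "- (b - a) = a - b"
      by (rule eq_matI) (simp_all add: that)
    moreover have "op_norm (- (b - a)) \<le> op_norm (b - a)"
      by (rule op_norm_uminus_le[of _ "dim_row (b - a)" "dim_col (b - a)"]) (rule carrier_matI; rule refl)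
    ultimately show ?thesis by metis
  qed
  show "op_dist x y = op_dist y x"
  proof (cases "dim_row x = dim_row y \<and> dim_col x = dim_col y")
    case True
    then have "op_norm (x - y) = op_norm (y - x)"
      by (intro antisym *) auto
    with True show ?thesis by (simp add: op_dist_def)
  qed (auto simp: op_dist_def)
next
  fix x y assume xy: "x \<in> SU d" "y \<in> SU d"
  then have c: "x \<in> carrier_mat d d" "y \<in> carrier_mat d d" by (auto dest: SU_carrier)
  show "op_dist x y = 0 \<longleftrightarrow> x = y"
  proof
    assume "op_dist x y = 0"
    then have 0: "op_norm (x - y) = 0" using xy by (simp add: op_dist_SU)
    show "x = y"
    proof (rule eq_matI)
      fix i j assume "i < dim_row y" "j < dim_col y"
      then show "x $$ (i, j) = y $$ (i, j)"
        using op_norm_eq_0D[OF 0, of i j] c by simp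
    qed (use c in auto)
  next
    assume "x = y"
    moreover have "y - y = 0\<^sub>m d d" using c by (intro eq_matI) auto
    ultimately show "op_dist x y = 0" by (simp add: op_dist_def op_norm_zero)
  qed
next
  fix x y z assume xyz: "x \<in> SU d" "y \<in> SU d" "z \<in> SU d"
  then have c: "x \<in> carrier_mat d d" "y \<in> carrier_mat d d" "z \<in> carrier_mat d d"
    by (auto dest: SU_carrier)
  then have "x - z = (x - y) + (y - z)" by (intro eq_matI) auto
  then show "op_dist x z \<le> op_dist x y + op_dist y z"
    using op_norm_triangle[OF minus_carrier_mat[OF c(2)] minus_carrier_mat[OF c(3)]] xyz
    by (metis op_dist_SU)
qed

lemma topspace_SU_topology: "topspace (SU_topology d) = SU d"
  by (simp add: SU_topology_def Metric_space.topspace_mtopology[OF Metric_space_SU])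

lemma space_borel_SU: "space (borel_SU d) = SU d"
  and sets_borel_SU: "sets (borel_SU d) = sigma_sets (SU d) {U. openin (SU_topology d) U}"
proof -
  have "{U. openin (SU_topology d) U} \<subseteq> Pow (SU d)"
    using openin_subset topspace_SU_topology by blast
  then show "space (borel_SU d) = SU d"
    "sets (borel_SU d) = sigma_sets (SU d) {U. openin (SU_topology d) U}"
    unfolding borel_SU_def by simp_all
qed

lemma adjoint_carrier: "g \<in> carrier_mat d d \<Longrightarrow> mat_adjoint g \<in> carrier_mat d d"
  by (auto simp: mat_adjoint_def)

lemma index_adjoint:
  "g \<in> carrier_mat d d \<Longrightarrow> i < d \<Longrightarrow> j < d \<Longrightarrow> mat_adjoint g $$ (i, j) = cnj (g $$ (j, i))"
  for g :: "complex mat"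
  by (auto simp: mat_adjoint_def mat_of_rows_index)

lemma adjoint_adjoint: "g \<in> carrier_mat d d \<Longrightarrow> mat_adjoint (mat_adjoint g) = g"
  for g :: "complex mat"
  by (rule eq_matI)
    (use adjoint_carrier[of g d] adjoint_carrier[of "mat_adjoint g" d] in
      \<open>auto simp: index_adjoint[of _ d]\<close>)

lemma adjoint_mult:
  fixes g h :: "complex mat"
  assumes g: "g \<in> carrier_mat d d" and h: "h \<in> carrier_mat d d"
  shows "mat_adjoint (g * h) = mat_adjoint h * mat_adjoint g"
proof (rule eq_matI)
  note c = adjoint_carrier[OF g] adjoint_carrier[OF h] adjoint_carrier[OF mult_carrier_mat[OF g h]]
  fix i j assume "i < dim_row (mat_adjoint h * mat_adjoint g)"
    "j < dim_col (mat_adjoint h * mat_adjoint g)"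
  then have ij: "i < d" "j < d" using c by auto
  show "mat_adjoint (g * h) $$ (i, j) = (mat_adjoint h * mat_adjoint g) $$ (i, j)"
    using ij g h c
    by (auto simp: index_adjoint[of _ d] scalar_prod_def mult.commute intro!: sum.cong)
qed (use adjoint_carrier[OF g] adjoint_carrier[OF h] adjoint_carrier[OF mult_carrier_mat[OF g h]] in auto)

lemma SU_one: "1\<^sub>m d \<in> SU d"
proof -
  have "mat_adjoint (1\<^sub>m d :: complex mat) = 1\<^sub>m d"
    by (rule eq_matI) (use adjoint_carrier[of "1\<^sub>m d" d] in \<open>auto simp: index_adjoint[of _ d]\<close>)
  then show ?thesis by (simp add: SU_def)
qed

lemma SU_mult:
  assumes "g \<in> SU d" "h \<in> SU d"
  shows "g * h \<in> SU d"
proof -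
  have g: "g \<in> carrier_mat d d" "mat_adjoint g * g = 1\<^sub>m d" "det g = 1"
    and h: "h \<in> carrier_mat d d" "mat_adjoint h * h = 1\<^sub>m d" "det h = 1"
    using assms by (auto simp: SU_def)
  note c = adjoint_carrier[OF g(1)] adjoint_carrier[OF h(1)]
  have "mat_adjoint (g * h) * (g * h) = mat_adjoint h * (mat_adjoint g * (g * h))"
    using g(1) h(1) c
    by (simp add: adjoint_mult[OF g(1) h(1)] assoc_mult_mat[of _ d d _ d _ d])
  also have "mat_adjoint g * (g * h) = h"
    using g h c by (simp flip: assoc_mult_mat[of _ d d _ d _ d])
  finally show ?thesis
    using g h by (simp add: SU_def det_mult[of _ d])
qed

lemma SU_adjoint:
  assumes "g \<in> SU d"
  shows "mat_adjoint g \<in> SU d"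
proof -
  have g: "g \<in> carrier_mat d d" "mat_adjoint g * g = 1\<^sub>m d" "det g = 1"
    using assms by (auto simp: SU_def)
  note c = adjoint_carrier[OF g(1)]
  have "g * mat_adjoint g = 1\<^sub>m d"
    by (rule mat_mult_left_right_inverse[OF c g(1,2)])
  moreover have "det (mat_adjoint g) * det g = det (1\<^sub>m d :: complex mat)"
    using det_mult[OF c g(1)] g(2) by simp
  ultimately show ?thesis
    using g c by (simp add: SU_def adjoint_adjoint)
qed

lemma group_SU: "group (SU_group d)"
proof (rule groupI)
  fix x assume "x \<in> carrier (SU_group d)"
  then have "x \<in> SU d" by (simp add: SU_group_def)
  then show "\<exists>y\<in>carrier (SU_group d). y \<otimes>\<^bsub>SU_group d\<^esub> x = \<one>\<^bsub>SU_group d\<^esub>"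
    using SU_adjoint[of x d] by (auto simp: SU_group_def SU_def)
qed (auto simp: SU_group_def SU_one SU_mult dest!: SU_carrier intro: assoc_mult_mat)

lemma sets_walk_measure: "sets (walk_measure \<eta> d) = sets (borel_SU d)"
  and space_walk_measure: "space (walk_measure \<eta> d) = SU d"
proof -
  have "sets (borel_SU d) \<subseteq> Pow (SU d)"
    using sets.space_closed[of "borel_SU d"] by (simp add: space_borel_SU)
  then show "sets (walk_measure \<eta> d) = sets (borel_SU d)" "space (walk_measure \<eta> d) = SU d"
    unfolding walk_measure_def
    using sets.sigma_sets_eq[of "borel_SU d"] by (simp_all add: space_borel_SU)
qed

lemma emeasure_walk_measure:
  assumes "A \<in> sets (borel_SU d)"
  shows "emeasure (walk_measure \<eta> d) A =
    ennreal (1 / real d) * (\<Sum>i<d. emeasure (pair_measure_SU \<eta> d i) A)"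
proof (rule emeasure_measure_of[OF walk_measure_def])
  show "sets (borel_SU d) \<subseteq> Pow (SU d)"
    using sets.space_closed[of "borel_SU d"] by (simp add: space_borel_SU)
  show "A \<in> sets (walk_measure \<eta> d)" using assms by (simp add: sets_walk_measure)
  show "positive (sets (walk_measure \<eta> d))
     (\<lambda>A. ennreal (1 / real d) * (\<Sum>i<d. emeasure (pair_measure_SU \<eta> d i) A))"
    by (simp add: positive_def)
  show "countably_additive (sets (walk_measure \<eta> d))
     (\<lambda>A. ennreal (1 / real d) * (\<Sum>i<d. emeasure (pair_measure_SU \<eta> d i) A))"
  proof (rule countably_additiveI)
    fix F :: "nat \<Rightarrow> complex mat set"
    assume F: "range F \<subseteq> sets (walk_measure \<eta> d)" "disjoint_family F"
    have "(\<Sum>n. emeasure (pair_measure_SU \<eta> d i) (F n)) = emeasure (pair_measure_SU \<eta> d i) (\<Union> (range F))"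
      for i
      using F by (intro suminf_emeasure) (auto simp: pair_measure_SU_def sets_walk_measure)
    then show "(\<Sum>n. ennreal (1 / real d) * (\<Sum>i<d. emeasure (pair_measure_SU \<eta> d i) (F n))) =
      ennreal (1 / real d) * (\<Sum>i<d. emeasure (pair_measure_SU \<eta> d i) (\<Union> (range F)))"
      by (simp add: suminf_sum)
  qed
qed

end

theory Submission
  imports Defs
begin

text \<open>
  For a function \<open>f\<close> on \<open>SU(d)\<close> put \<open>T f (x) = \<integral> f (g x) d\<nu>(g)\<close>, so that the integral of \<open>f\<close> against the
  \<open>l\<close>-step distribution is \<open>(T\<^sup>l f)(1)\<close>. Since the operator norm is bi-invariant, every \<open>f\<^sub>j = T\<^sup>j f\<close> is
  again 1-Lipschitz. Two consequences replace representation theory: translates of \<open>f\<^sub>j\<close> by nearby group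
  elements are uniformly close, and a Lipschitz function of tiny L2 norm is small everywhere, because a
  ball of radius \<open>r\<close> has Haar measure at least \<open>(r / d)\<close> to the power \<open>O(d\<^sup>2)\<close> (\<open>ball_measure_ge\<close>,
  \<open>sup_le_of_sq_norm\<close>). It remains to make the L2 norm of a mean-zero \<open>f\<close> decay by a factor \<open>1 + \<delta>\<close> per
  bounded number of steps, with \<open>1 / \<delta>\<close> polynomial in \<open>d\<close> and in the logarithm of the target size.

  The loss of norm in one step is a variance: \<open>\<parallel>f\<^sub>j\<parallel>\<^sup>2 - \<parallel>f\<^sub>j\<^sub>+\<^sub>1\<parallel>\<^sup>2\<close> is the \<open>\<nu>\<close>-average of
  \<open>\<parallel>f\<^sub>j(g \<cdot>) - f\<^sub>j\<^sub>+\<^sub>1\<parallel>\<^sup>2\<close> (\<open>variance_identity\<close>). If the norm hardly drops over a block of \<open>2 k\<close> steps, then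
  each typical generator moves \<open>f\<^sub>j\<close> approximately to \<open>f\<^sub>j\<^sub>+\<^sub>1\<close>, its inverse moves \<open>f\<^sub>j\<^sub>+\<^sub>1\<close> back to \<open>f\<^sub>j\<close>, and a
  word of length at most \<open>k\<close> with exponent sum zero approximately fixes the middle function \<open>f\<^sub>k\<close>
  (\<open>word_displacement\<close>). Words of exponent sum zero are still dense in
  \<open>SU(2)\<close>, because every element of \<open>SU(2)\<close> is a commutator; finitely many of them form a net, and the net
  survives small perturbations of the letters, so the letters may be any points of fixed neighbourhoods
  of positive \<open>\<eta>\<close>-measure (\<open>balanced_word_net\<close>).

  The displacement \<open>p(g) = \<parallel>f(g \<cdot>) - f\<parallel>\<close> is a length function on the group and is bounded by the
  distance of \<open>g\<close> to 1. The Solovay-Kitaev iteration therefore improves a bound \<open>B\<close> for \<open>p\<close> on a coarse net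
  of \<open>SU(2)\<close> to the bound \<open>5\<^sup>n B + exp (- (3/2)\<^sup>n) / 9\<close> for \<open>p\<close> on all embedded copies of \<open>SU(2)\<close>
  (\<open>solovay_kitaev\<close>); reaching accuracy \<open>\<rho>\<close> costs only a power of \<open>ln (1 / \<rho>)\<close>. Givens rotations write each
  element of \<open>SU(d)\<close> as a product of at most \<open>d\<^sup>2\<close> embedded elements (\<open>length_bound_SU\<close>), so \<open>p\<close> is small
  on the whole group. Averaging over the group then shows that a mean-zero \<open>f\<close> itself is small
  (\<open>norm_le_displacement\<close>), which contradicts a norm above the target size (\<open>block_contraction\<close>,
  \<open>geometric_decay\<close>).
\<close>

section \<open>The operator norm on unitary matrices\<close>

lemma l2_norm_mult_vec_le:
  assumes "v \<in> carrier_vec (dim_col A)"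
  shows "l2_norm (A *\<^sub>v v) \<le> op_norm A * l2_norm v"
proof (cases "l2_norm v = 0")
  case True
  have "vec_index v i = 0" if "i < dim_vec v" for i
    using l2_norm_component[OF that] True by simp
  then have "A *\<^sub>v v = 0\<^sub>v (dim_row A)"
    using assms by (intro eq_vecI) (auto simp: scalar_prod_def intro!: sum.neutral)
  then show ?thesis using True by (simp add: l2_norm_zero)
next
  case False
  define a where "a = l2_norm v"
  have a: "a > 0" using False l2_norm_nonneg[of v] by (simp add: a_def)
  define u where "u = complex_of_real (1 / a) \<cdot>\<^sub>v v"
  have u: "u \<in> carrier_vec (dim_col A)" using assms by (simp add: u_def)
  have "l2_norm u = 1" using a by (simp add: u_def l2_norm_smult a_def norm_divide)
  then have *: "l2_norm (A *\<^sub>v u) \<le> op_norm A" using u by (intro op_norm_bound) auto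
  have "v = complex_of_real a \<cdot>\<^sub>v u" using a by (simp add: u_def smult_smult_assoc)
  then have "A *\<^sub>v v = complex_of_real a \<cdot>\<^sub>v (A *\<^sub>v u)"
    using u by (metis mult_mat_vec carrier_matI)
  then have "l2_norm (A *\<^sub>v v) = a * l2_norm (A *\<^sub>v u)" using a by (simp add: l2_norm_smult)
  with * a show ?thesis by (simp add: a_def mult.commute mult_left_mono)
qed

lemma op_norm_mult:
  assumes "A \<in> carrier_mat n m" "B \<in> carrier_mat m k"
  shows "op_norm (A * B) \<le> op_norm A * op_norm B"
proof (rule op_norm_leI)
  fix v assume v: "v \<in> carrier_vec (dim_col (A * B))" "l2_norm v \<le> 1"
  then have "(A * B) *\<^sub>v v = A *\<^sub>v (B *\<^sub>v v)" using assms by (intro assoc_mult_mat_vec) auto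
  then have "l2_norm ((A * B) *\<^sub>v v) \<le> op_norm A * l2_norm (B *\<^sub>v v)"
    using l2_norm_mult_vec_le[of "B *\<^sub>v v" A] assms v by (simp add: mult_mat_vec_carrier[of _ m k])
  also have "\<dots> \<le> op_norm A * op_norm B"
    using v assms by (intro mult_left_mono op_norm_bound op_norm_nonneg) auto
  finally show "l2_norm (A * B *\<^sub>v v) \<le> op_norm A * op_norm B" .
qed

lemma norm_entry_le_op_norm:
  assumes "i < dim_row A" "j < dim_col A"
  shows "norm (A $$ (i, j)) \<le> op_norm A"
proof -
  let ?e = "unit_vec (dim_col A) j :: complex vec"
  have "(\<Sum>i<dim_col A. (norm (vec_index ?e i))\<^sup>2) = (\<Sum>i<dim_col A. if i = j then 1 else 0)"
    by (rule sum.cong) (auto simp: unit_vec_def)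
  then have "l2_norm ?e = 1" using assms by (simp add: l2_norm_def L2_set_def)
  then have "l2_norm (A *\<^sub>v ?e) \<le> op_norm A" by (intro op_norm_bound) auto
  moreover have "norm (vec_index (A *\<^sub>v ?e) i) \<le> l2_norm (A *\<^sub>v ?e)"
    using assms by (intro l2_norm_component) auto
  moreover have "vec_index (A *\<^sub>v ?e) i = A $$ (i, j)"
    using assms by (simp add: scalar_prod_right_unit)
  ultimately show ?thesis by (simp del: index_mult_mat_vec)
qed

lemma op_norm_le_sum_entries:
  "op_norm A \<le> (\<Sum>i<dim_row A. \<Sum>j<dim_col A. norm (A $$ (i, j)))"
proof (rule op_norm_leI)
  fix v assume v: "v \<in> carrier_vec (dim_col A)" "l2_norm v \<le> 1"
  have comp: "norm (vec_index v j) \<le> 1" if "j < dim_col A" for j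
    using l2_norm_component[of j v] v that by auto
  have "l2_norm (A *\<^sub>v v) \<le> (\<Sum>i<dim_row A. norm (vec_index (A *\<^sub>v v) i))"
    unfolding l2_norm_def dim_mult_mat_vec by (rule L2_set_le_sum) simp
  also have "\<dots> \<le> (\<Sum>i<dim_row A. \<Sum>j<dim_col A. norm (A $$ (i, j)))"
  proof (rule sum_mono)
    fix i assume i: "i \<in> {..<dim_row A}"
    have "vec_index (A *\<^sub>v v) i = (\<Sum>j<dim_col A. A $$ (i, j) * vec_index v j)"
      using i v by (auto simp: scalar_prod_def atLeast0LessThan intro!: sum.cong)
    also have "norm \<dots> \<le> (\<Sum>j<dim_col A. norm (A $$ (i, j)))"
      by (rule sum_norm_le) (auto simp: norm_mult intro!: mult_left_le comp)
    finally show "norm (vec_index (A *\<^sub>v v) i) \<le> (\<Sum>j<dim_col A. norm (A $$ (i, j)))" .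
  qed
  finally show "l2_norm (A *\<^sub>v v) \<le> (\<Sum>i<dim_row A. \<Sum>j<dim_col A. norm (A $$ (i, j)))" .
qed

lemma index_mult_sum:
  assumes "g \<in> carrier_mat d d" "h \<in> carrier_mat d d" "i < d" "j < d"
  shows "(g * h) $$ (i, j) = (\<Sum>k<d. g $$ (i, k) * h $$ (k, j))"
  using assms by (auto simp: scalar_prod_def atLeast0LessThan intro!: sum.cong)

lemma SU_cols_orthonormal:
  assumes "g \<in> SU d" "j < d" "k < d"
  shows "(\<Sum>i<d. cnj (g $$ (i, j)) * g $$ (i, k)) = (if j = k then 1 else 0)"
proof -
  have g: "g \<in> carrier_mat d d" "mat_adjoint g * g = 1\<^sub>m d" using assms by (auto simp: SU_def)
  have "(mat_adjoint g * g) $$ (j, k) = (\<Sum>i<d. mat_adjoint g $$ (j, i) * g $$ (i, k))"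
    using g assms adjoint_carrier[OF g(1)] by (intro index_mult_sum) auto
  also have "\<dots> = (\<Sum>i<d. cnj (g $$ (i, j)) * g $$ (i, k))"
    using g assms by (intro sum.cong) (auto simp: index_adjoint)
  finally show ?thesis using g assms by simp
qed

lemma SU_adjoint_right: "g \<in> SU d \<Longrightarrow> g * mat_adjoint g = 1\<^sub>m d"
  using SU_adjoint[of g d] by (auto simp: SU_def adjoint_adjoint)

lemma SU_adjoint_left: "g \<in> SU d \<Longrightarrow> mat_adjoint g * g = 1\<^sub>m d"
  by (auto simp: SU_def)

lemma l2_norm_SU_mult_vec:
  assumes g: "g \<in> SU d" and v: "v \<in> carrier_vec d"
  shows "l2_norm (g *\<^sub>v v) = l2_norm v"
proof -
  have gc: "g \<in> carrier_mat d d" using g by (rule SU_carrier)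
  have sq: "complex_of_real ((l2_norm w)\<^sup>2) = (\<Sum>i<d. cnj (vec_index w i) * vec_index w i)"
    if "w \<in> carrier_vec d" for w
  proof -
    have "(l2_norm w)\<^sup>2 = (\<Sum>i<d. (norm (vec_index w i))\<^sup>2)"
      using that by (simp add: l2_norm_def L2_set_def sum_nonneg)
    then show ?thesis by (simp add: mult.commute[of "cnj _"] flip: complex_norm_square)
  qed
  have ent: "vec_index (g *\<^sub>v v) i = (\<Sum>j<d. g $$ (i, j) * vec_index v j)" if "i < d" for i
    using gc v that by (auto simp: scalar_prod_def atLeast0LessThan intro!: sum.cong)
  have "(\<Sum>i<d. cnj (vec_index (g *\<^sub>v v) i) * vec_index (g *\<^sub>v v) i) =
      (\<Sum>i<d. \<Sum>j<d. \<Sum>k<d. cnj (vec_index v j) * vec_index v k * (cnj (g $$ (i, j)) * g $$ (i, k)))"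
    by (intro sum.cong refl, simp only: ent lessThan_iff cnj_sum sum_product)
       (intro sum.cong refl, simp)
  also have "\<dots> = (\<Sum>j<d. \<Sum>k<d. \<Sum>i<d. cnj (vec_index v j) * vec_index v k * (cnj (g $$ (i, j)) * g $$ (i, k)))"
    by (subst sum.swap) (intro sum.cong refl sum.swap)
  also have "\<dots> = (\<Sum>j<d. \<Sum>k<d. cnj (vec_index v j) * vec_index v k * (if j = k then 1 else 0))"
    by (intro sum.cong refl) (simp add: SU_cols_orthonormal[OF g] flip: sum_distrib_left)
  also have "\<dots> = (\<Sum>j<d. cnj (vec_index v j) * vec_index v j)"
    by (intro sum.cong) (auto simp: if_distrib cong: if_cong)
  finally have "complex_of_real ((l2_norm (g *\<^sub>v v))\<^sup>2) = complex_of_real ((l2_norm v)\<^sup>2)"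
    using sq[of v] sq[of "g *\<^sub>v v"] gc v by simp
  then have "(l2_norm (g *\<^sub>v v))\<^sup>2 = (l2_norm v)\<^sup>2" by (simp only: of_real_eq_iff)
  then show ?thesis by (simp add: l2_norm_nonneg)
qed

lemma op_norm_SU_le: "g \<in> SU d \<Longrightarrow> op_norm g \<le> 1"
  using SU_carrier[of g d] by (intro op_norm_leI) (auto simp: l2_norm_SU_mult_vec)

lemma op_norm_SU_mult_left:
  assumes "g \<in> SU d" "A \<in> carrier_mat d d"
  shows "op_norm (g * A) = op_norm A"
proof (rule antisym)
  have *: "op_norm (h * B) \<le> op_norm B" if "h \<in> SU d" "B \<in> carrier_mat d d" for h B
    using op_norm_mult[OF SU_carrier[OF that(1)] that(2)] op_norm_SU_le[OF that(1)] op_norm_nonneg[of B]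
    by (meson mult_left_le_one_le op_norm_nonneg order_trans)
  show "op_norm (g * A) \<le> op_norm A" using * assms by auto
  have "mat_adjoint g * (g * A) = A"
    using assms SU_carrier[OF assms(1)] SU_carrier[OF SU_adjoint[OF assms(1)]]
    by (simp add: SU_adjoint_left[OF assms(1)] flip: assoc_mult_mat[of _ d d _ d _ d])
  with *[OF SU_adjoint[OF assms(1)], of "g * A"] SU_carrier[OF assms(1)] assms(2)
  show "op_norm A \<le> op_norm (g * A)" by auto
qed

lemma op_norm_SU_mult_right:
  assumes "g \<in> SU d" "A \<in> carrier_mat d d"
  shows "op_norm (A * g) = op_norm A"
proof (rule antisym)
  have *: "op_norm (B * h) \<le> op_norm B" if "h \<in> SU d" "B \<in> carrier_mat d d" for h B
    using op_norm_mult[OF that(2) SU_carrier[OF that(1)]] op_norm_SU_le[OF that(1)] op_norm_nonneg[of B]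
    by (meson mult_right_le_one_le op_norm_nonneg order_trans)
  show "op_norm (A * g) \<le> op_norm A" using * assms by auto
  have "(A * g) * mat_adjoint g = A"
    using assms SU_carrier[OF assms(1)] SU_carrier[OF SU_adjoint[OF assms(1)]]
    by (simp add: SU_adjoint_right[OF assms(1)] assoc_mult_mat[of _ d d _ d _ d])
  with *[OF SU_adjoint[OF assms(1)], of "A * g"] SU_carrier[OF assms(1)] assms(2)
  show "op_norm A \<le> op_norm (A * g)" by auto
qed

lemma op_dist_eq: "g \<in> carrier_mat d d \<Longrightarrow> h \<in> carrier_mat d d \<Longrightarrow> op_dist g h = op_norm (g - h)"
  by (simp add: op_dist_def)

lemma op_dist_mult_left:
  assumes "g \<in> SU d" "x \<in> SU d" "y \<in> SU d"
  shows "op_dist (g * x) (g * y) = op_dist x y"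
proof -
  note c = SU_carrier[OF assms(1)] SU_carrier[OF assms(2)] SU_carrier[OF assms(3)]
  have "g * x - g * y = g * (x - y)" using c by (simp add: mult_minus_distrib_mat)
  then show ?thesis using c assms op_norm_SU_mult_left[of g d "x - y"]
    by (simp add: op_dist_def minus_carrier_mat)
qed

lemma op_dist_mult_right:
  assumes "g \<in> SU d" "x \<in> SU d" "y \<in> SU d"
  shows "op_dist (x * g) (y * g) = op_dist x y"
proof -
  note c = SU_carrier[OF assms(1)] SU_carrier[OF assms(2)] SU_carrier[OF assms(3)]
  have "x * g - y * g = (x - y) * g" using c by (simp add: minus_mult_distrib_mat)
  then show ?thesis using c assms op_norm_SU_mult_right[of g d "x - y"]
    by (simp add: op_dist_def minus_carrier_mat)
qed

lemma op_dist_SU_le_2: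
  assumes "g \<in> SU d" "h \<in> SU d"
  shows "op_dist g h \<le> 2"
proof -
  note c = SU_carrier[OF assms(1)] SU_carrier[OF assms(2)]
  have "g - h = g + - h" using c by (intro eq_matI) auto
  then have "op_norm (g - h) \<le> op_norm g + op_norm (- h)"
    using op_norm_triangle[of g d d "- h"] c by simp
  with op_norm_uminus_le[OF c(2)] op_norm_SU_le[OF assms(1)] op_norm_SU_le[OF assms(2)]
  show ?thesis using assms by (simp add: op_dist_SU)
qed

text \<open>
  Since \<open>g h - h g = (g - 1) (h - 1) - (h - 1) (g - 1)\<close>, the difference \<open>[g, h] - 1 = (g h - h g) g\<^sup>-\<^sup>1 h\<^sup>-\<^sup>1\<close>
  is of second order.
\<close>

lemma op_dist_commutator:
  assumes "g \<in> SU d" "h \<in> SU d"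
  shows "op_dist (g * h * mat_adjoint g * mat_adjoint h) (1\<^sub>m d) \<le> 2 * op_dist g (1\<^sub>m d) * op_dist h (1\<^sub>m d)"
proof -
  note S = assms SU_adjoint[OF assms(1)] SU_adjoint[OF assms(2)]
  note c = S[THEN SU_carrier]
  let ?I = "1\<^sub>m d :: complex mat"
  define G where "G = g - ?I"
  define H where "H = h - ?I"
  have GH: "G \<in> carrier_mat d d" "H \<in> carrier_mat d d" using c by (auto simp: G_def H_def)
  have gh: "g = G + ?I" "h = H + ?I" using c by (auto simp: G_def H_def intro!: eq_matI)
  have "g * h * mat_adjoint g * mat_adjoint h = (g * h) * (mat_adjoint g * mat_adjoint h)"
    using c by (simp add: assoc_mult_mat[of _ d d _ d _ d])
  moreover have "?I = (h * g) * (mat_adjoint g * mat_adjoint h)"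
  proof -
    have "(h * g) * (mat_adjoint g * mat_adjoint h) = h * ((g * mat_adjoint g) * mat_adjoint h)"
      using c by (simp add: assoc_mult_mat[of _ d d _ d _ d])
    then show ?thesis using c SU_adjoint_right assms by simp
  qed
  ultimately have "op_dist (g * h * mat_adjoint g * mat_adjoint h) ?I
      = op_dist ((g * h) * (mat_adjoint g * mat_adjoint h)) ((h * g) * (mat_adjoint g * mat_adjoint h))"
    by simp
  also have "\<dots> = op_dist (g * h) (h * g)"
    using S by (intro op_dist_mult_right SU_mult)
  also have "\<dots> = op_norm (g * h - h * g)" using c by (intro op_dist_eq) auto
  also have "g * h - h * g = G * H - H * G"
  proof -
    have ex: "g * h = G * H + G + H + ?I" "h * g = H * G + H + G + ?I"
      unfolding gh using GH
      by (auto simp: add_mult_distrib_mat[of _ d d] mult_add_distrib_mat[of _ d d] intro!: eq_matI)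
    show ?thesis unfolding ex using GH by (intro eq_matI) auto
  qed
  also have "\<dots> = G * H + - (H * G)" using GH by (intro eq_matI) auto
  also have "op_norm \<dots> \<le> op_norm (G * H) + op_norm (- (H * G))"
    using GH by (intro op_norm_triangle) auto
  also have "\<dots> \<le> op_norm G * op_norm H + op_norm H * op_norm G"
    using op_norm_uminus_le[OF mult_carrier_mat[OF GH(2,1)]] op_norm_mult[OF GH] op_norm_mult[OF GH(2,1)] by linarith
  also have "\<dots> = 2 * op_dist g ?I * op_dist h ?I"
    using c by (simp add: G_def H_def op_dist_eq)
  finally show ?thesis .
qed


section \<open>Solovay-Kitaev approximation in metric groups\<close>

text \<open>
  What the Solovay-Kitaev iteration needs of a group with a bi-invariant metric: commutators of elements
  near 1 are quadratically near 1, and conversely an element at distance \<open>r\<close> from 1 is a commutator of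
  two elements at distance at most \<open>\<surd>r\<close>.
\<close>

locale commutator_metric_group = group G for G (structure) +
  fixes dst :: "'a \<Rightarrow> 'a \<Rightarrow> real"
  assumes dist_nonneg: "x \<in> carrier G \<Longrightarrow> y \<in> carrier G \<Longrightarrow> 0 \<le> dst x y"
    and dist_sym: "x \<in> carrier G \<Longrightarrow> y \<in> carrier G \<Longrightarrow> dst x y = dst y x"
    and dist_triangle: "x \<in> carrier G \<Longrightarrow> y \<in> carrier G \<Longrightarrow> z \<in> carrier G \<Longrightarrow> dst x z \<le> dst x y + dst y z"
    and dist_left: "g \<in> carrier G \<Longrightarrow> x \<in> carrier G \<Longrightarrow> y \<in> carrier G \<Longrightarrow> dst (g \<otimes> x) (g \<otimes> y) = dst x y"
    and dist_right: "g \<in> carrier G \<Longrightarrow> x \<in> carrier G \<Longrightarrow> y \<in> carrier G \<Longrightarrow> dst (x \<otimes> g) (y \<otimes> g) = dst x y"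
    and dist_commutator: "x \<in> carrier G \<Longrightarrow> y \<in> carrier G \<Longrightarrow>
      dst (x \<otimes> y \<otimes> inv x \<otimes> inv y) \<one> \<le> 2 * dst x \<one> * dst y \<one>"
    and commutator_root: "g \<in> carrier G \<Longrightarrow>
      \<exists>u\<in>carrier G. \<exists>v\<in>carrier G. g = u \<otimes> v \<otimes> inv u \<otimes> inv v \<and>
        (dst u \<one>)\<^sup>2 \<le> dst g \<one> \<and> (dst v \<one>)\<^sup>2 \<le> dst g \<one>"
begin

lemma dist_inv_mult:
  assumes "x \<in> carrier G" "y \<in> carrier G"
  shows "dst (inv x \<otimes> y) \<one> = dst y x" "dst (y \<otimes> inv x) \<one> = dst y x"
  using dist_left[of "inv x" y x] dist_right[of "inv x" y x] assms by simp_all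

lemma dist_conj:
  assumes "g \<in> carrier G" "x \<in> carrier G"
  shows "dst (g \<otimes> x \<otimes> inv g) \<one> = dst x \<one>"
proof -
  have "dst (g \<otimes> x \<otimes> inv g) (g \<otimes> \<one> \<otimes> inv g) = dst x \<one>"
    using assms by (subst dist_right, simp_all only: inv_closed m_closed one_closed) (rule dist_left, auto)
  then show ?thesis using assms by simp
qed

definition commutator :: "'a \<Rightarrow> 'a \<Rightarrow> 'a" where
  "commutator x y = x \<otimes> y \<otimes> inv x \<otimes> inv y"

lemma commutator_closed: "x \<in> carrier G \<Longrightarrow> y \<in> carrier G \<Longrightarrow> commutator x y \<in> carrier G"
  by (simp add: commutator_def)

lemma inv_cancel_left:
  assumes "a \<in> carrier G" "b \<in> carrier G"
  shows "inv a \<otimes> (a \<otimes> b) = b" "a \<otimes> (inv a \<otimes> b) = b"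
  using assms by (simp_all flip: m_assoc)

lemma commutator_mult_left:
  assumes "x \<in> carrier G" "a \<in> carrier G" "y \<in> carrier G"
  shows "commutator (x \<otimes> a) y = x \<otimes> commutator a y \<otimes> inv x \<otimes> commutator x y"
  using assms by (simp add: commutator_def inv_mult_group m_assoc inv_cancel_left)

lemma commutator_mult_right:
  assumes "x \<in> carrier G" "b \<in> carrier G" "y \<in> carrier G"
  shows "commutator x (y \<otimes> b) = commutator x y \<otimes> (y \<otimes> commutator x b \<otimes> inv y)"
  using assms by (simp add: commutator_def inv_mult_group m_assoc inv_cancel_left)

text \<open>
  Writing \<open>x' = x a\<close> and \<open>y' = y b\<close>, the commutator identities for products turn the change from
  \<open>[x, y]\<close> to \<open>[x', y']\<close> into conjugates of \<open>[a, y']\<close> and \<open>[x, b]\<close>. Hence an error in one argument is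
  damped by the distance of the other argument from 1.
\<close>

lemma dist_commutator_commutator:
  assumes "x \<in> carrier G" "y \<in> carrier G" "x' \<in> carrier G" "y' \<in> carrier G"
  shows "dst (commutator x' y') (commutator x y) \<le> 2 * dst x' x * dst y' \<one> + 2 * dst y' y * dst x \<one>"
proof -
  define a where "a = inv x \<otimes> x'"
  define b where "b = inv y \<otimes> y'"
  have ab: "a \<in> carrier G" "b \<in> carrier G" using assms by (auto simp: a_def b_def)
  have x': "x' = x \<otimes> a" and y': "y' = y \<otimes> b"
    using assms by (simp_all add: a_def b_def m_assoc[symmetric])
  have da: "dst a \<one> = dst x' x" and db: "dst b \<one> = dst y' y"
    using assms dist_inv_mult by (simp_all add: a_def b_def)
  have "dst (commutator x' y') (commutator x y') = dst ((x \<otimes> commutator a y' \<otimes> inv x) \<otimes> commutator x y') (\<one> \<otimes> commutator x y')"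
    using assms ab commutator_closed by (simp add: x' commutator_mult_left)
  also have "\<dots> = dst (x \<otimes> commutator a y' \<otimes> inv x) \<one>"
    using assms ab commutator_closed by (intro dist_right) auto
  also have "\<dots> = dst (commutator a y') \<one>"
    using assms ab commutator_closed by (intro dist_conj) auto
  also have "\<dots> \<le> 2 * dst x' x * dst y' \<one>"
    using dist_commutator[of a y'] assms ab da by (simp add: commutator_def)
  finally have 1: "dst (commutator x' y') (commutator x y') \<le> 2 * dst x' x * dst y' \<one>" .
  have "dst (commutator x y') (commutator x y) = dst (commutator x y \<otimes> (y \<otimes> commutator x b \<otimes> inv y)) (commutator x y \<otimes> \<one>)"
    using assms ab commutator_closed by (simp add: y' commutator_mult_right)
  also have "\<dots> = dst (y \<otimes> commutator x b \<otimes> inv y) \<one>"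
    using assms ab commutator_closed by (intro dist_left) auto
  also have "\<dots> = dst (commutator x b) \<one>"
    using assms ab commutator_closed by (intro dist_conj) auto
  also have "\<dots> \<le> 2 * dst x \<one> * dst y' y"
    using dist_commutator[of x b] assms ab db by (simp add: commutator_def)
  finally have 2: "dst (commutator x y') (commutator x y) \<le> 2 * dst y' y * dst x \<one>" by (simp add: mult_ac)
  show ?thesis
    using 1 2 dist_triangle[of "commutator x' y'" "commutator x y'" "commutator x y"] assms commutator_closed
    by force
qed

text \<open>
  With approximations of accuracy \<open>e\<^sup>2\<close> at hand, the remaining error \<open>h = g w\<^sub>0\<^sup>-\<^sup>1\<close> of an approximation \<open>w\<^sub>0\<close>
  of \<open>g\<close> is a commutator \<open>[u, v]\<close> with \<open>u\<close>, \<open>v\<close> within \<open>e\<close> of 1. Replacing \<open>u\<close> and \<open>v\<close> by approximations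
  \<open>u'\<close> and \<open>v'\<close> costs an error of order \<open>e\<^sup>2 e\<close> only, and \<open>[u', v'] w\<^sub>0\<close> uses five approximations.
  Words and their lengths are replaced by an arbitrary length function \<open>p\<close>.
\<close>

lemma solovay_kitaev_step:
  assumes p_mult: "\<And>x y. x \<in> carrier G \<Longrightarrow> y \<in> carrier G \<Longrightarrow> p (x \<otimes> y) \<le> p x + p y"
    and p_inv: "\<And>x. x \<in> carrier G \<Longrightarrow> p (inv x) \<le> p x"
    and approx: "\<And>g. g \<in> carrier G \<Longrightarrow> \<exists>w\<in>carrier G. p w \<le> B \<and> dst g w \<le> e\<^sup>2"
    and e: "0 \<le> e" "e \<le> 1" and g: "g \<in> carrier G"
  shows "\<exists>w\<in>carrier G. p w \<le> 5 * (B::real) \<and> dst g w \<le> 6 * e ^ 3"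
proof -
  obtain w0 where w0: "w0 \<in> carrier G" "p w0 \<le> B" "dst g w0 \<le> e\<^sup>2" using approx[OF g] by blast
  define h where "h = g \<otimes> inv w0"
  have h: "h \<in> carrier G" "dst h \<one> \<le> e\<^sup>2" using w0 g dist_inv_mult(2)[of w0 g] by (auto simp: h_def)
  obtain u v where uv: "u \<in> carrier G" "v \<in> carrier G" "h = u \<otimes> v \<otimes> inv u \<otimes> inv v"
      "(dst u \<one>)\<^sup>2 \<le> dst h \<one>" "(dst v \<one>)\<^sup>2 \<le> dst h \<one>"
    using commutator_root[OF h(1)] by blast
  have du: "dst u \<one> \<le> e" and dv: "dst v \<one> \<le> e"
    using uv(4,5) h(2) e by (meson order_trans power2_le_imp_le)+
  obtain u' where u': "u' \<in> carrier G" "p u' \<le> B" "dst u u' \<le> e\<^sup>2" using approx[OF uv(1)] by blast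
  obtain v' where v': "v' \<in> carrier G" "p v' \<le> B" "dst v v' \<le> e\<^sup>2" using approx[OF uv(2)] by blast
  define c where "c = commutator u' v'"
  have c: "c \<in> carrier G" using u' v' by (simp add: c_def commutator_closed)
  have "dst (commutator u v) c \<le> 2 * dst u u' * dst v \<one> + 2 * dst v v' * dst u' \<one>"
    unfolding c_def using uv u' v' by (intro dist_commutator_commutator) auto
  also have "\<dots> \<le> 2 * e\<^sup>2 * e + 2 * e\<^sup>2 * (e + e\<^sup>2)"
  proof (intro add_mono mult_mono)
    show "dst u' \<one> \<le> e + e\<^sup>2"
      using dist_triangle[of u' u \<one>] dist_sym[of u u'] uv u' du by auto
  qed (use uv u' v' du dv e dist_nonneg in auto)
  also have "\<dots> \<le> 6 * e ^ 3"
  proof -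
    have "e\<^sup>2 * e\<^sup>2 \<le> e\<^sup>2 * e" using e by (intro mult_left_mono) (auto simp: power2_eq_square mult_left_le)
    then show ?thesis by (simp add: power2_eq_square power3_eq_cube algebra_simps)
  qed
  finally have dc: "dst h c \<le> 6 * e ^ 3" using uv(3) by (simp add: commutator_def)
  have "g = h \<otimes> w0" using g w0 by (simp add: h_def m_assoc)
  then have "dst g (c \<otimes> w0) \<le> 6 * e ^ 3" using dc dist_right[of w0 h c] w0 h c by simp
  moreover have "p (c \<otimes> w0) \<le> 5 * B"
  proof -
    have "p c \<le> p u' + p v' + p (inv u') + p (inv v')"
      unfolding c_def commutator_def using u' v'
        p_mult[of "u' \<otimes> v' \<otimes> inv u'" "inv v'"] p_mult[of "u' \<otimes> v'" "inv u'"] p_mult[of u' v']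
      by auto
    then show ?thesis
      using p_mult[OF c w0(1)] p_inv[OF u'(1)] p_inv[OF v'(1)] u' v' w0 by linarith
  qed
  ultimately show ?thesis using c w0 by blast
qed

text \<open>
  In terms of \<open>36 e\<close>, where \<open>e\<close> is the accuracy, the recursion \<open>e \<mapsto> 6 e\<^bsup>3/2\<^esup>\<close> of the step above reads
  \<open>t \<mapsto> t\<^bsup>3/2\<^esup>\<close>. The starting accuracy 1/108 is chosen so that \<open>t \<le> 1/3 \<le> exp (- 1)\<close> initially.
\<close>

theorem solovay_kitaev:
  assumes p_mult: "\<And>x y. x \<in> carrier G \<Longrightarrow> y \<in> carrier G \<Longrightarrow> p (x \<otimes> y) \<le> p x + p y"
    and p_inv: "\<And>x. x \<in> carrier G \<Longrightarrow> p (inv x) \<le> p x"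
    and net: "\<And>g. g \<in> carrier G \<Longrightarrow> \<exists>w\<in>carrier G. p w \<le> B \<and> dst g w \<le> 1 / 108"
    and g: "g \<in> carrier G"
  shows "\<exists>w\<in>carrier G. p w \<le> 5 ^ n * (B::real) \<and> dst g w \<le> exp (- ((3/2) ^ n)) / 36"
  using g
proof (induction n arbitrary: g)
  case 0
  have "(1 / 108::real) \<le> exp (- 1) / 36"
    using exp_le by (simp add: exp_minus field_simps)
  then show ?case using net[OF 0] by force
next
  case (Suc n)
  define e where "e = exp (- ((3/2) ^ n) / 2) / (6::real)"
  have e2: "e\<^sup>2 = exp (- ((3/2) ^ n)) / 36"
    by (simp add: e_def power_divide flip: exp_of_nat_mult)
  have e3: "6 * e ^ 3 = exp (- ((3/2) ^ Suc n)) / 36"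
    by (simp add: e_def power_divide flip: exp_of_nat_mult)
  have e1: "0 \<le> e" "e \<le> 1"
  proof -
    have "exp (- ((3/2) ^ n) / 2) \<le> (1::real)" by simp
    then have "exp (- ((3/2) ^ n) / 2) \<le> (6::real)" by linarith
    then show "0 \<le> e" "e \<le> 1" by (auto simp: e_def)
  qed
  show ?case
    using solovay_kitaev_step[OF p_mult p_inv _ e1 Suc.prems, of "5 ^ n * B"] Suc.IH
    unfolding e2 e3 by (simp add: mult.assoc)
qed

end


section \<open>Commutators in SU(2)\<close>

text \<open>The quaternion \<open>a + b j\<close>, so that \<open>SU(2)\<close> is the group of unit quaternions and 1, i, j are \<open>quat 1 0\<close>,
  \<open>quat \<i> 0\<close>, \<open>quat 0 1\<close>.\<close>

definition quat :: "complex \<Rightarrow> complex \<Rightarrow> complex mat" where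
  "quat a b = mat 2 2 (\<lambda>(i, j). if i = 0 then (if j = 0 then a else b) else (if j = 0 then - cnj b else cnj a))"

lemma quat_carrier [simp]: "quat a b \<in> carrier_mat 2 2"
  and quat_dim [simp]: "dim_row (quat a b) = 2" "dim_col (quat a b) = 2"
  by (simp_all add: quat_def)

lemma quat_index [simp]:
  "quat a b $$ (0, 0) = a" "quat a b $$ (0, Suc 0) = b"
  "quat a b $$ (Suc 0, 0) = - cnj b" "quat a b $$ (Suc 0, Suc 0) = cnj a"
  by (simp_all add: quat_def)

lemma mat_2_eqI:
  assumes "A \<in> carrier_mat 2 2" "B \<in> carrier_mat 2 2"
    "A $$ (0, 0) = B $$ (0, 0)" "A $$ (0, Suc 0) = B $$ (0, Suc 0)"
    "A $$ (Suc 0, 0) = B $$ (Suc 0, 0)" "A $$ (Suc 0, Suc 0) = B $$ (Suc 0, Suc 0)"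
  shows "A = B"
  using assms by (intro eq_matI) (auto simp: less_2_cases_iff)

lemma mat_2_mult_index:
  assumes "A \<in> carrier_mat 2 2" "B \<in> carrier_mat 2 2" "i < 2" "j < 2"
  shows "(A * B) $$ (i, j) = A $$ (i, 0) * B $$ (0, j) + A $$ (i, Suc 0) * B $$ (Suc 0, j)"
  using index_mult_sum[OF assms] by (simp add: numeral_2_eq_2)

lemma quat_mult: "quat a b * quat c d = quat (a * c - b * cnj d) (a * d + b * cnj c)"
  by (rule mat_2_eqI) (auto simp: mat_2_mult_index[OF quat_carrier quat_carrier] algebra_simps simp del: index_mult_mat(1))

lemma quat_adjoint: "mat_adjoint (quat a b) = quat (cnj a) (- b)"
  by (rule mat_2_eqI) (auto simp: index_adjoint[OF quat_carrier] adjoint_carrier)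

lemma quat_one: "1\<^sub>m 2 = quat 1 0"
  by (rule mat_2_eqI) auto

lemma quat_minus: "quat a b - quat c d = quat (a - c) (b - d)"
  by (rule mat_2_eqI) auto

lemma det_mat_2:
  assumes "A \<in> carrier_mat 2 2"
  shows "det A = A $$ (0, 0) * A $$ (Suc 0, Suc 0) - A $$ (0, Suc 0) * A $$ (Suc 0, 0)"
proof -
  have del: "mat_delete A 0 j \<in> carrier_mat 1 1" for j using assms by (simp add: mat_delete_def)
  have "det A = (\<Sum>j<2. A $$ (0, j) * cofactor A 0 j)"
    using assms by (intro laplace_expansion_row) auto
  then show ?thesis
    using assms det_single[OF del[of 0]] det_single[OF del[of "Suc 0"]]
    by (simp add: numeral_2_eq_2 cofactor_def mat_delete_def)
qed

lemma quat_in_SU: "(cmod a)\<^sup>2 + (cmod b)\<^sup>2 = 1 \<Longrightarrow> quat a b \<in> SU 2"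
proof -
  assume "(cmod a)\<^sup>2 + (cmod b)\<^sup>2 = 1"
  then have 1: "a * cnj a + b * cnj b = 1"
    by (metis complex_norm_square of_real_1 of_real_add)
  have "cnj a * a + b * cnj b = 1" using 1 by (simp add: mult.commute)
  then show ?thesis using 1 unfolding SU_def
    by (simp add: quat_adjoint quat_mult quat_one det_mat_2[OF quat_carrier] mult.commute)
qed

lemma SU_2_quatE:
  assumes "g \<in> SU 2"
  obtains a b where "g = quat a b" "(cmod a)\<^sup>2 + (cmod b)\<^sup>2 = 1"
proof -
  define a b c e where "a = g $$ (0, 0)" and "b = g $$ (0, Suc 0)" and "c = g $$ (Suc 0, 0)" and "e = g $$ (Suc 0, Suc 0)"
  have g: "g \<in> carrier_mat 2 2" "det g = 1" using assms by (auto simp: SU_def)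
  have d: "a * e - b * c = 1" using det_mat_2[OF g(1)] g(2) by (simp add: a_def b_def c_def e_def)
  have o: "cnj a * a + cnj c * c = 1" "cnj b * b + cnj e * e = 1" "cnj a * b + cnj c * e = 0"
    using SU_cols_orthonormal[OF assms, of 0 0] SU_cols_orthonormal[OF assms, of 1 1] SU_cols_orthonormal[OF assms, of 0 1]
    by (auto simp: numeral_2_eq_2 a_def b_def c_def e_def)
  \<comment> \<open>Cramer's rule for the system \<open>a e - b c = 1\<close>, \<open>cnj c * e + cnj a * b = 0\<close> in the unknowns \<open>e\<close>, \<open>b\<close>.\<close>
  have "e = cnj a"
  proof -
    have "e * (cnj a * a + cnj c * c) = cnj a * (a * e - b * c) + c * (cnj a * b + cnj c * e)" by (simp add: algebra_simps)
    then show ?thesis using o d by simp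
  qed
  moreover have "b = - cnj c"
  proof -
    have "b * (cnj a * a + cnj c * c) = a * (cnj a * b + cnj c * e) - cnj c * (a * e - b * c)" by (simp add: algebra_simps)
    then show ?thesis using o d by simp
  qed
  ultimately have e: "e = cnj a" and c: "c = - cnj b" by auto
  have "g = quat a b"
    using g e c by (intro mat_2_eqI) (auto simp: a_def b_def c_def e_def)
  moreover have "complex_of_real ((cmod a)\<^sup>2 + (cmod b)\<^sup>2) = 1"
    using o(1) c by (simp only: of_real_add complex_norm_square) (simp add: mult.commute)
  then have "(cmod a)\<^sup>2 + (cmod b)\<^sup>2 = 1" using of_real_eq_1_iff by blast
  ultimately show ?thesis using that by blast
qed

text \<open>A quaternion is a unitary matrix times a real scalar, its modulus.\<close>

lemma op_norm_quat: "op_norm (quat a b) = sqrt ((cmod a)\<^sup>2 + (cmod b)\<^sup>2)"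
proof -
  define n where "n = sqrt ((cmod a)\<^sup>2 + (cmod b)\<^sup>2)"
  show ?thesis
  proof (cases "n = 0")
    case True
    then have "a = 0" "b = 0" by (auto simp: n_def sum_power2_eq_zero_iff)
    then have "quat a b = 0\<^sub>m 2 2" by (intro mat_2_eqI) auto
    then show ?thesis using True by (simp add: op_norm_zero n_def)
  next
    case False
    have n: "n > 0" using False by (auto simp: n_def less_le)
    define u where "u = quat (a / of_real n) (b / of_real n)"
    have "u \<in> SU 2" unfolding u_def
    proof (rule quat_in_SU)
      have "(cmod (a / of_real n))\<^sup>2 + (cmod (b / of_real n))\<^sup>2 = ((cmod a)\<^sup>2 + (cmod b)\<^sup>2) / n\<^sup>2"
        using n by (simp add: norm_divide power_divide add_divide_distrib)
      moreover have "(cmod a)\<^sup>2 + (cmod b)\<^sup>2 = n\<^sup>2" by (simp add: n_def)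
        ultimately show "(cmod (a / of_real n))\<^sup>2 + (cmod (b / of_real n))\<^sup>2 = 1" using n by simp
    qed
    moreover have "quat a b = u * quat (of_real n) 0"
      using n by (simp add: u_def quat_mult)
    ultimately have "op_norm (quat a b) = op_norm (quat (of_real n) 0)"
      by (simp add: op_norm_SU_mult_left)
    also have "\<dots> = n"
    proof (rule antisym[OF op_norm_leI])
      fix v :: "complex vec" assume v: "v \<in> carrier_vec (dim_col (quat (of_real n) 0))" "l2_norm v \<le> 1"
      have "quat (of_real n) 0 *\<^sub>v v = of_real n \<cdot>\<^sub>v v"
        using v by (intro eq_vecI) (auto simp: scalar_prod_def numeral_2_eq_2 less_Suc_eq)
      then show "l2_norm (quat (of_real n) 0 *\<^sub>v v) \<le> n"
        using v n by (simp add: l2_norm_smult mult_left_le)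
    next
      show "n \<le> op_norm (quat (of_real n) 0)"
        using norm_entry_le_op_norm[of 0 "quat (of_real n) 0" 0] n by simp
    qed
    finally show ?thesis by (simp add: n_def)
  qed
qed

lemma op_dist_quat: "op_dist (quat a b) (quat c d) = sqrt ((cmod (a - c))\<^sup>2 + (cmod (b - d))\<^sup>2)"
  by (simp add: op_dist_def quat_minus op_norm_quat)

lemma op_dist_quat_one:
  assumes "(cmod a)\<^sup>2 + (cmod b)\<^sup>2 = 1"
  shows "(op_dist (quat a b) (1\<^sub>m 2))\<^sup>2 = 2 - 2 * Re a"
proof -
  have "(op_dist (quat a b) (1\<^sub>m 2))\<^sup>2 = (cmod (a - 1))\<^sup>2 + (cmod b)\<^sup>2"
    by (simp add: quat_one op_dist_quat)
  then show ?thesis using assms unfolding cmod_power2 by (simp add: power2_eq_square algebra_simps)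
qed

text \<open>
  If \<open>g\<close> and \<open>k\<close> have the same real part, then \<open>g + g\<^sup>-\<^sup>1 = k + k\<^sup>-\<^sup>1\<close>, and this gives \<open>g h = h k\<close> for
  \<open>h = g - k\<^sup>-\<^sup>1\<close>. As a quaternion, \<open>h\<close> can be normalised to an element of \<open>SU(2)\<close> unless it vanishes.
\<close>

lemma quat_conjugate_same_trace:
  assumes "(cmod a)\<^sup>2 + (cmod b)\<^sup>2 = 1" "(cmod c)\<^sup>2 + (cmod d)\<^sup>2 = 1" "Re a = Re c"
    and "quat a b \<noteq> mat_adjoint (quat c d)"
  obtains h where "h \<in> SU 2" "quat a b = h * quat c d * mat_adjoint h"
proof -
  define p q where "p = a - cnj c" and "q = b + d"
  define n where "n = sqrt ((cmod p)\<^sup>2 + (cmod q)\<^sup>2)"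
  have "p \<noteq> 0 \<or> q \<noteq> 0"
    using assms(4) by (auto simp: p_def q_def quat_adjoint add_eq_0_iff)
  then have n: "n > 0" by (auto simp: n_def sum_power2_gt_zero_iff)
  have E: "quat a b * quat p q = quat p q * quat c d"
  proof -
    have 1: "a * cnj a + b * cnj b = 1" "c * cnj c + d * cnj d = 1"
      using assms by (metis complex_norm_square of_real_1 of_real_add)+
    have 2: "a + cnj a = c + cnj c" using assms(3) by (simp add: complex_add_cnj)
    then have 3: "cnj a = c + cnj c - a" by (simp add: algebra_simps)
    have "a * p - b * cnj q = p * c - q * cnj d"
      using 1 unfolding p_def q_def complex_cnj_diff complex_cnj_add complex_cnj_cnj 3 by (simp add: algebra_simps) algebra
    moreover have "a * q + b * cnj p = p * d + q * cnj c"
      unfolding p_def q_def complex_cnj_diff complex_cnj_add complex_cnj_cnj 3 by (simp add: algebra_simps)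
    ultimately show ?thesis by (simp add: quat_mult)
  qed
  define h where "h = quat (p / of_real n) (q / of_real n)"
  have h: "h \<in> SU 2" unfolding h_def
  proof (rule quat_in_SU)
    have "(cmod (p / of_real n))\<^sup>2 + (cmod (q / of_real n))\<^sup>2 = ((cmod p)\<^sup>2 + (cmod q)\<^sup>2) / n\<^sup>2"
      using n by (simp add: norm_divide power_divide add_divide_distrib)
    moreover have "(cmod p)\<^sup>2 + (cmod q)\<^sup>2 = n\<^sup>2" by (simp add: n_def)
      ultimately show "(cmod (p / of_real n))\<^sup>2 + (cmod (q / of_real n))\<^sup>2 = 1" using n by simp
  qed
  have hs: "h = quat p q * quat (of_real (1 / n)) 0" "h = quat (of_real (1 / n)) 0 * quat p q"
    using n by (simp_all add: h_def quat_mult)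
  have cm: "quat c d * quat (of_real (1 / n)) 0 = quat (of_real (1 / n)) 0 * quat c d"
    by (simp add: quat_mult)
  have "quat a b * h = h * quat c d"
  proof -
    let ?D = "quat (of_real (1 / n)) 0"
    note assoc = assoc_mult_mat[OF quat_carrier quat_carrier quat_carrier]
    have "quat a b * h = quat a b * quat p q * ?D" unfolding hs(1) by (rule assoc[symmetric])
    also have "\<dots> = quat p q * (quat c d * ?D)" unfolding E by (rule assoc)
    also have "\<dots> = quat p q * ?D * quat c d" unfolding cm by (rule assoc[symmetric])
    finally show ?thesis unfolding hs(1) .
  qed
  then have "h * quat c d * mat_adjoint h = quat a b * h * mat_adjoint h" by (rule arg_cong[OF sym])
  also have "\<dots> = quat a b * (h * mat_adjoint h)"
    by (rule assoc_mult_mat[OF quat_carrier SU_carrier[OF h] SU_carrier[OF SU_adjoint[OF h]]])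
  also have "\<dots> = quat a b" unfolding SU_adjoint_right[OF h] by (rule right_mult_one_mat[OF quat_carrier])
  finally show ?thesis using that[OF h] by simp
qed

lemma SU_assoc: "x \<in> SU d \<Longrightarrow> y \<in> SU d \<Longrightarrow> z \<in> SU d \<Longrightarrow> x * y * z = x * (y * z)"
  by (rule assoc_mult_mat[of _ d d _ d _ d]) (auto dest: SU_carrier)

lemma SU_adjoint_mult: "x \<in> SU d \<Longrightarrow> y \<in> SU d \<Longrightarrow> mat_adjoint (x * y) = mat_adjoint y * mat_adjoint x"
  by (rule adjoint_mult[of _ d]) (auto dest: SU_carrier)

lemma SU_adjoint_adjoint: "x \<in> SU d \<Longrightarrow> mat_adjoint (mat_adjoint x) = x"
  by (rule adjoint_adjoint[of _ d]) (auto dest: SU_carrier)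

lemma SU_cancel:
  assumes "x \<in> SU d" "y \<in> SU d"
  shows "mat_adjoint x * (x * y) = y" "x * (mat_adjoint x * y) = y" "1\<^sub>m d * x = x" "x * 1\<^sub>m d = x"
  using assms SU_adjoint_left[OF assms(1)] SU_adjoint_right[OF assms(1)] assms[THEN SU_carrier]
  by (simp_all add: SU_assoc[of _ d, symmetric] SU_adjoint)

lemmas SU_simps = SU_mult SU_adjoint SU_one SU_assoc[of _ d] SU_adjoint_mult[of _ d] SU_adjoint_adjoint[of _ d]
  SU_cancel[of _ d] SU_adjoint_left SU_adjoint_right for d

text \<open>
  For \<open>u = c + s i\<close> and \<open>v = c + s j\<close> with \<open>c\<^sup>2 + s\<^sup>2 = 1\<close>, the commutator \<open>[u, v]\<close> has real part
  \<open>1 - 2 s\<^sup>4\<close>. Choosing \<open>s\<^sup>2\<close> as half the distance from \<open>g\<close> to 1 gives \<open>[u, v]\<close> the same real part as \<open>g\<close>.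
  So \<open>g\<close> is a conjugate of \<open>[u, v]\<close>, hence a commutator of conjugates of \<open>u\<close> and \<open>v\<close>, or else \<open>g\<close> is
  the inverse \<open>[v, u]\<close>.
\<close>

lemma SU_2_commutator_root:
  assumes g: "g \<in> SU 2"
  shows "\<exists>u\<in>SU 2. \<exists>v\<in>SU 2. g = u * v * mat_adjoint u * mat_adjoint v \<and>
    (op_dist u (1\<^sub>m 2))\<^sup>2 \<le> op_dist g (1\<^sub>m 2) \<and> (op_dist v (1\<^sub>m 2))\<^sup>2 \<le> op_dist g (1\<^sub>m 2)"
proof -
  obtain a b where ab: "g = quat a b" "(cmod a)\<^sup>2 + (cmod b)\<^sup>2 = 1" using SU_2_quatE[OF g] by blast
  define r where "r = op_dist g (1\<^sub>m 2)"
  have r0: "0 \<le> r" by (simp add: r_def op_dist_def op_norm_nonneg)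
  have r2: "r\<^sup>2 = 2 - 2 * Re a" using ab op_dist_quat_one by (simp add: r_def)
  have rle: "r \<le> 2" using op_dist_SU_le_2[OF g SU_one] by (simp add: r_def)
  define s c where "s = sqrt (r / 2)" and "c = sqrt (1 - r / 2)"
  have s: "0 \<le> s" "s\<^sup>2 = r / 2" and c: "0 \<le> c" "c\<^sup>2 = 1 - r / 2"
    using r0 rle by (auto simp: s_def c_def)
  have c1: "c \<le> 1" using r0 by (simp add: c_def)
  define u v where "u = quat (Complex c s) 0" and "v = quat (of_real c) (of_real s)"
  have nu: "(cmod (Complex c s))\<^sup>2 + (cmod 0)\<^sup>2 = 1" "(cmod (of_real c))\<^sup>2 + (cmod (of_real s))\<^sup>2 = 1"
    using s c by (simp_all add: cmod_power2)
  have uv: "u \<in> SU 2" "v \<in> SU 2" using nu by (auto simp: u_def v_def intro!: quat_in_SU simp del: norm_of_real)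
  have cc: "1 - c \<le> r / 2" using c c1 by (smt (verit) mult_left_le power2_eq_square)
  have du: "(op_dist u (1\<^sub>m 2))\<^sup>2 \<le> r" "(op_dist v (1\<^sub>m 2))\<^sup>2 \<le> r"
    using cc op_dist_quat_one[OF nu(1)] op_dist_quat_one[OF nu(2)] by (simp_all add: u_def v_def)
  define k where "k = u * v * mat_adjoint u * mat_adjoint v"
  have k: "k \<in> SU 2" using uv by (auto simp: k_def intro!: SU_mult SU_adjoint)
  obtain e f where ef: "k = quat e f" "(cmod e)\<^sup>2 + (cmod f)\<^sup>2 = 1" using SU_2_quatE[OF k] by blast
  have "Re e = Re (k $$ (0, 0))" by (simp add: ef)
  also have "\<dots> = c * c * (c * c + s * s) + s * s * (c * c - s * s)"
    by (simp add: k_def u_def v_def quat_mult quat_adjoint algebra_simps)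
  also have "\<dots> = 1 - 2 * (s\<^sup>2)\<^sup>2"
  proof -
    have "c * c = 1 - s * s" using s c by (simp add: power2_eq_square)
    then show ?thesis by (simp only:) (simp add: power2_eq_square algebra_simps)
  qed
  also have "\<dots> = Re a" using r2 by (simp add: s(2) power_divide field_simps)
  finally have Re: "Re a = Re e" by simp
  note S = uv SU_adjoint[OF uv(1)] SU_adjoint[OF uv(2)]
  show ?thesis
  proof (cases "g = mat_adjoint k")
    case True
    have "mat_adjoint k = v * u * mat_adjoint v * mat_adjoint u"
      using S by (simp add: k_def SU_simps[where d = 2])
    then show ?thesis using True uv du unfolding r_def by blast
  next
    case False
    then obtain h where h: "h \<in> SU 2" "g = h * k * mat_adjoint h"
      using quat_conjugate_same_trace[OF ab(2) ef(2) Re] ab(1) ef(1) by metis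
    note H = h(1) SU_adjoint[OF h(1)]
    have conj: "mat_adjoint (h * x * mat_adjoint h) = h * mat_adjoint x * mat_adjoint h"
      "op_dist (h * x * mat_adjoint h) (1\<^sub>m 2) = op_dist x (1\<^sub>m 2)" if "x \<in> SU 2" for x
    proof -
      note X = H that SU_adjoint[OF that]
      show "mat_adjoint (h * x * mat_adjoint h) = h * mat_adjoint x * mat_adjoint h"
        using X by (simp add: SU_simps[where d = 2])
      have "op_dist (h * x * mat_adjoint h) (h * 1\<^sub>m 2 * mat_adjoint h) = op_dist (h * x) (h * 1\<^sub>m 2)"
        by (rule op_dist_mult_right[OF X(2) SU_mult[OF X(1,3)] SU_mult[OF X(1) SU_one]])
      also have "\<dots> = op_dist x (1\<^sub>m 2)" by (rule op_dist_mult_left[OF X(1,3) SU_one])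
      finally show "op_dist (h * x * mat_adjoint h) (1\<^sub>m 2) = op_dist x (1\<^sub>m 2)"
        using X by (simp add: SU_simps[where d = 2])
    qed
    have merge: "(h * x * mat_adjoint h) * (h * y * mat_adjoint h) = h * (x * y) * mat_adjoint h"
      if "x \<in> SU 2" "y \<in> SU 2" for x y
    proof -
      show ?thesis using H that by (simp add: SU_simps[where d = 2])
    qed
    let ?u = "h * u * mat_adjoint h" and ?v = "h * v * mat_adjoint h"
    have "g = ?u * ?v * mat_adjoint ?u * mat_adjoint ?v"
      unfolding h(2) k_def using S by (simp only: conj merge SU_mult)
    moreover have "?u \<in> SU 2" "?v \<in> SU 2" using uv H by (auto intro!: SU_mult)
    ultimately show ?thesis using conj(2) uv du unfolding r_def by metis
  qed
qed

lemma inv_SU_group: "g \<in> SU d \<Longrightarrow> inv\<^bsub>SU_group d\<^esub> g = mat_adjoint g"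
  by (rule group.inv_equality[OF group_SU]) (simp_all add: SU_group_def SU_adjoint_left SU_adjoint)

lemma commutator_metric_group_SU_2: "commutator_metric_group (SU_group 2) op_dist"
proof -
  interpret group "SU_group 2" by (rule group_SU)
  interpret Metric_space "SU 2" op_dist by (rule Metric_space_SU)
  show ?thesis
  proof
    show "\<exists>u\<in>carrier (SU_group 2). \<exists>v\<in>carrier (SU_group 2).
        g = u \<otimes>\<^bsub>SU_group 2\<^esub> v \<otimes>\<^bsub>SU_group 2\<^esub> inv\<^bsub>SU_group 2\<^esub> u \<otimes>\<^bsub>SU_group 2\<^esub> inv\<^bsub>SU_group 2\<^esub> v \<and>
        (op_dist u \<one>\<^bsub>SU_group 2\<^esub>)\<^sup>2 \<le> op_dist g \<one>\<^bsub>SU_group 2\<^esub> \<and> (op_dist v \<one>\<^bsub>SU_group 2\<^esub>)\<^sup>2 \<le> op_dist g \<one>\<^bsub>SU_group 2\<^esub>"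
      if "g \<in> carrier (SU_group 2)" for g
    proof -
      have "g \<in> SU 2" using that by (simp add: SU_group_def)
      from SU_2_commutator_root[OF this] obtain u v where "u \<in> SU 2" "v \<in> SU 2"
        "g = u * v * mat_adjoint u * mat_adjoint v"
        "(op_dist u (1\<^sub>m 2))\<^sup>2 \<le> op_dist g (1\<^sub>m 2)" "(op_dist v (1\<^sub>m 2))\<^sup>2 \<le> op_dist g (1\<^sub>m 2)" by blast
      then show ?thesis using inv_SU_group[of u 2] inv_SU_group[of v 2]
        by (intro bexI[of _ u] bexI[of _ v]) (auto simp: SU_group_def)
    qed
    show "op_dist (x \<otimes>\<^bsub>SU_group 2\<^esub> y \<otimes>\<^bsub>SU_group 2\<^esub> inv\<^bsub>SU_group 2\<^esub> x \<otimes>\<^bsub>SU_group 2\<^esub> inv\<^bsub>SU_group 2\<^esub> y) \<one>\<^bsub>SU_group 2\<^esub>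
        \<le> 2 * op_dist x \<one>\<^bsub>SU_group 2\<^esub> * op_dist y \<one>\<^bsub>SU_group 2\<^esub>"
      if "x \<in> carrier (SU_group 2)" "y \<in> carrier (SU_group 2)" for x y
    proof -
      have "x \<in> SU 2" "y \<in> SU 2" using that by (auto simp: SU_group_def)
      then show ?thesis using op_dist_commutator[of x 2 y] inv_SU_group[of x 2] inv_SU_group[of y 2]
        by (auto simp: SU_group_def)
    qed
  qed (auto simp: SU_group_def nonneg commute op_dist_mult_left op_dist_mult_right intro: triangle)
qed


section \<open>Two-level unitaries generate SU(d)\<close>

definition next_index :: "nat \<Rightarrow> nat \<Rightarrow> nat" where "next_index d i = Suc i mod d"

lemma next_index: "i < d \<Longrightarrow> 2 \<le> d \<Longrightarrow> next_index d i < d \<and> next_index d i \<noteq> i"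
  unfolding next_index_def by (cases "Suc i = d") auto

lemma embed_carrier [simp]: "embed_SU2 d i g \<in> carrier_mat d d"
  by (simp add: embed_SU2_def Let_def)

lemma embed_dim [simp]: "dim_row (embed_SU2 d i g) = d" "dim_col (embed_SU2 d i g) = d"
  by (simp_all add: embed_SU2_def Let_def)

lemma embed_index:
  assumes "r < d" "c < d"
  shows "embed_SU2 d i g $$ (r, c) =
    (if r \<in> {i, next_index d i} \<and> c \<in> {i, next_index d i}
     then g $$ (if r = i then 0 else 1, if c = i then 0 else 1) else if r = c then 1 else 0)"
  using assms by (simp add: embed_SU2_def Let_def next_index_def)

lemma embed_mult_index:
  assumes A: "A \<in> carrier_mat d d" and i: "i < d" "2 \<le> d" and rc: "r < d" "c < d"
  shows "(embed_SU2 d i g * A) $$ (r, c) =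
    (if r = i then g $$ (0, 0) * A $$ (i, c) + g $$ (0, 1) * A $$ (next_index d i, c)
     else if r = next_index d i then g $$ (1, 0) * A $$ (i, c) + g $$ (1, 1) * A $$ (next_index d i, c)
     else A $$ (r, c))"
proof -
  define j where "j = next_index d i"
  have j: "j < d" "j \<noteq> i" using next_index[OF i] by (auto simp: j_def)
  have "(embed_SU2 d i g * A) $$ (r, c) = (\<Sum>k<d. embed_SU2 d i g $$ (r, k) * A $$ (k, c))"
    by (rule index_mult_sum) (use A rc in auto)
  also have "\<dots> = (\<Sum>k\<in>(if r \<in> {i, j} then {i, j} else {r}). embed_SU2 d i g $$ (r, k) * A $$ (k, c))"
    using rc i j by (intro sum.mono_neutral_right) (auto simp: embed_index j_def[symmetric])
  also have "\<dots> = (if r = i then g $$ (0, 0) * A $$ (i, c) + g $$ (0, 1) * A $$ (j, c)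
     else if r = j then g $$ (1, 0) * A $$ (i, c) + g $$ (1, 1) * A $$ (j, c)
     else A $$ (r, c))"
    using rc i j by (auto simp: embed_index j_def[symmetric])
  finally show ?thesis by (simp only: j_def)
qed

lemma embed_mult:
  assumes "g \<in> carrier_mat 2 2" "h \<in> carrier_mat 2 2" "i < d" "2 \<le> d"
  shows "embed_SU2 d i (g * h) = embed_SU2 d i g * embed_SU2 d i h"
proof (rule eq_matI)
  fix r c assume "r < dim_row (embed_SU2 d i g * embed_SU2 d i h)" "c < dim_col (embed_SU2 d i g * embed_SU2 d i h)"
  then have rc: "r < d" "c < d" by auto
  note n = next_index[OF assms(3,4)]
  have e: "(g * h) $$ (a, b) = g $$ (a, 0) * h $$ (0, b) + g $$ (a, Suc 0) * h $$ (Suc 0, b)"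
    if "a < 2" "b < 2" for a b using mat_2_mult_index[OF assms(1,2) that] .
  show "embed_SU2 d i (g * h) $$ (r, c) = (embed_SU2 d i g * embed_SU2 d i h) $$ (r, c)"
    unfolding embed_mult_index[OF embed_carrier assms(3,4) rc]
    using n rc assms(3) by (auto simp: embed_index e simp del: index_mult_mat(1))
qed auto

lemma embed_one:
  assumes "i < d" "2 \<le> d"
  shows "embed_SU2 d i (1\<^sub>m 2) = 1\<^sub>m d"
proof (rule eq_matI)
  fix r c assume "r < dim_row (1\<^sub>m d)" "c < dim_col (1\<^sub>m d)"
  then show "embed_SU2 d i (1\<^sub>m 2) $$ (r, c) = 1\<^sub>m d $$ (r, c)"
    using next_index[OF assms] by (auto simp: embed_index)
qed auto

lemma embed_adjoint:
  assumes "g \<in> carrier_mat 2 2" "i < d" "2 \<le> d"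
  shows "mat_adjoint (embed_SU2 d i g) = embed_SU2 d i (mat_adjoint g)"
proof (rule eq_matI)
  fix r c assume "r < dim_row (embed_SU2 d i (mat_adjoint g))" "c < dim_col (embed_SU2 d i (mat_adjoint g))"
  then have rc: "r < d" "c < d" by auto
  then show "mat_adjoint (embed_SU2 d i g) $$ (r, c) = embed_SU2 d i (mat_adjoint g) $$ (r, c)"
    using next_index[OF assms(2,3)] by (auto simp: index_adjoint[OF embed_carrier] embed_index index_adjoint[OF assms(1)])
qed (use adjoint_carrier[OF embed_carrier[of d i g]] in auto)

text \<open>The determinant is 1 because \<open>g\<close> is a commutator in \<open>SU(2)\<close> and the embedding is multiplicative.\<close>

lemma embed_in_SU:
  assumes g: "g \<in> SU 2" and i: "i < d" "2 \<le> d"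
  shows "embed_SU2 d i g \<in> SU d"
proof -
  let ?e = "embed_SU2 d i"
  have m: "?e (x * y) = ?e x * ?e y" if "x \<in> SU 2" "y \<in> SU 2" for x y
    using that i by (intro embed_mult) (auto dest: SU_carrier)
  have unit: "?e (mat_adjoint x) * ?e x = 1\<^sub>m d" if "x \<in> SU 2" for x
    using m[OF SU_adjoint[OF that] that] embed_one[OF i] SU_adjoint_left[OF that] by simp
  have dt: "det (?e x) * det (?e (mat_adjoint x)) = 1" if "x \<in> SU 2" for x
    using unit[OF that] det_mult[OF embed_carrier[of d i "mat_adjoint x"] embed_carrier[of d i x]]
    by (simp add: mult.commute)
  obtain u v where uv: "u \<in> SU 2" "v \<in> SU 2" "g = u * v * mat_adjoint u * mat_adjoint v"
    using SU_2_commutator_root[OF g] by blast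
  have "?e g = ?e u * ?e v * ?e (mat_adjoint u) * ?e (mat_adjoint v)"
    unfolding uv(3) using uv(1,2) by (simp only: m SU_mult SU_adjoint)
  then have "det (?e g) = det (?e u) * det (?e v) * det (?e (mat_adjoint u)) * det (?e (mat_adjoint v))"
    by (simp add: det_mult[of _ d] mult_carrier_mat[of _ d d _ d])
  also have "\<dots> = (det (?e u) * det (?e (mat_adjoint u))) * (det (?e v) * det (?e (mat_adjoint v)))"
    by (simp add: mult_ac)
  finally have "det (?e g) = 1" using dt uv by simp
  moreover have "mat_adjoint (?e g) * ?e g = 1\<^sub>m d"
    using unit[OF g] embed_adjoint[OF SU_carrier[OF g] i] by simp
  ultimately show ?thesis by (simp add: SU_def)
qed

text \<open>The factor 4 counts the entries in which the two embedded matrices can differ.\<close>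

lemma op_dist_embed:
  assumes "g \<in> SU 2" "h \<in> SU 2" "i < d" "2 \<le> d"
  shows "op_dist (embed_SU2 d i g) (embed_SU2 d i h) \<le> 4 * op_dist g h"
proof -
  define j where "j = next_index d i"
  have j: "j < d" "j \<noteq> i" using next_index[OF assms(3,4)] by (auto simp: j_def)
  define A where "A = embed_SU2 d i g - embed_SU2 d i h"
  have A: "A \<in> carrier_mat d d" by (simp add: A_def minus_carrier_mat)
  have gh: "g \<in> carrier_mat 2 2" "h \<in> carrier_mat 2 2" using assms by (auto dest: SU_carrier)
  have ent: "cmod (A $$ (r, c)) \<le> (if r \<in> {i, j} \<and> c \<in> {i, j} then op_dist g h else 0)" if "r < d" "c < d" for r c
  proof -
    have e2: "cmod (g $$ (a, b) - h $$ (a, b)) \<le> op_dist g h" if "a < 2" "b < 2" for a b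
      using norm_entry_le_op_norm[of a "g - h" b] gh that by (simp add: op_dist_eq[OF gh])
    have "A $$ (r, c) = embed_SU2 d i g $$ (r, c) - embed_SU2 d i h $$ (r, c)"
      unfolding A_def using that by simp
    then show ?thesis using that by (auto simp: embed_index j_def[symmetric] intro!: e2)
  qed
  have "op_norm A \<le> (\<Sum>r<d. \<Sum>c<d. cmod (A $$ (r, c)))" using op_norm_le_sum_entries[of A] A by simp
  also have "\<dots> \<le> (\<Sum>r<d. \<Sum>c<d. if r \<in> {i, j} \<and> c \<in> {i, j} then op_dist g h else 0)"
    using ent by (intro sum_mono) auto
  also have "\<dots> = (\<Sum>r\<in>{i, j}. \<Sum>c\<in>{i, j}. op_dist g h)"
  proof -
    have two: "(\<Sum>c<d. if c = i \<or> c = j then y else 0) = 2 * y" for y :: real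
    proof -
      have "(\<Sum>c<d. if c = i \<or> c = j then y else 0) = (\<Sum>c\<in>{i, j}. y)"
        using j assms(3) by (intro sum.mono_neutral_cong_right) auto
      then show ?thesis using j by simp
    qed
    have *: "(\<Sum>c<d. if r \<in> {i, j} \<and> c \<in> {i, j} then op_dist g h else 0) = (if r \<in> {i, j} then \<Sum>c\<in>{i, j}. op_dist g h else 0)" for r
      using j by (cases "r \<in> {i, j}") (auto simp: two)
    show ?thesis unfolding * using j by (simp add: two)
  qed
  also have "\<dots> = 4 * op_dist g h" using j by simp
  finally show ?thesis by (simp add: A_def op_dist_eq[OF embed_carrier embed_carrier])
qed

lemma givens_rotation:
  obtains g r where "g \<in> SU 2" "0 \<le> r" "g $$ (0, 0) * a + g $$ (0, 1) * b = of_real r"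
    "g $$ (1, 0) * a + g $$ (1, 1) * b = 0"
proof (cases "a = 0 \<and> b = 0")
  case True
  show ?thesis by (rule that[of "1\<^sub>m 2" 0]) (use True SU_one in auto)
next
  case False
  define r where "r = sqrt ((cmod a)\<^sup>2 + (cmod b)\<^sup>2)"
  have r: "r > 0" using False by (auto simp: r_def sum_power2_gt_zero_iff)
  have r2: "(cmod a)\<^sup>2 + (cmod b)\<^sup>2 = r\<^sup>2" by (simp add: r_def)
  have r2c: "cnj a * a + cnj b * b = of_real r * of_real r"
  proof -
    have "of_real (r * r) = complex_of_real ((cmod a)\<^sup>2 + (cmod b)\<^sup>2)" using r2 by (simp add: power2_eq_square)
    then show ?thesis by (simp only: of_real_add complex_norm_square of_real_mult) (simp add: mult.commute)
  qed
  show ?thesis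
  proof (rule that[of "quat (cnj a / of_real r) (cnj b / of_real r)" r])
    show "quat (cnj a / of_real r) (cnj b / of_real r) \<in> SU 2"
    proof (rule quat_in_SU)
      have "(cmod (cnj a / of_real r))\<^sup>2 + (cmod (cnj b / of_real r))\<^sup>2 = ((cmod a)\<^sup>2 + (cmod b)\<^sup>2) / r\<^sup>2"
        using r by (simp add: norm_divide power_divide add_divide_distrib)
      then show "(cmod (cnj a / of_real r))\<^sup>2 + (cmod (cnj b / of_real r))\<^sup>2 = 1" using r r2 by simp
    qed
  qed (use r r2c in \<open>auto simp: field_simps\<close>)
qed

definition fixes_first_cols :: "nat \<Rightarrow> nat \<Rightarrow> complex mat \<Rightarrow> bool" where
  "fixes_first_cols d k h \<longleftrightarrow> (\<forall>c<k. \<forall>r<d. h $$ (r, c) = (if r = c then 1 else 0))"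

lemma fixes_first_cols_row_zero:
  assumes h: "h \<in> SU d" "fixes_first_cols d k h" and "r < k" "k \<le> c" "c < d"
  shows "h $$ (r, c) = 0"
proof -
  have "(\<Sum>i<d. cnj (h $$ (i, r)) * h $$ (i, c)) = 0"
    using SU_cols_orthonormal[OF h(1), of r c] assms by simp
  moreover have "(\<Sum>i<d. cnj (h $$ (i, r)) * h $$ (i, c)) = (\<Sum>i<d. if i = r then h $$ (i, c) else 0)"
    using assms by (intro sum.cong) (auto simp: fixes_first_cols_def)
  ultimately show ?thesis using assms by simp
qed

text \<open>
  Givens elimination of column \<open>k\<close> from the bottom: if the entries below row \<open>k + n\<close> vanish, then \<open>n\<close>
  rotations of adjacent rows clear everything below the diagonal. The last rotation makes the diagonal
  entry real and nonnegative, and being the only nonzero entry of a unit column it equals 1. For \<open>n = 0\<close>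
  no rotation is left to do this, so nonnegativity is then assumed.
\<close>

lemma clear_column:
  fixes B :: real and n :: nat
  assumes p_mult: "\<And>x y. x \<in> SU d \<Longrightarrow> y \<in> SU d \<Longrightarrow> p (x * y) \<le> p x + p y"
    and p_embed: "\<And>i g. i < d \<Longrightarrow> g \<in> SU 2 \<Longrightarrow> p (embed_SU2 d i g) \<le> B"
    and "k + n < d" "h \<in> SU d" "fixes_first_cols d k h"
    and "\<And>r. k + n < r \<Longrightarrow> r < d \<Longrightarrow> h $$ (r, k) = 0"
    and "n = 0 \<Longrightarrow> \<exists>r\<ge>0. h $$ (k, k) = complex_of_real r"
  shows "\<exists>h'\<in>SU d. fixes_first_cols d (Suc k) h' \<and> p h \<le> p h' + n * B"
  using assms(3-)
proof (induction n arbitrary: h)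
  case 0
  have kd: "k < d" using 0 by simp
  have z: "h $$ (r, k) = 0" if "r < d" "r \<noteq> k" for r
    using fixes_first_cols_row_zero[OF 0(2,3), of r k] 0(4)[of r] that kd by (cases "r < k") auto
  obtain r where r: "r \<ge> 0" "h $$ (k, k) = complex_of_real r" using 0(5) by auto
  have "(\<Sum>i<d. cnj (h $$ (i, k)) * h $$ (i, k)) = (\<Sum>i<d. if i = k then complex_of_real (r * r) else 0)"
    using z r by (intro sum.cong) auto
  then have "complex_of_real (r * r) = 1" using SU_cols_orthonormal[OF 0(2) kd kd] kd by simp
  then have "r * r = 1" using of_real_eq_1_iff by blast
  then have "r = 1" using r(1) by (metis abs_of_nonneg abs_square_eq_1 power2_eq_square)
  then have "fixes_first_cols d (Suc k) h"
    using 0(3) z r by (auto simp: fixes_first_cols_def less_Suc_eq)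
  then show ?case using 0 by auto
next
  case (Suc n)
  define i where "i = k + n"
  have i: "i < d" "2 \<le> d" "next_index d i = Suc i" "Suc i < d" using Suc.prems by (auto simp: i_def next_index_def)
  obtain g r where g: "g \<in> SU 2" "0 \<le> r" "g $$ (0, 0) * h $$ (i, k) + g $$ (0, 1) * h $$ (Suc i, k) = of_real r"
      "g $$ (1, 0) * h $$ (i, k) + g $$ (1, 1) * h $$ (Suc i, k) = 0"
    using givens_rotation .
  define e where "e = embed_SU2 d i g"
  have e: "e \<in> SU d" using g i by (simp add: e_def embed_in_SU)
  define h1 where "h1 = e * h"
  have h1: "h1 \<in> SU d" using e Suc.prems by (simp add: h1_def SU_mult)
  note ix = embed_mult_index[OF SU_carrier[OF Suc.prems(2)] i(1,2), of _ _ g, folded e_def, folded h1_def, unfolded i(3)]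
  have "h = mat_adjoint e * h1" using e Suc.prems(2) by (simp add: h1_def SU_cancel)
  then have "p h \<le> p (mat_adjoint e) + p h1" using p_mult[OF SU_adjoint[OF e] h1] by simp
  moreover have "p (mat_adjoint e) \<le> B"
    using p_embed[OF i(1) SU_adjoint[OF g(1)]] embed_adjoint[OF SU_carrier[OF g(1)] i(1,2)] by (simp add: e_def)
  moreover have "\<exists>h'\<in>SU d. fixes_first_cols d (Suc k) h' \<and> p h1 \<le> p h' + n * B"
  proof (rule Suc.IH)
    show "fixes_first_cols d k h1"
      using Suc.prems(3) i unfolding fixes_first_cols_def by (auto simp: ix i_def)
    show "h1 $$ (r', k) = 0" if "k + n < r'" "r' < d" for r'
      using that g(4) i Suc.prems(4)[of r'] by (auto simp: ix i_def)
    show "\<exists>r\<ge>0. h1 $$ (k, k) = complex_of_real r" if "n = 0"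
      using that g i by (auto simp: ix i_def)
  qed (use h1 Suc.prems in auto)
  ultimately show ?case by (force simp: algebra_simps)
qed

text \<open>
  Clearing the columns \<open>0, \<dots>, d - 2\<close> takes at most \<open>d\<close> rotations each. What remains is a diagonal matrix
  whose last entry is its determinant 1.
\<close>

theorem length_bound_SU:
  fixes B :: real
  assumes p_mult: "\<And>x y. x \<in> SU d \<Longrightarrow> y \<in> SU d \<Longrightarrow> p (x * y) \<le> p x + p y"
    and p_one: "p (1\<^sub>m d) = 0"
    and p_embed: "\<And>i g. i < d \<Longrightarrow> g \<in> SU 2 \<Longrightarrow> p (embed_SU2 d i g) \<le> B"
    and "0 \<le> B" "2 \<le> d" "h \<in> SU d"
  shows "p h \<le> d\<^sup>2 * B"
proof -
  have "p h \<le> m * (d * B)" if "m \<le> d - 1" "h \<in> SU d" "fixes_first_cols d (d - 1 - m) h" for m h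
    using that
  proof (induction m arbitrary: h)
    case 0
    have f: "h $$ (r, c) = (if r = c then 1 else 0)" if "r < d" "c < d" "(r, c) \<noteq> (d - 1, d - 1)" for r c
    proof (cases "c < d - 1")
      case True
      then show ?thesis using 0 that by (simp add: fixes_first_cols_def)
    next
      case False
      then show ?thesis using fixes_first_cols_row_zero[OF 0(2,3), of r c] that by auto
    qed
    have hc: "h \<in> carrier_mat d d" using 0 by (auto dest: SU_carrier)
    have "upper_triangular h" using hc f by (auto intro!: upper_triangularI)
    then have "det h = (\<Prod>i<d. h $$ (i, i))"
      using det_upper_triangular[OF _ hc] hc by (simp add: prod_list_diag_prod atLeast0LessThan)
    also have "\<dots> = (\<Prod>i<d. if i = d - 1 then h $$ (i, i) else 1)"
      using f by (intro prod.cong) auto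
    also have "\<dots> = h $$ (d - 1, d - 1)" using assms(5) by simp
    finally have "h $$ (d - 1, d - 1) = 1" using 0(2) by (simp add: SU_def)
    then have "h = 1\<^sub>m d" using hc f by (intro eq_matI) (force split: if_splits)+
    then show ?case using p_one by simp
  next
    case (Suc m)
    define k where "k = d - 1 - Suc m"
    have k: "k + (d - 1 - k) < d" "d - 1 - k \<noteq> 0" "d - 1 - m = Suc k" using Suc.prems assms(5) by (auto simp: k_def)
    have "\<exists>h'\<in>SU d. fixes_first_cols d (Suc k) h' \<and> p h \<le> p h' + real (d - 1 - k) * B"
      using Suc.prems k by (intro clear_column p_mult p_embed) (auto simp: k_def)
    then obtain h' where h': "h' \<in> SU d" "fixes_first_cols d (Suc k) h'" "p h \<le> p h' + real (d - 1 - k) * B" by blast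
    have "p h' \<le> m * (d * B)" using Suc.IH[of h'] h' k Suc.prems by simp
    moreover have "real (d - 1 - k) * B \<le> d * B" using assms(4) by (intro mult_right_mono) auto
    ultimately show ?case using h' by (simp add: algebra_simps)
  qed
  from this[of "d - 1" h] have "p h \<le> (d - 1) * (d * B)"
    using assms by (simp add: fixes_first_cols_def)
  also have "\<dots> \<le> d * (d * B)" using assms by (intro mult_right_mono) auto
  finally show ?thesis by (simp add: power2_eq_square mult.assoc)
qed


section \<open>Finite nets and words of exponent sum zero\<close>

text \<open>
  One point of \<open>SU(d)\<close> is picked from each nonempty cell of the grid of mesh \<open>1 / Q\<close> in the \<open>2 d\<^sup>2\<close> real
  coordinates of a matrix; all coordinates lie in \<open>[- 1, 1]\<close>.
\<close>

lemma SU_finite_net: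
  assumes "0 < Q"
  obtains X where "X \<subseteq> SU d" "finite X" "card X \<le> (2 * Q + 1) ^ (2 * d\<^sup>2)"
    "\<And>g. g \<in> SU d \<Longrightarrow> \<exists>x\<in>X. op_dist g x \<le> 2 * (real d)\<^sup>2 / real Q"
proof -
  let ?I = "{..<d} \<times> {..<d}"
  let ?J = "{- int Q .. int Q} \<times> {- int Q .. int Q}"
  define cell where "cell g = restrict (\<lambda>ij. (\<lfloor>real Q * Re (g $$ ij)\<rfloor>, \<lfloor>real Q * Im (g $$ ij)\<rfloor>)) ?I" for g :: "complex mat"
  have rng: "cell g \<in> PiE ?I (\<lambda>_. ?J)" if g: "g \<in> SU d" for g
  proof -
    have bd: "\<lfloor>real Q * t\<rfloor> \<in> {- int Q .. int Q}" if "\<bar>t\<bar> \<le> 1" for t :: real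
    proof -
      have "\<bar>real Q * t\<bar> \<le> real Q * 1" unfolding abs_mult using that by (intro mult_mono) auto
      then have "real Q * t \<le> real Q" "- real Q \<le> real Q * t" by linarith+
      then show ?thesis by (simp add: le_floor_iff floor_le_iff)
    qed
    have "cmod (g $$ ij) \<le> 1" if "ij \<in> ?I" for ij
      using norm_entry_le_op_norm[of "fst ij" g "snd ij"] op_norm_SU_le[OF g] SU_carrier[OF g] that by auto
    then have "\<bar>Re (g $$ ij)\<bar> \<le> 1" "\<bar>Im (g $$ ij)\<bar> \<le> 1" if "ij \<in> ?I" for ij
      using that abs_Re_le_cmod[of "g $$ ij"] abs_Im_le_cmod[of "g $$ ij"] order_trans by blast+
    then show ?thesis unfolding cell_def restrict_PiE_iff using bd by blast
  qed
  have close: "op_dist g h \<le> 2 * (real d)\<^sup>2 / real Q" if g: "g \<in> SU d" and h: "h \<in> SU d" and eq: "cell g = cell h" for g h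
  proof -
    note c = SU_carrier[OF g] SU_carrier[OF h]
    have fl: "\<bar>s - t\<bar> \<le> 1 / real Q" if "\<lfloor>real Q * s\<rfloor> = \<lfloor>real Q * t\<rfloor>" for s t
    proof -
      have "\<bar>real Q * s - real Q * t\<bar> \<le> 1" using that by linarith
      then have "real Q * \<bar>s - t\<bar> \<le> 1" by (simp add: abs_mult flip: right_diff_distrib)
      then show ?thesis using assms by (simp add: field_simps)
    qed
    have entry: "cmod (g $$ ij - h $$ ij) \<le> 2 / real Q" if "ij \<in> ?I" for ij
    proof -
      have "cell g ij = cell h ij" using eq by simp
      then have "\<bar>Re (g $$ ij) - Re (h $$ ij)\<bar> \<le> 1 / real Q" "\<bar>Im (g $$ ij) - Im (h $$ ij)\<bar> \<le> 1 / real Q"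
        using that by (auto simp: cell_def intro!: fl)
      then show ?thesis using cmod_le[of "g $$ ij - h $$ ij"] by simp
    qed
    have "op_norm (g - h) \<le> (\<Sum>i<d. \<Sum>j<d. cmod (g $$ (i, j) - h $$ (i, j)))"
      using op_norm_le_sum_entries[of "g - h"] c by simp
    also have "\<dots> \<le> (\<Sum>i<d. \<Sum>j<d. 2 / real Q)"
      by (intro sum_mono entry) auto
    finally show ?thesis using g h by (simp add: op_dist_SU power2_eq_square algebra_simps)
  qed
  define pick where "pick z = (SOME g. g \<in> SU d \<and> cell g = z)" for z
  have pick: "pick (cell g) \<in> SU d \<and> cell (pick (cell g)) = cell g" if "g \<in> SU d" for g
    unfolding pick_def by (rule someI[of _ g]) (use that in simp)
  define X where "X = (pick \<circ> cell) ` SU d"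
  have fin: "finite (PiE ?I (\<lambda>_. ?J))" by (intro finite_PiE) auto
  have sub: "cell ` SU d \<subseteq> PiE ?I (\<lambda>_. ?J)" using rng by auto
  have "card X \<le> card (cell ` SU d)"
    unfolding X_def image_comp[symmetric] using fin sub by (intro card_image_le) (rule finite_subset)
  also have "\<dots> \<le> card (PiE ?I (\<lambda>_. ?J))" using fin sub by (rule card_mono)
  also have "\<dots> = ((2 * Q + 1) * (2 * Q + 1)) ^ (d * d)"
  proof -
    have "card {- int Q .. int Q} = 2 * Q + 1" by simp
    then show ?thesis by (simp only: card_PiE finite_cartesian_product finite_lessThan card_cartesian_product
        prod_constant card_lessThan)
  qed
  also have "\<dots> = (2 * Q + 1) ^ (2 * d\<^sup>2)"
    by (simp add: power_mult power2_eq_square)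
  finally have "card X \<le> (2 * Q + 1) ^ (2 * d\<^sup>2)" .
  moreover have "finite X" unfolding X_def image_comp[symmetric] using fin sub finite_subset by blast
  moreover have "X \<subseteq> SU d" using pick by (auto simp: X_def)
  moreover have "\<exists>x\<in>X. op_dist g x \<le> 2 * (real d)\<^sup>2 / real Q" if "g \<in> SU d" for g
    using close[OF that, of "pick (cell g)"] pick[OF that] that by (auto simp: X_def)
  ultimately show ?thesis using that by blast
qed

text \<open>
  A word is a list of letters \<open>(b, a)\<close>, standing for the generator \<open>a\<close> if \<open>b\<close> holds and for its inverse
  otherwise. The assignment \<open>\<sigma>\<close> of matrices to generators is a parameter, since the same word will be
  evaluated at perturbed generators.
\<close>

primrec letter :: "('a \<Rightarrow> complex mat) \<Rightarrow> bool \<times> 'a \<Rightarrow> complex mat" where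
  "letter \<sigma> (b, a) = (if b then \<sigma> a else mat_adjoint (\<sigma> a))"

primrec word_eval :: "('a \<Rightarrow> complex mat) \<Rightarrow> (bool \<times> 'a) list \<Rightarrow> complex mat" where
  "word_eval \<sigma> [] = 1\<^sub>m 2"
| "word_eval \<sigma> (x # w) = letter \<sigma> x * word_eval \<sigma> w"

definition exponent_sum :: "(bool \<times> 'a) list \<Rightarrow> int" where
  "exponent_sum w = (\<Sum>x\<leftarrow>w. if fst x then 1 else - 1)"

definition inv_word :: "(bool \<times> 'a) list \<Rightarrow> (bool \<times> 'a) list" where
  "inv_word w = rev (map (\<lambda>(b, a). (\<not> b, a)) w)"

lemma exponent_sum_simps [simp]:
  "exponent_sum [] = 0"
  "exponent_sum (x # w) = (if fst x then 1 else - 1) + exponent_sum w"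
  "exponent_sum (v @ w) = exponent_sum v + exponent_sum w"
  by (simp_all add: exponent_sum_def)

lemma exponent_sum_inv_word [simp]: "exponent_sum (inv_word w) = - exponent_sum w"
  by (induction w) (auto simp: inv_word_def)

lemma set_inv_word [simp]: "snd ` set (inv_word w) = snd ` set w"
  by (force simp: inv_word_def)

lemma letter_SU: "\<sigma> (snd x) \<in> SU 2 \<Longrightarrow> letter \<sigma> x \<in> SU 2"
  by (cases x) (auto intro: SU_adjoint)

lemma word_eval_SU: "(\<And>a. a \<in> snd ` set w \<Longrightarrow> \<sigma> a \<in> SU 2) \<Longrightarrow> word_eval \<sigma> w \<in> SU 2"
  by (induction w) (auto intro!: SU_one SU_mult letter_SU)

lemma word_eval_append:
  "(\<And>a. a \<in> snd ` set (v @ w) \<Longrightarrow> \<sigma> a \<in> SU 2) \<Longrightarrow> word_eval \<sigma> (v @ w) = word_eval \<sigma> v * word_eval \<sigma> w"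
proof (induction v)
  case Nil
  then have "word_eval \<sigma> w \<in> SU 2" by (intro word_eval_SU) auto
  then show ?case by (simp add: left_mult_one_mat[OF SU_carrier])
next
  case (Cons x v)
  have "letter \<sigma> x \<in> SU 2" "word_eval \<sigma> v \<in> SU 2" "word_eval \<sigma> w \<in> SU 2"
    using Cons.prems by (auto intro!: letter_SU word_eval_SU)
  then show ?case using Cons by (simp add: SU_assoc[of _ 2])
qed

lemma word_eval_inv_word:
  "(\<And>a. a \<in> snd ` set w \<Longrightarrow> \<sigma> a \<in> SU 2) \<Longrightarrow> word_eval \<sigma> (inv_word w) = mat_adjoint (word_eval \<sigma> w)"
proof (induction w)
  case Nil
  show ?case using SU_one[of 2] by (simp add: inv_word_def SU_def)
    (metis SU_adjoint SU_adjoint_left SU_cancel(4) SU_one)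
next
  case (Cons x w)
  obtain b a where x: "x = (b, a)" by (cases x)
  have a: "\<sigma> a \<in> SU 2" "mat_adjoint (\<sigma> a) \<in> SU 2" using Cons.prems[of a] x SU_adjoint by auto
  have w: "word_eval \<sigma> w \<in> SU 2" using Cons.prems by (auto intro!: word_eval_SU)
  have "inv_word (x # w) = inv_word w @ [(\<not> b, a)]" by (simp add: inv_word_def x)
  moreover have "word_eval \<sigma> (inv_word w @ [(\<not> b, a)]) = word_eval \<sigma> (inv_word w) * word_eval \<sigma> [(\<not> b, a)]"
  proof (rule word_eval_append)
    fix c assume "c \<in> snd ` set (inv_word w @ [(\<not> b, a)])"
    then have "c \<in> snd ` set (x # w)" by (simp add: image_Un x disj_commute)
    then show "\<sigma> c \<in> SU 2" by (rule Cons.prems)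
  qed
  ultimately show ?case
    using Cons.IH Cons.prems a w SU_carrier[OF a(1)] SU_carrier[OF a(2)]
    by (cases b) (simp_all add: x SU_adjoint_mult[of _ 2] SU_adjoint_adjoint[of _ 2])
qed

lemma op_dist_adjoint:
  assumes "g \<in> SU 2" "h \<in> SU 2"
  shows "op_dist (mat_adjoint g) (mat_adjoint h) = op_dist g h"
proof -
  interpret commutator_metric_group "SU_group 2" op_dist by (rule commutator_metric_group_SU_2)
  have gh: "g \<in> carrier (SU_group 2)" "h \<in> carrier (SU_group 2)" using assms by (auto simp: SU_group_def)
  have "op_dist (inv\<^bsub>SU_group 2\<^esub> g) (inv\<^bsub>SU_group 2\<^esub> h) = op_dist h g"
    using dist_inv_mult(1)[OF gh] dist_right[of h "inv\<^bsub>SU_group 2\<^esub> g" "inv\<^bsub>SU_group 2\<^esub> h"] gh by simp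
  then show ?thesis using inv_SU_group[OF assms(1)] inv_SU_group[OF assms(2)] dist_sym[OF gh] by simp
qed

lemma word_eval_perturb:
  fixes \<delta> :: real
  assumes "\<And>a. a \<in> snd ` set w \<Longrightarrow> \<sigma> a \<in> SU 2 \<and> \<tau> a \<in> SU 2 \<and> op_dist (\<sigma> a) (\<tau> a) \<le> \<delta>"
  shows "op_dist (word_eval \<sigma> w) (word_eval \<tau> w) \<le> length w * \<delta>"
  using assms
proof (induction w)
  case Nil
  interpret Metric_space "SU 2" op_dist by (rule Metric_space_SU)
  show ?case using zero[of "1\<^sub>m 2" "1\<^sub>m 2"] SU_one by simp
next
  case (Cons x w)
  interpret Metric_space "SU 2" op_dist by (rule Metric_space_SU)
  obtain b a where x: "x = (b, a)" by (cases x)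
  have a: "\<sigma> a \<in> SU 2" "\<tau> a \<in> SU 2" "op_dist (\<sigma> a) (\<tau> a) \<le> \<delta>" using Cons.prems[of a] x by auto
  have l: "letter \<sigma> x \<in> SU 2" "letter \<tau> x \<in> SU 2" "op_dist (letter \<sigma> x) (letter \<tau> x) \<le> \<delta>"
    using a by (auto simp: x op_dist_adjoint intro: SU_adjoint)
  have w: "word_eval \<sigma> w \<in> SU 2" "word_eval \<tau> w \<in> SU 2" using Cons.prems by (auto intro!: word_eval_SU)
  have "op_dist (letter \<sigma> x * word_eval \<sigma> w) (letter \<tau> x * word_eval \<tau> w)
      \<le> op_dist (letter \<sigma> x * word_eval \<sigma> w) (letter \<sigma> x * word_eval \<tau> w)
        + op_dist (letter \<sigma> x * word_eval \<tau> w) (letter \<tau> x * word_eval \<tau> w)"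
    using l w by (intro triangle SU_mult)
  also have "\<dots> = op_dist (word_eval \<sigma> w) (word_eval \<tau> w) + op_dist (letter \<sigma> x) (letter \<tau> x)"
    using l w by (simp add: op_dist_mult_left[of _ 2] op_dist_mult_right[of _ 2])
  also have "\<dots> \<le> length w * \<delta> + \<delta>" using l Cons by (intro add_mono) auto
  finally show ?case by (simp add: algebra_simps)
qed

lemma generate_SU_word:
  assumes "x \<in> generate (SU_group 2) S" "S \<subseteq> SU 2"
  shows "\<exists>w. snd ` set w \<subseteq> S \<and> word_eval (\<lambda>a. a) w = x"
  using assms(1)
proof (induction rule: generate.induct)
  case one
  show ?case by (rule exI[of _ "[]"]) (simp add: SU_group_def)
next
  case (incl h)
  then have "h \<in> SU 2" using assms by auto
  then show ?case using incl SU_carrier[of h 2] by (intro exI[of _ "[(True, h)]"]) auto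
next
  case (inv h)
  then have h: "h \<in> SU 2" using assms by auto
  then show ?case using inv SU_carrier[OF SU_adjoint[OF h]] inv_SU_group[OF h]
    by (intro exI[of _ "[(False, h)]"]) auto
next
  case (eng h1 h2)
  then obtain w1 w2 where w: "snd ` set w1 \<subseteq> S" "word_eval (\<lambda>a. a) w1 = h1"
      "snd ` set w2 \<subseteq> S" "word_eval (\<lambda>a. a) w2 = h2" by blast
  have "word_eval (\<lambda>a. a) (w1 @ w2) = word_eval (\<lambda>a. a) w1 * word_eval (\<lambda>a. a) w2"
    by (rule word_eval_append) (use w assms in auto)
  then show ?case using w by (intro exI[of _ "w1 @ w2"]) (auto simp: SU_group_def)
qed

text \<open>
  The coarse nets from which the Solovay-Kitaev iteration starts, at its initial accuracy 1/108. The
  generators may move within \<open>\<delta>\<close> because single points of the support can have measure zero while their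
  neighbourhoods do not. The exponent sum is zero because such words lead a sequence of functions
  \<open>T\<^sup>j f\<close> back to the function where they start.
\<close>

definition robust_word_net :: "complex mat set \<Rightarrow> nat \<Rightarrow> real \<Rightarrow> bool" where
  "robust_word_net A k \<delta> \<longleftrightarrow> (\<forall>\<sigma>. (\<forall>a\<in>A. \<sigma> a \<in> SU 2 \<and> op_dist (\<sigma> a) a < \<delta>) \<longrightarrow> (\<forall>g\<in>SU 2.
    \<exists>w. snd ` set w \<subseteq> A \<and> length w \<le> k \<and> exponent_sum w = 0 \<and> op_dist g (word_eval \<sigma> w) \<le> 1 / 108))"

lemma robust_word_net_mono:
  assumes "robust_word_net A k \<delta>" "k \<le> k'"
  shows "robust_word_net A k' \<delta>"
proof -
  have "length w \<le> k \<Longrightarrow> length w \<le> k'" for w :: "(bool \<times> complex mat) list"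
    using assms(2) by simp
  then show ?thesis using assms(1) unfolding robust_word_net_def by fast
qed

text \<open>
  Each point of a finite net of \<open>SU(2)\<close> is a commutator \<open>[u, v]\<close>, and replacing \<open>u\<close> and \<open>v\<close> by nearby
  words in the generators gives a word of exponent sum zero near it. Only finitely many words of bounded
  length occur, so a perturbation of the generators moves each of them by a bounded multiple of its size.
\<close>

theorem balanced_word_net:
  assumes S: "S \<subseteq> SU 2" and dense: "SU_topology 2 closure_of generate (SU_group 2) S = SU 2"
  shows "\<exists>A m \<delta>. finite A \<and> A \<subseteq> S \<and> 0 < \<delta> \<and> robust_word_net A m \<delta>"
proof -
  interpret M: Metric_space "SU 2" op_dist by (rule Metric_space_SU)
  interpret commutator_metric_group "SU_group 2" op_dist by (rule commutator_metric_group_SU_2)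
  have car: "carrier (SU_group 2) = SU 2" by (simp add: SU_group_def)
  obtain X where X: "X \<subseteq> SU 2" "finite X" "\<And>g. g \<in> SU 2 \<Longrightarrow> \<exists>x\<in>X. op_dist g x \<le> 2 * (real 2)\<^sup>2 / real 3200"
    using SU_finite_net[of 3200 2] by (metis zero_less_numeral of_nat_numeral)
  have word: "\<exists>w. snd ` set w \<subseteq> S \<and> op_dist (word_eval (\<lambda>a. a) w) u < 1 / 3200" if "u \<in> SU 2" for u
  proof -
    have "u \<in> M.mtopology closure_of generate (SU_group 2) S" using that dense by (simp add: SU_topology_def)
    then have "\<forall>r>0. \<exists>y\<in>generate (SU_group 2) S. y \<in> M.mball u r" by (simp add: M.metric_closure_of)
    from this[rule_format, of "1 / 3200"] obtain y where
      "y \<in> generate (SU_group 2) S" "y \<in> M.mball u (1 / 3200)" by auto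
    then show ?thesis using generate_SU_word[OF _ S, of y] M.commute by auto
  qed
  have "\<exists>w. snd ` set w \<subseteq> S \<and> exponent_sum w = 0 \<and> op_dist x (word_eval (\<lambda>a. a) w) \<le> 1 / 400" if x: "x \<in> X" for x
  proof -
    have "x \<in> SU 2" using x X by auto
    then obtain u v where uv: "u \<in> SU 2" "v \<in> SU 2" "x = u * v * mat_adjoint u * mat_adjoint v"
      using SU_2_commutator_root by blast
    obtain wu where wu: "snd ` set wu \<subseteq> S" "op_dist (word_eval (\<lambda>a. a) wu) u < 1 / 3200" using word[OF uv(1)] by blast
    obtain wv where wv: "snd ` set wv \<subseteq> S" "op_dist (word_eval (\<lambda>a. a) wv) v < 1 / 3200" using word[OF uv(2)] by blast
    let ?e = "word_eval (\<lambda>a. a)"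
    define w where "w = wu @ wv @ inv_word wu @ inv_word wv"
    have e: "?e wu \<in> SU 2" "?e wv \<in> SU 2" using wu wv S by (auto intro!: word_eval_SU)
    have comm: "commutator a b = a * b * mat_adjoint a * mat_adjoint b" if "a \<in> SU 2" "b \<in> SU 2" for a b
      unfolding commutator_def inv_SU_group[OF that(1)] inv_SU_group[OF that(2)] by (simp add: SU_group_def)
    have in_S: "a \<in> SU 2" if "a \<in> snd ` set wu \<or> a \<in> snd ` set wv" for a using that wu wv S by blast
    have "?e w = ?e wu * (?e wv * (?e (inv_word wu) * ?e (inv_word wv)))"
      unfolding w_def
      by (subst word_eval_append, (simp add: image_Un, use in_S in blast))+ (rule refl)
    also have "\<dots> = commutator (?e wu) (?e wv)"
    proof -
      have "?e (inv_word wu) = mat_adjoint (?e wu)" "?e (inv_word wv) = mat_adjoint (?e wv)"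
        by (rule word_eval_inv_word, use in_S in blast)+
      then show ?thesis
        unfolding comm[OF e] using e by (simp add: SU_assoc[of _ 2] SU_mult SU_adjoint)
    qed
    finally have ew: "?e w = commutator (?e wu) (?e wv)" .
    have "op_dist (commutator (?e wu) (?e wv)) (commutator u v)
        \<le> 2 * op_dist (?e wu) u * op_dist (?e wv) (1\<^sub>m 2) + 2 * op_dist (?e wv) v * op_dist u (1\<^sub>m 2)"
      using dist_commutator_commutator[of u v "?e wu" "?e wv"] uv e by (simp add: SU_group_def)
    also have "\<dots> \<le> 2 * (1 / 3200) * 2 + 2 * (1 / 3200) * 2"
      using wu(2) wv(2) op_dist_SU_le_2[OF e(2) SU_one] op_dist_SU_le_2[OF uv(1) SU_one]
      by (intro add_mono mult_mono) auto
    finally have "op_dist (?e w) x \<le> 1 / 400" using ew comm[OF uv(1,2)] uv(3) by simp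
    moreover have "snd ` set w \<subseteq> S" using wu(1) wv(1) by (simp add: w_def image_Un)
    moreover have "exponent_sum w = 0" by (simp add: w_def)
    ultimately show ?thesis using M.commute[of x "?e w"] by metis
  qed
  then have "\<forall>x\<in>X. \<exists>w. snd ` set w \<subseteq> S \<and> exponent_sum w = 0 \<and> op_dist x (word_eval (\<lambda>a. a) w) \<le> 1 / 400" by blast
  from bchoice[OF this] obtain W where
    "\<forall>x\<in>X. snd ` set (W x) \<subseteq> S \<and> exponent_sum (W x) = 0 \<and> op_dist x (word_eval (\<lambda>a. a) (W x)) \<le> 1 / 400" ..
  then have W: "snd ` set (W x) \<subseteq> S \<and> exponent_sum (W x) = 0 \<and> op_dist x (word_eval (\<lambda>a. a) (W x)) \<le> 1 / 400"
    if "x \<in> X" for x using that by blast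
  define A where "A = (\<Union>x\<in>X. snd ` set (W x))"
  define m where "m = Max (insert 0 ((length \<circ> W) ` X))"
  define \<delta> where "\<delta> = 1 / (400 * (real m + 1))"
  have m: "length (W x) \<le> m" if "x \<in> X" for x
    unfolding m_def using X(2) that by (intro Max_ge) auto
  show ?thesis
  proof (intro exI[of _ A] exI[of _ m] exI[of _ \<delta>] conjI)
    show "finite A" using X(2) by (auto simp: A_def)
    show "A \<subseteq> S" using W by (auto simp: A_def)
    show "0 < \<delta>" by (simp add: \<delta>_def add_nonneg_pos)
    show "robust_word_net A m \<delta>"
      unfolding robust_word_net_def
    proof (intro allI impI ballI)
      fix \<sigma> g assume \<sigma>A: "\<forall>a\<in>A. \<sigma> a \<in> SU 2 \<and> op_dist (\<sigma> a) a < \<delta>" and g: "g \<in> SU 2"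
      have \<sigma>: "\<sigma> a \<in> SU 2 \<and> op_dist (\<sigma> a) a < \<delta>" if "a \<in> A" for a using \<sigma>A that by blast
      obtain x where x: "x \<in> X" "op_dist g x \<le> 2 * (real 2)\<^sup>2 / real 3200" using X(3)[OF g] by blast
      have sub: "snd ` set (W x) \<subseteq> A" using x by (auto simp: A_def)
      have SA: "a \<in> SU 2" if "a \<in> snd ` set (W x)" for a using that W[OF x(1)] S by blast
      have "op_dist (word_eval (\<lambda>a. a) (W x)) (word_eval \<sigma> (W x)) \<le> length (W x) * \<delta>"
      proof (rule word_eval_perturb)
        fix a assume a: "a \<in> snd ` set (W x)"
        then have "a \<in> A" using sub by blast
        with \<sigma>[OF this] SA[OF a] show "a \<in> SU 2 \<and> \<sigma> a \<in> SU 2 \<and> op_dist a (\<sigma> a) \<le> \<delta>"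
          using M.commute[of a "\<sigma> a"] by auto
      qed
      also have "\<dots> \<le> 1 / 400"
      proof -
        have "real (length (W x)) \<le> real m + 1" using m[OF x(1)] by simp
        then show ?thesis unfolding \<delta>_def by (simp add: field_simps)
      qed
      finally have 1: "op_dist (word_eval (\<lambda>a. a) (W x)) (word_eval \<sigma> (W x)) \<le> 1 / 400" .
      have mem: "x \<in> SU 2" "word_eval (\<lambda>a. a) (W x) \<in> SU 2" "word_eval \<sigma> (W x) \<in> SU 2"
        using x X SA sub \<sigma> by (auto intro!: word_eval_SU)
      have "op_dist g (word_eval \<sigma> (W x)) \<le> op_dist g x + op_dist x (word_eval (\<lambda>a. a) (W x))
          + op_dist (word_eval (\<lambda>a. a) (W x)) (word_eval \<sigma> (W x))"
        using M.triangle[of g x "word_eval \<sigma> (W x)"] M.triangle[of x "word_eval (\<lambda>a. a) (W x)" "word_eval \<sigma> (W x)"] g mem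
        by linarith
      also have "\<dots> \<le> 1 / 108" using 1 x(2) W[OF x(1)] by simp
      finally show "\<exists>w. snd ` set w \<subseteq> A \<and> length w \<le> m \<and> exponent_sum w = 0 \<and> op_dist g (word_eval \<sigma> w) \<le> 1 / 108"
        using sub m[OF x(1)] W[OF x(1)] by blast
    qed
  qed
qed


section \<open>Measurability on SU(d)\<close>

lemma lipschitz_measurable_SU:
  fixes f :: "complex mat \<Rightarrow> 'b :: metric_space"
  assumes "\<And>g h. g \<in> SU d \<Longrightarrow> h \<in> SU d \<Longrightarrow> dist (f g) (f h) \<le> op_dist g h"
  shows "f \<in> borel_measurable (borel_SU d)"
proof (rule borel_measurableI)
  interpret Metric_space "SU d" op_dist by (rule Metric_space_SU)
  fix S :: "'b set" assume S: "open S"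
  have "openin (SU_topology d) (f -` S \<inter> SU d)"
    unfolding SU_topology_def openin_mtopology
  proof (intro conjI ballI allI impI)
    fix x assume x: "x \<in> f -` S \<inter> SU d"
    then obtain e where e: "e > 0" "ball (f x) e \<subseteq> S" using S open_contains_ball by blast
    have "mball x e \<subseteq> f -` S \<inter> SU d"
    proof
      fix y assume "y \<in> mball x e"
      then have y: "x \<in> SU d" "y \<in> SU d" "op_dist x y < e" by auto
      then have "f y \<in> ball (f x) e" using assms[of x y] by simp
      then show "y \<in> f -` S \<inter> SU d" using e y by auto
    qed
    then show "\<exists>r>0. mball x r \<subseteq> f -` S \<inter> SU d" using e by blast
  qed auto
  then show "f -` S \<inter> space (borel_SU d) \<in> sets (borel_SU d)"
    by (simp add: space_borel_SU sets_borel_SU sigma_sets.Basic)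
qed

lemma measurable_entry_SU:
  assumes "i < d" "j < d"
  shows "(\<lambda>g. g $$ (i, j)) \<in> borel_measurable (borel_SU d)"
proof (rule lipschitz_measurable_SU)
  fix g h assume "g \<in> SU d" "h \<in> SU d"
  then show "dist (g $$ (i, j)) (h $$ (i, j)) \<le> op_dist g h"
    using norm_entry_le_op_norm[of i "g - h" j] assms SU_carrier[of g d] SU_carrier[of h d]
    by (simp add: op_dist_SU dist_norm)
qed

text \<open>
  Every open set of \<open>SU(d)\<close> is the trace of an open set in the space of matrix entries: around each of its
  points a box of entries fits into a ball. The product of countably many copies of the complex numbers
  is second countable, so measurability of the entries suffices there.
\<close>

lemma measurable_into_borel_SU:
  assumes range: "F \<in> space N \<rightarrow> SU d"
    and entries: "\<And>i j. i < d \<Longrightarrow> j < d \<Longrightarrow> (\<lambda>x. F x $$ (i, j)) \<in> borel_measurable N"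
  shows "F \<in> measurable N (borel_SU d)"
  unfolding borel_SU_def
proof (rule measurable_measure_of)
  interpret Metric_space "SU d" op_dist by (rule Metric_space_SU)
  show "{U. openin (SU_topology d) U} \<subseteq> Pow (SU d)"
    using openin_subset topspace_SU_topology by blast
  fix U assume "U \<in> {U. openin (SU_topology d) U}"
  then have U: "U \<subseteq> SU d" "\<forall>x\<in>U. \<exists>r>0. mball x r \<subseteq> U"
    unfolding SU_topology_def by (auto simp: openin_mtopology)
  from bchoice[OF U(2)] obtain r where r: "\<forall>x\<in>U. 0 < r x \<and> mball x (r x) \<subseteq> U" ..
  define E where "E x = (\<lambda>ij::nat \<times> nat. if fst ij < d \<and> snd ij < d then F x $$ ij else 0)" for x
  have E: "E \<in> borel_measurable N"
  proof (rule measurable_coordinatewise_then_product)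
    fix ij :: "nat \<times> nat"
    show "(\<lambda>x. E x ij) \<in> borel_measurable N"
      using entries[of "fst ij" "snd ij"] by (cases "fst ij < d \<and> snd ij < d") (auto simp: E_def)
  qed
  define q where "q x = r x / (real d * real d + 1)" for x
  define V where "V = (\<Union>x\<in>U. \<Inter>ij\<in>{..<d} \<times> {..<d}. {\<phi> :: nat \<times> nat \<Rightarrow> complex. dist (\<phi> ij) (x $$ ij) < q x})"
  have "open V" unfolding V_def
    by (intro open_UN ballI open_INT finite_SigmaI finite_lessThan open_Collect_less continuous_intros
        continuous_on_product_coordinates)
  moreover have "F -` U \<inter> space N = E -` V \<inter> space N"
  proof (intro equalityI subsetI)
    fix y assume "y \<in> F -` U \<inter> space N"
    then have y: "y \<in> space N" "F y \<in> U" by auto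
    then have "0 < q (F y)" using r by (simp add: q_def add_nonneg_pos)
    then have "E y \<in> V" unfolding V_def by (intro UN_I[OF y(2)]) (auto simp: E_def)
    then show "y \<in> E -` V \<inter> space N" using y by simp
  next
    fix y assume "y \<in> E -` V \<inter> space N"
    then have y: "y \<in> space N" "E y \<in> V" by auto
    then obtain x where x: "x \<in> U" "\<And>i j. i < d \<Longrightarrow> j < d \<Longrightarrow> dist (E y (i, j)) (x $$ (i, j)) < q x"
      unfolding V_def by auto
    have mem: "x \<in> SU d" "F y \<in> SU d" using x U range y by auto
    have "op_norm (x - F y) \<le> (\<Sum>i<d. \<Sum>j<d. cmod (x $$ (i, j) - F y $$ (i, j)))"
      using op_norm_le_sum_entries[of "x - F y"] mem[THEN SU_carrier] by simp
    also have "\<dots> \<le> (\<Sum>i<d. \<Sum>j<d. q x)"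
    proof (intro sum_mono)
      fix i j assume "i \<in> {..<d}" "j \<in> {..<d}"
      then show "cmod (x $$ (i, j) - F y $$ (i, j)) \<le> q x"
        using x(2)[of i j] by (simp add: E_def dist_norm norm_minus_commute)
    qed
    also have "\<dots> = (real d * real d) * q x" by simp
    also have "\<dots> < r x"
    proof -
      have "(real d * real d) * r x < r x * (real d * real d + 1)" using r x(1) by (simp add: algebra_simps)
      then show ?thesis by (simp add: q_def pos_divide_less_eq add_nonneg_pos)
    qed
    finally have "F y \<in> mball x (r x)" using mem by (simp add: op_dist_SU)
    then show "y \<in> F -` U \<inter> space N" using r x y by blast
  qed
  ultimately show "F -` U \<inter> space N \<in> sets N"
    using measurable_sets[OF E, of V] by simp
qed (use range in auto)

lemma measurable_mult_SU:
  assumes "F \<in> measurable N (borel_SU d)" "G \<in> measurable N (borel_SU d)"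
  shows "(\<lambda>x. F x * G x) \<in> measurable N (borel_SU d)"
proof (rule measurable_into_borel_SU)
  have FG: "F x \<in> SU d" "G x \<in> SU d" if "x \<in> space N" for x
    using assms[THEN measurable_space] that by (auto simp: space_borel_SU)
  then show "(\<lambda>x. F x * G x) \<in> space N \<rightarrow> SU d" by (auto intro: SU_mult)
  fix i j assume ij: "i < d" "j < d"
  have "(\<lambda>x. \<Sum>k<d. F x $$ (i, k) * G x $$ (k, j)) \<in> borel_measurable N"
    using ij measurable_compose[OF assms(1) measurable_entry_SU] measurable_compose[OF assms(2) measurable_entry_SU]
    by (intro borel_measurable_sum borel_measurable_times) auto
  then show "(\<lambda>x. (F x * G x) $$ (i, j)) \<in> borel_measurable N"
    using FG[THEN SU_carrier] ij by (subst measurable_cong[where g = "\<lambda>x. \<Sum>k<d. F x $$ (i, k) * G x $$ (k, j)"])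
      (auto intro!: index_mult_sum simp del: index_mult_mat(1))
qed

lemma measurable_adjoint_SU:
  assumes "F \<in> measurable N (borel_SU d)"
  shows "(\<lambda>x. mat_adjoint (F x)) \<in> measurable N (borel_SU d)"
proof (rule measurable_into_borel_SU)
  have F: "F x \<in> SU d" if "x \<in> space N" for x
    using assms[THEN measurable_space] that by (auto simp: space_borel_SU)
  then show "(\<lambda>x. mat_adjoint (F x)) \<in> space N \<rightarrow> SU d" by (auto intro: SU_adjoint)
  fix i j assume ij: "i < d" "j < d"
  have "(\<lambda>x. cnj (F x $$ (j, i))) \<in> borel_measurable N"
    using measurable_compose[OF assms measurable_entry_SU[OF ij(2,1)]]
    by (rule borel_measurable_continuous_on[OF continuous_on_cnj[OF continuous_on_id]])
  then show "(\<lambda>x. mat_adjoint (F x) $$ (i, j)) \<in> borel_measurable N"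
    using F[THEN SU_carrier] ij
    by (subst measurable_cong[where g = "\<lambda>x. cnj (F x $$ (j, i))"]) (auto intro!: index_adjoint)
qed

lemma measurable_embed_SU:
  assumes "i < d" "2 \<le> d"
  shows "embed_SU2 d i \<in> measurable (borel_SU 2) (borel_SU d)"
proof (rule measurable_into_borel_SU)
  show "embed_SU2 d i \<in> space (borel_SU 2) \<rightarrow> SU d" using assms by (auto simp: space_borel_SU embed_in_SU)
  fix r c assume rc: "r < d" "c < d"
  show "(\<lambda>x. embed_SU2 d i x $$ (r, c)) \<in> borel_measurable (borel_SU 2)"
    unfolding embed_index[OF rc]
    by (cases "r \<in> {i, next_index d i} \<and> c \<in> {i, next_index d i}") (auto intro!: measurable_entry_SU)
qed

section \<open>Integral inequalities\<close>

lemma L2_triangle: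
  fixes f g :: "'a \<Rightarrow> real"
  assumes "integrable M (\<lambda>x. (f x)\<^sup>2)" "integrable M (\<lambda>x. (g x)\<^sup>2)" "integrable M (\<lambda>x. (f x + g x)\<^sup>2)"
  shows "sqrt (\<integral>x. (f x + g x)\<^sup>2 \<partial>M) \<le> sqrt (\<integral>x. (f x)\<^sup>2 \<partial>M) + sqrt (\<integral>x. (g x)\<^sup>2 \<partial>M)"
proof (rule field_le_epsilon)
  fix e :: real assume e: "0 < e"
  define A B where "A = sqrt (\<integral>x. (f x)\<^sup>2 \<partial>M)" and "B = sqrt (\<integral>x. (g x)\<^sup>2 \<partial>M)"
  have AB: "0 \<le> A" "0 \<le> B" "(\<integral>x. (f x)\<^sup>2 \<partial>M) = A\<^sup>2" "(\<integral>x. (g x)\<^sup>2 \<partial>M) = B\<^sup>2" by (auto simp: A_def B_def)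
  \<comment> \<open>The weighted inequality below is sharp at \<open>a = A\<close>, \<open>b = B\<close>; the margin \<open>e\<close> keeps the weights positive.\<close>
  define a b where "a = A + e / 2" and "b = B + e / 2"
  have ab: "0 < a" "0 < b" using e AB by (auto simp: a_def b_def)
  have pw: "(s + t)\<^sup>2 \<le> (a + b) * (s\<^sup>2 / a + t\<^sup>2 / b)" for s t :: real
  proof -
    have "(a + b) * (s\<^sup>2 / a + t\<^sup>2 / b) - (s + t)\<^sup>2 = (b * s - a * t)\<^sup>2 / (a * b)"
      using ab by (simp add: field_simps power2_eq_square)
    moreover have "0 \<le> (b * s - a * t)\<^sup>2 / (a * b)" using ab by simp
    ultimately show ?thesis by linarith
  qed
  have "(\<integral>x. (f x + g x)\<^sup>2 \<partial>M) \<le> (\<integral>x. (a + b) * ((f x)\<^sup>2 / a + (g x)\<^sup>2 / b) \<partial>M)"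
    using assms pw by (intro integral_mono) auto
  also have "\<dots> = (a + b) * (A\<^sup>2 / a + B\<^sup>2 / b)" using assms AB by simp
  also have "\<dots> \<le> (a + b) * (a + b)"
  proof -
    have "A * A \<le> a * a" "B * B \<le> b * b" using AB e by (auto simp: a_def b_def intro!: mult_mono)
    then have "A\<^sup>2 / a \<le> a" "B\<^sup>2 / b \<le> b" using ab by (simp_all add: pos_divide_le_eq power2_eq_square)
    then show ?thesis using ab by (intro mult_left_mono) auto
  qed
  finally have "sqrt (\<integral>x. (f x + g x)\<^sup>2 \<partial>M) \<le> a + b"
    using ab by (intro real_le_lsqrt) (auto simp: power2_eq_square)
  then show "sqrt (\<integral>x. (f x + g x)\<^sup>2 \<partial>M) \<le> sqrt (\<integral>x. (f x)\<^sup>2 \<partial>M) + sqrt (\<integral>x. (g x)\<^sup>2 \<partial>M) + e"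
    by (simp add: a_def b_def A_def B_def)
qed

lemma Fubini_bounded:
  fixes f :: "'a \<Rightarrow> 'b \<Rightarrow> real"
  assumes "prob_space M" "prob_space N" "(\<lambda>(x, y). f x y) \<in> borel_measurable (M \<Otimes>\<^sub>M N)"
    and bound: "\<And>x y. x \<in> space M \<Longrightarrow> y \<in> space N \<Longrightarrow> \<bar>f x y\<bar> \<le> B"
  shows "(\<integral>y. \<integral>x. f x y \<partial>M \<partial>N) = (\<integral>x. \<integral>y. f x y \<partial>N \<partial>M)"
proof -
  interpret M: prob_space M by fact
  interpret N: prob_space N by fact
  interpret pair_prob_space M N ..
  have "integrable (M \<Otimes>\<^sub>M N) (\<lambda>(x, y). f x y)"
    using assms(3) bound by (intro P.integrable_const_bound[of _ B]) (auto simp: space_pair_measure)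
  then show ?thesis by (rule Fubini_integral)
qed


section \<open>The averaging operator of a random walk\<close>

definition lipschitz_SU :: "nat \<Rightarrow> (complex mat \<Rightarrow> real) \<Rightarrow> bool" where
  "lipschitz_SU d f \<longleftrightarrow> (\<forall>g\<in>SU d. \<forall>h\<in>SU d. \<bar>f g - f h\<bar> \<le> op_dist g h)"

definition bdd_measurable :: "nat \<Rightarrow> (complex mat \<Rightarrow> real) \<Rightarrow> bool" where
  "bdd_measurable d f \<longleftrightarrow> f \<in> borel_measurable (borel_SU d) \<and> (\<exists>B. \<forall>x\<in>SU d. \<bar>f x\<bar> \<le> B)"

definition translate :: "complex mat \<Rightarrow> (complex mat \<Rightarrow> real) \<Rightarrow> complex mat \<Rightarrow> real" where
  "translate g f x = f (g * x)"

lemma bdd_measurable_diff: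
  assumes "bdd_measurable d f" "bdd_measurable d h"
  shows "bdd_measurable d (\<lambda>x. f x - h x)"
proof -
  obtain A B where "\<forall>x\<in>SU d. \<bar>f x\<bar> \<le> A" "\<forall>x\<in>SU d. \<bar>h x\<bar> \<le> B"
    using assms by (auto simp: bdd_measurable_def)
  then have "\<forall>x\<in>SU d. \<bar>f x - h x\<bar> \<le> A + B" by (metis abs_triangle_ineq4 add_mono order_trans)
  then show ?thesis using assms unfolding bdd_measurable_def by (auto intro!: borel_measurable_diff)
qed

lemma bdd_measurable_mult:
  assumes "bdd_measurable d f" "bdd_measurable d h"
  shows "bdd_measurable d (\<lambda>x. f x * h x)"
proof -
  obtain A B where "\<forall>x\<in>SU d. \<bar>f x\<bar> \<le> A" "\<forall>x\<in>SU d. \<bar>h x\<bar> \<le> B"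
    using assms by (auto simp: bdd_measurable_def)
  then have "\<forall>x\<in>SU d. \<bar>f x * h x\<bar> \<le> A * B"
    unfolding abs_mult by (meson abs_ge_zero mult_mono order_trans)
  then show ?thesis using assms unfolding bdd_measurable_def by (auto intro!: borel_measurable_times)
qed

lemma bdd_measurable_square:
  "bdd_measurable d f \<Longrightarrow> bdd_measurable d (\<lambda>x. (f x)\<^sup>2)"
  using bdd_measurable_mult[of d f f] by (simp add: power2_eq_square)

lemma bdd_measurable_translate:
  assumes "bdd_measurable d f" "g \<in> SU d"
  shows "bdd_measurable d (translate g f)"
proof -
  have "(\<lambda>x. g * x) \<in> measurable (borel_SU d) (borel_SU d)"
    using assms by (intro measurable_mult_SU) (auto simp: space_borel_SU)
  then have "translate g f \<in> borel_measurable (borel_SU d)"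
    using assms measurable_compose[of "\<lambda>x. g * x" "borel_SU d" "borel_SU d" f borel]
    by (auto simp: bdd_measurable_def translate_def[abs_def])
  then show ?thesis using assms SU_mult by (fastforce simp: bdd_measurable_def translate_def)
qed

lemma lipschitz_SU_bounded_by:
  assumes "lipschitz_SU d f" "x \<in> SU d"
  shows "\<bar>f x\<bar> \<le> \<bar>f (1\<^sub>m d)\<bar> + 2"
proof -
  have "\<bar>f x - f (1\<^sub>m d)\<bar> \<le> op_dist x (1\<^sub>m d)" using assms SU_one by (auto simp: lipschitz_SU_def)
  then show ?thesis using op_dist_SU_le_2[OF assms(2) SU_one] by linarith
qed

lemma lipschitz_SU_bounded_measurable: "lipschitz_SU d f \<Longrightarrow> bdd_measurable d f"
  unfolding bdd_measurable_def
proof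
  assume f: "lipschitz_SU d f"
  then show "f \<in> borel_measurable (borel_SU d)"
    by (intro lipschitz_measurable_SU) (auto simp: lipschitz_SU_def dist_real_def)
  show "\<exists>B. \<forall>x\<in>SU d. \<bar>f x\<bar> \<le> B" using lipschitz_SU_bounded_by[OF f] by blast
qed

lemma translate_mult:
  "g \<in> SU d \<Longrightarrow> h \<in> SU d \<Longrightarrow> x \<in> SU d \<Longrightarrow> translate (g * h) f x = translate h (translate g f) x"
  by (simp add: translate_def SU_assoc[of _ d])

locale SU_walk =
  fixes d :: nat and m \<nu> :: "complex mat measure"
  assumes haar: "normalized_haar_SU d m" and prob_\<nu>: "prob_space \<nu>" and sets_\<nu>: "sets \<nu> = sets (borel_SU d)"
begin

lemma prob_m: "prob_space m" and sets_m: "sets m = sets (borel_SU d)"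
  and invariant_m: "g \<in> SU d \<Longrightarrow> distr m (borel_SU d) (\<lambda>h. g * h) = m"
  using haar by (auto simp: normalized_haar_SU_def)

lemma space_m: "space m = SU d" and space_\<nu>: "space \<nu> = SU d"
  using sets_eq_imp_space_eq[OF sets_m] sets_eq_imp_space_eq[OF sets_\<nu>] by (simp_all add: space_borel_SU)

lemma measurable_m: "measurable m = measurable (borel_SU d)" and measurable_\<nu>: "measurable \<nu> = measurable (borel_SU d)"
  by (intro ext measurable_cong_sets sets_m sets_\<nu> refl)+

lemma integrable_bounded_measurable:
  assumes "bdd_measurable d f"
  shows "integrable m f" "integrable \<nu> f"
proof -
  interpret M: prob_space m by (rule prob_m)
  interpret N: prob_space \<nu> by (rule prob_\<nu>)
  obtain B where B: "\<forall>x\<in>SU d. \<bar>f x\<bar> \<le> B" and f: "f \<in> borel_measurable (borel_SU d)"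
    using assms by (auto simp: bdd_measurable_def)
  show "integrable m f" using B f by (intro M.integrable_const_bound[of _ B]) (auto simp: space_m measurable_m)
  show "integrable \<nu> f" using B f by (intro N.integrable_const_bound[of _ B]) (auto simp: space_\<nu> measurable_\<nu>)
qed

lemma integral_translate:
  assumes "bdd_measurable d f" "g \<in> SU d"
  shows "(\<integral>x. translate g f x \<partial>m) = (\<integral>x. f x \<partial>m)"
proof -
  have "(\<lambda>x. g * x) \<in> measurable m (borel_SU d)"
    unfolding measurable_m using assms by (intro measurable_mult_SU) (auto simp: space_borel_SU)
  then have "(\<integral>x. f x \<partial>distr m (borel_SU d) (\<lambda>x. g * x)) = (\<integral>x. f (g * x) \<partial>m)"
    using assms by (intro integral_distr) (auto simp: bdd_measurable_def)
  then show ?thesis using invariant_m[OF assms(2)] by (simp add: translate_def)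
qed

definition L2_dist :: "(complex mat \<Rightarrow> real) \<Rightarrow> (complex mat \<Rightarrow> real) \<Rightarrow> real" where
  "L2_dist f h = sqrt (\<integral>x. (f x - h x)\<^sup>2 \<partial>m)"

lemma L2_dist_nonneg: "0 \<le> L2_dist f h" and L2_dist_sym: "L2_dist f h = L2_dist h f" and L2_dist_self: "L2_dist f f = 0"
  by (simp_all add: L2_dist_def power2_commute)

lemma L2_dist_square: "(L2_dist f h)\<^sup>2 = (\<integral>x. (f x - h x)\<^sup>2 \<partial>m)"
  by (simp add: L2_dist_def)

lemma L2_dist_cong:
  "(\<And>x. x \<in> SU d \<Longrightarrow> f x = f' x) \<Longrightarrow> (\<And>x. x \<in> SU d \<Longrightarrow> h x = h' x) \<Longrightarrow> L2_dist f h = L2_dist f' h'"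
  unfolding L2_dist_def by (intro arg_cong[where f = sqrt] Bochner_Integration.integral_cong) (auto simp: space_m)

lemma L2_dist_triangle:
  assumes "bdd_measurable d f" "bdd_measurable d g" "bdd_measurable d h"
  shows "L2_dist f h \<le> L2_dist f g + L2_dist g h"
proof -
  have i: "integrable m (\<lambda>x. (u x - v x)\<^sup>2)" if "bdd_measurable d u" "bdd_measurable d v" for u v
    using that by (intro integrable_bounded_measurable bdd_measurable_square bdd_measurable_diff)
  show ?thesis
    using L2_triangle[of m "\<lambda>x. f x - g x" "\<lambda>x. g x - h x"] i[OF assms(1,2)] i[OF assms(2,3)] i[OF assms(1,3)]
    by (simp add: L2_dist_def)
qed

lemma L2_dist_translate:
  assumes "bdd_measurable d f" "bdd_measurable d h" "g \<in> SU d"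
  shows "L2_dist (translate g f) (translate g h) = L2_dist f h"
  using integral_translate[OF bdd_measurable_square[OF bdd_measurable_diff[OF assms(1,2)]] assms(3)]
  by (simp add: L2_dist_def translate_def)

lemma L2_dist_le_sup:
  assumes "bdd_measurable d f" "bdd_measurable d h" "\<And>x. x \<in> SU d \<Longrightarrow> \<bar>f x - h x\<bar> \<le> B" "0 \<le> B"
  shows "L2_dist f h \<le> B"
proof -
  interpret M: prob_space m by (rule prob_m)
  have "(\<integral>x. (f x - h x)\<^sup>2 \<partial>m) \<le> (\<integral>x. B\<^sup>2 \<partial>m)"
  proof (rule integral_mono)
    show "integrable m (\<lambda>x. (f x - h x)\<^sup>2)"
      using assms by (intro integrable_bounded_measurable bdd_measurable_square bdd_measurable_diff)
    fix x assume "x \<in> space m"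
    then have "\<bar>f x - h x\<bar>\<^sup>2 \<le> B\<^sup>2" using assms by (intro power_mono) (auto simp: space_m)
    then show "(f x - h x)\<^sup>2 \<le> B\<^sup>2" by simp
  qed simp
  then show ?thesis using assms(4) unfolding L2_dist_def by (intro real_le_lsqrt) (auto simp: M.prob_space)
qed

definition T :: "(complex mat \<Rightarrow> real) \<Rightarrow> complex mat \<Rightarrow> real" where
  "T f x = (\<integral>g. f (g * x) \<partial>\<nu>)"

lemma bdd_measurable_right:
  assumes "bdd_measurable d f" "x \<in> SU d"
  shows "bdd_measurable d (\<lambda>g. f (g * x))"
proof -
  have "(\<lambda>g. g * x) \<in> measurable (borel_SU d) (borel_SU d)"
    using assms by (intro measurable_mult_SU) (auto simp: space_borel_SU)
  then have "(\<lambda>g. f (g * x)) \<in> borel_measurable (borel_SU d)"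
    using assms measurable_compose[of "\<lambda>g. g * x" "borel_SU d" "borel_SU d" f borel]
    by (auto simp: bdd_measurable_def)
  then show ?thesis using assms SU_mult by (fastforce simp: bdd_measurable_def)
qed

lemma lipschitz_SU_T:
  assumes "lipschitz_SU d f"
  shows "lipschitz_SU d (T f)"
  unfolding lipschitz_SU_def
proof (intro ballI)
  interpret N: prob_space \<nu> by (rule prob_\<nu>)
  fix x y assume xy: "x \<in> SU d" "y \<in> SU d"
  note bm = lipschitz_SU_bounded_measurable[OF assms]
  note i = integrable_bounded_measurable(2)[OF bdd_measurable_right[OF bm xy(1)]]
    integrable_bounded_measurable(2)[OF bdd_measurable_right[OF bm xy(2)]]
  have "\<bar>T f x - T f y\<bar> = \<bar>\<integral>g. f (g * x) - f (g * y) \<partial>\<nu>\<bar>" using i by (simp add: T_def)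
  also have "\<dots> \<le> (\<integral>g. \<bar>f (g * x) - f (g * y)\<bar> \<partial>\<nu>)" by (rule integral_abs_bound)
  also have "\<dots> \<le> (\<integral>g. op_dist x y \<partial>\<nu>)"
  proof (rule integral_mono)
    fix g assume "g \<in> space \<nu>"
    then have g: "g \<in> SU d" by (simp add: space_\<nu>)
    then have "\<bar>f (g * x) - f (g * y)\<bar> \<le> op_dist (g * x) (g * y)"
      using assms xy SU_mult by (auto simp: lipschitz_SU_def)
    then show "\<bar>f (g * x) - f (g * y)\<bar> \<le> op_dist x y" using op_dist_mult_left[OF g xy] by simp
  qed (use i in auto)
  finally show "\<bar>T f x - T f y\<bar> \<le> op_dist x y" by (simp add: N.prob_space)
qed

lemma measurable_action:
  assumes "bdd_measurable d f"
  shows "(\<lambda>(x, g). f (g * x)) \<in> borel_measurable (m \<Otimes>\<^sub>M \<nu>)"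
proof -
  have "(\<lambda>z. snd z * fst z) \<in> measurable (m \<Otimes>\<^sub>M \<nu>) (borel_SU d)"
    using measurable_fst[of m \<nu>] measurable_snd[of m \<nu>]
    by (intro measurable_mult_SU) (simp_all cong: measurable_cong_sets add: measurable_cong_sets[OF refl sets_m] measurable_cong_sets[OF refl sets_\<nu>])
  then show ?thesis
    using assms measurable_compose[of "\<lambda>z. snd z * fst z" "m \<Otimes>\<^sub>M \<nu>" "borel_SU d" f borel]
    by (auto simp: bdd_measurable_def case_prod_beta')
qed

lemma action_swap:
  assumes "bdd_measurable d f"
  shows "(\<integral>x. \<integral>g. f (g * x) \<partial>\<nu> \<partial>m) = (\<integral>x. f x \<partial>m)"
proof -
  interpret N: prob_space \<nu> by (rule prob_\<nu>)
  obtain B where B: "\<forall>x\<in>SU d. \<bar>f x\<bar> \<le> B" using assms by (auto simp: bdd_measurable_def)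
  have "(\<integral>x. \<integral>g. f (g * x) \<partial>\<nu> \<partial>m) = (\<integral>g. \<integral>x. f (g * x) \<partial>m \<partial>\<nu>)"
    using B by (intro Fubini_bounded[symmetric, where B = B] prob_m prob_\<nu> measurable_action assms)
      (auto simp: space_m space_\<nu> intro: SU_mult)
  also have "\<dots> = (\<integral>g. (\<integral>x. f x \<partial>m) \<partial>\<nu>)"
  proof (rule Bochner_Integration.integral_cong[OF refl])
    fix g assume "g \<in> space \<nu>"
    then show "(\<integral>x. f (g * x) \<partial>m) = (\<integral>x. f x \<partial>m)"
      using integral_translate[OF assms, of g] by (simp add: space_\<nu> translate_def)
  qed
  finally show ?thesis by (simp add: N.prob_space)
qed

lemma integral_T: "bdd_measurable d f \<Longrightarrow> (\<integral>x. T f x \<partial>m) = (\<integral>x. f x \<partial>m)"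
  using action_swap by (simp add: T_def)

lemma measurable_displacement:
  assumes "bdd_measurable d f" "bdd_measurable d h"
  shows "(\<lambda>(x, g). (f (g * x) - h x)\<^sup>2) \<in> borel_measurable (m \<Otimes>\<^sub>M \<nu>)"
proof -
  have "(\<lambda>z. h (fst z)) \<in> borel_measurable (m \<Otimes>\<^sub>M \<nu>)"
    using assms(2) by (intro measurable_compose[OF measurable_fst]) (auto simp: bdd_measurable_def measurable_m)
  then show ?thesis using measurable_action[OF assms(1)] by (simp add: case_prod_beta')
qed

lemma measurable_D_translate:
  assumes "bdd_measurable d f" "bdd_measurable d h"
  shows "(\<lambda>g. (L2_dist (translate g f) h)\<^sup>2) \<in> borel_measurable (borel_SU d)"
proof -
  interpret M: prob_space m by (rule prob_m)
  interpret N: prob_space \<nu> by (rule prob_\<nu>)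
  interpret pair_prob_space m \<nu> ..
  have "(\<lambda>(g, x). (f (g * x) - h x)\<^sup>2) \<in> borel_measurable (\<nu> \<Otimes>\<^sub>M m)"
    using measurable_compose[OF measurable_pair_swap'[of \<nu> m] measurable_displacement[OF assms]]
    by (simp add: case_prod_beta')
  then have "(\<lambda>g. \<integral>x. (f (g * x) - h x)\<^sup>2 \<partial>m) \<in> borel_measurable \<nu>"
    by (rule M.borel_measurable_lebesgue_integral)
  then show ?thesis by (simp add: L2_dist_square translate_def measurable_\<nu>)
qed

text \<open>
  For fixed \<open>x\<close>, the number \<open>T f x\<close> is the mean of the random variable \<open>g \<mapsto> f (g x)\<close>, so the inner
  integral over \<open>g\<close> is its variance. The second moments integrate to \<open>\<parallel>f\<parallel>\<^sup>2\<close> by invariance of Haar measure.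
\<close>

lemma variance_identity:
  assumes "lipschitz_SU d f"
  shows "(\<integral>g. (L2_dist (translate g f) (T f))\<^sup>2 \<partial>\<nu>) = (\<integral>x. (f x)\<^sup>2 \<partial>m) - (\<integral>x. (T f x)\<^sup>2 \<partial>m)"
proof -
  interpret N: prob_space \<nu> by (rule prob_\<nu>)
  note f = lipschitz_SU_bounded_measurable[OF assms]
  note Tf = lipschitz_SU_bounded_measurable[OF lipschitz_SU_T[OF assms]]
  obtain A where A: "\<forall>x\<in>SU d. \<bar>f x\<bar> \<le> A" using f by (auto simp: bdd_measurable_def)
  obtain B where B: "\<forall>x\<in>SU d. \<bar>T f x\<bar> \<le> B" using Tf by (auto simp: bdd_measurable_def)
  have "(\<integral>g. (L2_dist (translate g f) (T f))\<^sup>2 \<partial>\<nu>) = (\<integral>g. \<integral>x. (f (g * x) - T f x)\<^sup>2 \<partial>m \<partial>\<nu>)"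
    by (simp add: L2_dist_square translate_def)
  also have "\<dots> = (\<integral>x. \<integral>g. (f (g * x) - T f x)\<^sup>2 \<partial>\<nu> \<partial>m)"
  proof (intro Fubini_bounded[where B = "(A + B)\<^sup>2"] prob_m prob_\<nu> measurable_displacement f Tf)
    fix x g assume "x \<in> space m" "g \<in> space \<nu>"
    then have "\<bar>f (g * x)\<bar> \<le> A" "\<bar>T f x\<bar> \<le> B" using A B SU_mult by (auto simp: space_m space_\<nu>)
    then have "\<bar>f (g * x) - T f x\<bar> \<le> \<bar>A + B\<bar>" by linarith
    then show "\<bar>(f (g * x) - T f x)\<^sup>2\<bar> \<le> (A + B)\<^sup>2" by (simp add: abs_le_square_iff)
  qed
  also have "\<dots> = (\<integral>x. (\<integral>g. (f (g * x))\<^sup>2 \<partial>\<nu>) - (T f x)\<^sup>2 \<partial>m)"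
  proof (rule Bochner_Integration.integral_cong[OF refl])
    fix x assume "x \<in> space m"
    then have x: "x \<in> SU d" by (simp add: space_m)
    note r = bdd_measurable_right[OF f x]
    note i = integrable_bounded_measurable(2)[OF r] integrable_bounded_measurable(2)[OF bdd_measurable_square[OF r]]
    have "(\<integral>g. (f (g * x) - T f x)\<^sup>2 \<partial>\<nu>) = (\<integral>g. (f (g * x))\<^sup>2 - 2 * T f x * f (g * x) + (T f x)\<^sup>2 \<partial>\<nu>)"
      by (intro Bochner_Integration.integral_cong) (auto simp: power2_diff algebra_simps)
    also have "\<dots> = (\<integral>g. (f (g * x))\<^sup>2 \<partial>\<nu>) - 2 * T f x * T f x + (T f x)\<^sup>2"
      using i by (simp add: T_def N.prob_space)
    finally show "(\<integral>g. (f (g * x) - T f x)\<^sup>2 \<partial>\<nu>) = (\<integral>g. (f (g * x))\<^sup>2 \<partial>\<nu>) - (T f x)\<^sup>2"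
      by (simp add: power2_eq_square)
  qed
  also have "\<dots> = (\<integral>x. \<integral>g. (f (g * x))\<^sup>2 \<partial>\<nu> \<partial>m) - (\<integral>x. (T f x)\<^sup>2 \<partial>m)"
  proof (rule Bochner_Integration.integral_diff)
    interpret M: prob_space m by (rule prob_m)
    show "integrable m (\<lambda>x. \<integral>g. (f (g * x))\<^sup>2 \<partial>\<nu>)"
    proof (rule M.integrable_const_bound[of _ "A\<^sup>2"])
      show "(\<lambda>x. \<integral>g. (f (g * x))\<^sup>2 \<partial>\<nu>) \<in> borel_measurable m"
        using measurable_action[OF bdd_measurable_square[OF f]] by (intro N.borel_measurable_lebesgue_integral) simp
      have "\<bar>\<integral>g. (f (g * x))\<^sup>2 \<partial>\<nu>\<bar> \<le> A\<^sup>2" if x: "x \<in> SU d" for x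
      proof -
        have "(\<integral>g. (f (g * x))\<^sup>2 \<partial>\<nu>) \<le> (\<integral>g. A\<^sup>2 \<partial>\<nu>)"
        proof (rule integral_mono)
          fix g assume "g \<in> space \<nu>"
          then have "\<bar>f (g * x)\<bar> \<le> \<bar>A\<bar>" using A x SU_mult[of g d x] by (force simp: space_\<nu>)
          then show "(f (g * x))\<^sup>2 \<le> A\<^sup>2" by (simp add: abs_le_square_iff)
        qed (use integrable_bounded_measurable(2)[OF bdd_measurable_square[OF bdd_measurable_right[OF f x]]] in auto)
        then show ?thesis by (simp add: N.prob_space)
      qed
      then show "AE x in m. norm (\<integral>g. (f (g * x))\<^sup>2 \<partial>\<nu>) \<le> A\<^sup>2" by (auto simp: space_m)
    qed
    show "integrable m (\<lambda>x. (T f x)\<^sup>2)" by (intro integrable_bounded_measurable bdd_measurable_square Tf)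
  qed
  also have "(\<integral>x. \<integral>g. (f (g * x))\<^sup>2 \<partial>\<nu> \<partial>m) = (\<integral>x. (f x)\<^sup>2 \<partial>m)"
    using action_swap[OF bdd_measurable_square[OF f]] by simp
  finally show ?thesis .
qed

lemma translate_lipschitz_dist:
  assumes "lipschitz_SU d f" "g \<in> SU d" "h \<in> SU d"
  shows "L2_dist (translate g f) (translate h f) \<le> op_dist g h"
proof (rule L2_dist_le_sup)
  fix x assume x: "x \<in> SU d"
  then show "\<bar>translate g f x - translate h f x\<bar> \<le> op_dist g h"
    using assms op_dist_mult_right[of x d g h] SU_mult unfolding lipschitz_SU_def translate_def by metis
qed (use assms Metric_space.nonneg[OF Metric_space_SU] lipschitz_SU_bounded_measurable[OF assms(1)] in
    \<open>auto intro!: bdd_measurable_translate\<close>)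

text \<open>
  Translations act by isometries of L2, so the distance by which they move \<open>f\<close> is a length function on
  the group.
\<close>

lemma displacement_mult:
  assumes f: "bdd_measurable d f" and gh: "g \<in> SU d" "h \<in> SU d"
  shows "L2_dist (translate (g * h) f) f \<le> L2_dist (translate g f) f + L2_dist (translate h f) f"
proof -
  have "L2_dist (translate (g * h) f) f = L2_dist (translate h (translate g f)) f"
    using gh by (intro L2_dist_cong) (auto simp: translate_mult)
  also have "\<dots> \<le> L2_dist (translate h (translate g f)) (translate h f) + L2_dist (translate h f) f"
    using f gh by (intro L2_dist_triangle bdd_measurable_translate)
  also have "L2_dist (translate h (translate g f)) (translate h f) = L2_dist (translate g f) f"
    using f gh by (intro L2_dist_translate bdd_measurable_translate)
  finally show ?thesis .
qed

text \<open>Two functions \<open>f\<close> and \<open>h\<close> occur because inverse letters move between different functions of a sequence.\<close>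

lemma displacement_adjoint:
  assumes f: "bdd_measurable d f" "bdd_measurable d h" and g: "g \<in> SU d"
  shows "L2_dist (translate (mat_adjoint g) f) h = L2_dist (translate g h) f"
proof -
  have "L2_dist (translate (mat_adjoint g) f) h = L2_dist (translate g (translate (mat_adjoint g) f)) (translate g h)"
    using f g by (intro L2_dist_translate[symmetric] bdd_measurable_translate SU_adjoint)
  also have "\<dots> = L2_dist f (translate g h)"
    using g by (intro L2_dist_cong) (auto simp: translate_def SU_cancel SU_adjoint)
  finally show ?thesis by (simp add: L2_dist_sym)
qed

text \<open>
  Expanding \<open>\<parallel>f(h\<^sup>-\<^sup>1 \<cdot>) - f\<parallel>\<^sup>2 = 2 \<parallel>f\<parallel>\<^sup>2 - 2 \<langle>f(h\<^sup>-\<^sup>1 \<cdot>), f\<rangle>\<close> and averaging over \<open>h\<close> kills the inner product,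
  since the average of \<open>f(h\<^sup>-\<^sup>1 x)\<close> over \<open>h\<close> is a constant and \<open>f\<close> has mean zero.
\<close>

lemma norm_le_displacement:
  assumes f: "bdd_measurable d f" and mean: "(\<integral>x. f x \<partial>m) = 0"
    and disp: "\<And>h. h \<in> SU d \<Longrightarrow> L2_dist (translate h f) f \<le> b"
  shows "(\<integral>x. (f x)\<^sup>2 \<partial>m) \<le> b\<^sup>2"
proof -
  interpret M: prob_space m by (rule prob_m)
  define S where "S = (\<integral>x. (f x)\<^sup>2 \<partial>m)"
  obtain A where A: "\<forall>x\<in>SU d. \<bar>f x\<bar> \<le> A" using f by (auto simp: bdd_measurable_def)
  define k where "k x h = f (mat_adjoint h * x) * f x" for x h
  have k_meas: "(\<lambda>(x, h). k x h) \<in> borel_measurable (m \<Otimes>\<^sub>M m)"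
  proof -
    have p: "fst \<in> measurable (m \<Otimes>\<^sub>M m) (borel_SU d)" "snd \<in> measurable (m \<Otimes>\<^sub>M m) (borel_SU d)"
      using measurable_fst[of m m] measurable_snd[of m m] measurable_cong_sets[OF refl sets_m] by blast+
    have "(\<lambda>z. f (mat_adjoint (snd z) * fst z)) \<in> borel_measurable (m \<Otimes>\<^sub>M m)"
      using f by (intro measurable_compose[OF measurable_mult_SU[OF measurable_adjoint_SU[OF p(2)] p(1)]])
        (auto simp: bdd_measurable_def)
    moreover have "(\<lambda>z. f (fst z)) \<in> borel_measurable (m \<Otimes>\<^sub>M m)"
      using f by (intro measurable_compose[OF p(1)]) (auto simp: bdd_measurable_def)
    ultimately show ?thesis unfolding k_def by (simp add: case_prod_beta')
  qed
  have k_bound: "\<bar>k x h\<bar> \<le> A * A" if "x \<in> space m" "h \<in> space m" for x h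
    unfolding k_def abs_mult using A that SU_mult[OF SU_adjoint] unfolding space_m
    by (intro mult_mono) (auto intro: order_trans[OF abs_ge_zero])
  have inner: "2 * S - 2 * (\<integral>x. k x h \<partial>m) \<le> b\<^sup>2" if "h \<in> space m" for h
  proof -
    have h: "mat_adjoint h \<in> SU d" using that by (simp add: space_m SU_adjoint)
    note t = bdd_measurable_translate[OF f h]
    have "(\<integral>x. (translate (mat_adjoint h) f x - f x)\<^sup>2 \<partial>m)
      = (\<integral>x. (translate (mat_adjoint h) f x)\<^sup>2 + (f x)\<^sup>2 - 2 * (translate (mat_adjoint h) f x * f x) \<partial>m)"
      by (intro Bochner_Integration.integral_cong) (auto simp: power2_diff algebra_simps)
    also have "\<dots> = (\<integral>x. (translate (mat_adjoint h) f x)\<^sup>2 \<partial>m) + S - 2 * (\<integral>x. k x h \<partial>m)"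
      using integrable_bounded_measurable(1)[OF bdd_measurable_square[OF t]]
        integrable_bounded_measurable(1)[OF bdd_measurable_square[OF f]]
        integrable_bounded_measurable(1)[OF bdd_measurable_mult[OF t f]]
      by (simp add: S_def k_def translate_def)
    also have "(\<integral>x. (translate (mat_adjoint h) f x)\<^sup>2 \<partial>m) = S"
      using integral_translate[OF bdd_measurable_square[OF f] h] by (simp add: S_def translate_def)
    finally have "(L2_dist (translate (mat_adjoint h) f) f)\<^sup>2 = 2 * S - 2 * (\<integral>x. k x h \<partial>m)" by (simp add: L2_dist_square)
    moreover have "(L2_dist (translate (mat_adjoint h) f) f)\<^sup>2 \<le> b\<^sup>2"
      using disp[OF h] L2_dist_nonneg by (intro power_mono)
    ultimately show ?thesis by simp
  qed
  \<comment> \<open>\<open>f (h\<^sup>-\<^sup>1 x)\<close> is the function \<open>h \<mapsto> f (h\<^sup>-\<^sup>1)\<close> at \<open>x\<^sup>-\<^sup>1 h\<close>, so by left invariance its average over \<open>h\<close>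
    does not depend on \<open>x\<close>.\<close>
  define c where "c = (\<integral>h. f (mat_adjoint h) \<partial>m)"
  have fa: "bdd_measurable d (\<lambda>h. f (mat_adjoint h))"
  proof -
    have "(\<lambda>h. f (mat_adjoint h)) \<in> borel_measurable (borel_SU d)"
      using f measurable_compose[OF measurable_adjoint_SU[of "\<lambda>x. x" "borel_SU d" d], of f borel]
      by (simp add: bdd_measurable_def)
    then show ?thesis using A SU_adjoint by (auto simp: bdd_measurable_def)
  qed
  have avg: "(\<integral>h. k x h \<partial>m) = c * f x" if "x \<in> space m" for x
  proof -
    have x: "x \<in> SU d" using that by (simp add: space_m)
    have "(\<integral>h. f (mat_adjoint h * x) \<partial>m) = (\<integral>h. translate (mat_adjoint x) (\<lambda>h. f (mat_adjoint h)) h \<partial>m)"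
      using x by (intro Bochner_Integration.integral_cong)
        (auto simp: space_m translate_def SU_adjoint_mult[of _ d] SU_adjoint SU_adjoint_adjoint[of _ d])
    also have "\<dots> = c" unfolding c_def by (rule integral_translate[OF fa SU_adjoint[OF x]])
    finally show ?thesis by (simp add: k_def)
  qed
  have "(\<integral>h. \<integral>x. k x h \<partial>m \<partial>m) = (\<integral>x. \<integral>h. k x h \<partial>m \<partial>m)"
    by (rule Fubini_bounded[OF prob_m prob_m k_meas k_bound])
  also have "\<dots> = (\<integral>x. c * f x \<partial>m)" using avg by (intro Bochner_Integration.integral_cong) auto
  also have "\<dots> = 0" using mean by simp
  finally have K0: "(\<integral>h. \<integral>x. k x h \<partial>m \<partial>m) = 0" .
  have int_k: "integrable m (\<lambda>h. \<integral>x. k x h \<partial>m)"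
  proof (rule M.integrable_const_bound[of _ "A * A"])
    have "(\<lambda>(h, x). k x h) \<in> borel_measurable (m \<Otimes>\<^sub>M m)"
      using measurable_compose[OF measurable_pair_swap'[of m m] k_meas] by (simp add: case_prod_beta')
    then show "(\<lambda>h. \<integral>x. k x h \<partial>m) \<in> borel_measurable m" by (rule M.borel_measurable_lebesgue_integral)
    have "\<bar>\<integral>x. k x h \<partial>m\<bar> \<le> A * A" if h: "h \<in> space m" for h
    proof -
      have "\<bar>\<integral>x. k x h \<partial>m\<bar> \<le> (\<integral>x. \<bar>k x h\<bar> \<partial>m)" by (rule integral_abs_bound)
      also have "\<dots> \<le> (\<integral>x. A * A \<partial>m)"
      proof (rule integral_mono)
        have "mat_adjoint h \<in> SU d" using h by (simp add: space_m SU_adjoint)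
        from integrable_bounded_measurable(1)[OF bdd_measurable_mult[OF bdd_measurable_translate[OF f this] f]]
        show "integrable m (\<lambda>x. \<bar>k x h\<bar>)" unfolding k_def translate_def by (rule integrable_abs)
      qed (use k_bound h in auto)
      finally show ?thesis by (simp add: M.prob_space)
    qed
    then show "AE h in m. norm (\<integral>x. k x h \<partial>m) \<le> A * A" by auto
  qed
  have "2 * S = (\<integral>h. 2 * S - 2 * (\<integral>x. k x h \<partial>m) \<partial>m)"
    using int_k K0 by (simp add: M.prob_space)
  also have "\<dots> \<le> (\<integral>h. b\<^sup>2 \<partial>m)" using int_k inner by (intro integral_mono) auto
  finally have "2 * S \<le> b\<^sup>2" by (simp add: M.prob_space)
  moreover have "0 \<le> S" by (simp add: S_def)
  ultimately show ?thesis unfolding S_def by linarith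
qed

end


section \<open>Contraction over a block of steps\<close>

context SU_walk begin

lemma lipschitz_SU_iterate: "lipschitz_SU d f \<Longrightarrow> lipschitz_SU d ((T ^^ n) f)"
  by (induction n) (auto intro: lipschitz_SU_T)

lemma integral_iterate: "lipschitz_SU d f \<Longrightarrow> (\<integral>x. (T ^^ n) f x \<partial>m) = (\<integral>x. f x \<partial>m)"
  by (induction n) (simp_all add: integral_T lipschitz_SU_bounded_measurable lipschitz_SU_iterate)

definition sq_norm :: "(complex mat \<Rightarrow> real) \<Rightarrow> real" where
  "sq_norm f = (\<integral>x. (f x)\<^sup>2 \<partial>m)"

lemma sq_norm_nonneg: "0 \<le> sq_norm f"
  by (simp add: sq_norm_def)

lemma sq_norm_T_le:
  assumes "lipschitz_SU d f"
  shows "sq_norm (T f) \<le> sq_norm f"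
proof -
  have "0 \<le> (\<integral>g. (L2_dist (translate g f) (T f))\<^sup>2 \<partial>\<nu>)" by (rule Bochner_Integration.integral_nonneg) simp
  then show ?thesis using variance_identity[OF assms] by (simp add: sq_norm_def)
qed

lemma sq_norm_iterate_antimono:
  assumes "lipschitz_SU d f" "n \<le> k"
  shows "sq_norm ((T ^^ k) f) \<le> sq_norm ((T ^^ n) f)"
proof -
  have "antimono (\<lambda>n. sq_norm ((T ^^ n) f))"
    unfolding decseq_Suc_iff using sq_norm_T_le[OF lipschitz_SU_iterate[OF assms(1)]] by simp
  then show ?thesis using assms(2) by (rule antimonoD)
qed

text \<open>
  A letter moves \<open>F j\<close> to \<open>F (j + 1)\<close> and an inverse letter moves \<open>F (j + 1)\<close> to \<open>F j\<close>, up to \<open>\<kappa>\<close>, so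
  reading a word shifts the position by its exponent sum. The length constraints keep all intermediate
  positions inside the range \<open>0, \<dots>, k\<close> on which \<open>step\<close> is available.
\<close>

lemma word_displacement:
  fixes F :: "nat \<Rightarrow> complex mat \<Rightarrow> real" and \<kappa> :: real
  assumes i: "i < d" "2 \<le> d" and F: "\<And>j. lipschitz_SU d (F j)"
    and \<sigma>: "\<And>a. a \<in> A \<Longrightarrow> \<sigma> a \<in> SU 2"
    and step: "\<And>a j. a \<in> A \<Longrightarrow> j < k \<Longrightarrow> L2_dist (translate (embed_SU2 d i (\<sigma> a)) (F j)) (F (Suc j)) \<le> \<kappa>"
    and w: "snd ` set w \<subseteq> A" "length w \<le> j" "j + length w \<le> k"
  shows "L2_dist (translate (embed_SU2 d i (word_eval \<sigma> w)) (F j)) (F (nat (int j + exponent_sum w))) \<le> length w * \<kappa>"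
  using w
proof (induction w arbitrary: j)
  case Nil
  have "L2_dist (translate (1\<^sub>m d) (F j)) (F j) = L2_dist (F j) (F j)"
    by (intro L2_dist_cong) (auto simp: translate_def dest: SU_carrier)
  then show ?case by (simp add: embed_one[OF i] L2_dist_self)
next
  case (Cons x w)
  obtain b a where x: "x = (b, a)" by (cases x)
  have a: "a \<in> A" "\<sigma> a \<in> SU 2" using Cons.prems \<sigma> by (auto simp: x)
  have W: "word_eval \<sigma> w \<in> SU 2" using Cons.prems \<sigma> by (intro word_eval_SU) auto
  have L: "letter \<sigma> x \<in> SU 2" using a by (intro letter_SU) (simp add: x)
  define j' where "j' = (if b then Suc j else j - 1)"
  have j': "int j + exponent_sum (x # w) = int j' + exponent_sum w"
    using Cons.prems by (auto simp: j'_def x)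
  define e where "e = embed_SU2 d i"
  have e: "e (letter \<sigma> x) \<in> SU d" "e (word_eval \<sigma> w) \<in> SU d" "e (\<sigma> a) \<in> SU d"
    using L W a i by (auto simp: e_def intro!: embed_in_SU)
  note bm = lipschitz_SU_bounded_measurable[OF F]
  have first: "L2_dist (translate (e (letter \<sigma> x)) (F j)) (F j') \<le> \<kappa>"
  proof (cases b)
    case True
    then show ?thesis using step[OF a(1), of j] Cons.prems by (simp add: x j'_def e_def)
  next
    case False
    have "e (letter \<sigma> x) = mat_adjoint (e (\<sigma> a))"
      using False embed_adjoint[OF SU_carrier[OF a(2)] i] by (simp add: x e_def)
    then have "L2_dist (translate (e (letter \<sigma> x)) (F j)) (F j') = L2_dist (translate (e (\<sigma> a)) (F j')) (F j)"
      using displacement_adjoint[OF bm bm e(3)] by simp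
    also have "\<dots> \<le> \<kappa>" using step[OF a(1), of j'] Cons.prems False by (simp add: j'_def e_def)
    finally show ?thesis .
  qed
  let ?E = "F (nat (int j' + exponent_sum w))"
  have "L2_dist (translate (e (letter \<sigma> x * word_eval \<sigma> w)) (F j)) ?E
      = L2_dist (translate (e (word_eval \<sigma> w)) (translate (e (letter \<sigma> x)) (F j))) ?E"
    using e embed_mult[OF SU_carrier[OF L] SU_carrier[OF W] i]
    by (intro L2_dist_cong) (auto simp: translate_mult e_def)
  also have "\<dots> \<le> L2_dist (translate (e (word_eval \<sigma> w)) (translate (e (letter \<sigma> x)) (F j))) (translate (e (word_eval \<sigma> w)) (F j'))
      + L2_dist (translate (e (word_eval \<sigma> w)) (F j')) ?E"
    using e by (intro L2_dist_triangle bdd_measurable_translate bm)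
  also have "L2_dist (translate (e (word_eval \<sigma> w)) (translate (e (letter \<sigma> x)) (F j))) (translate (e (word_eval \<sigma> w)) (F j'))
      = L2_dist (translate (e (letter \<sigma> x)) (F j)) (F j')"
    using e by (intro L2_dist_translate bdd_measurable_translate bm)
  also have "L2_dist (translate (e (word_eval \<sigma> w)) (F j')) ?E \<le> length w * \<kappa>"
    unfolding e_def using Cons.prems by (intro Cons.IH) (auto simp: j'_def)
  finally show ?case using first unfolding j' word_eval.simps by (simp add: e_def algebra_simps)
qed

text \<open>
  The Solovay-Kitaev iteration is applied to the displacement function of each embedded \<open>SU(2)\<close>. The
  term \<open>exp (- (3/2)\<^sup>n) / 9\<close> is four times the accuracy \<open>exp (- (3/2)\<^sup>n) / 36\<close> reached after \<open>n\<close> rounds,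
  because the embedding expands distances by at most 4.
\<close>

lemma norm_le_of_net:
  assumes d: "2 \<le> d" and f: "lipschitz_SU d f" "(\<integral>x. f x \<partial>m) = 0"
    and net: "\<And>i g. i < d \<Longrightarrow> g \<in> SU 2 \<Longrightarrow>
      \<exists>w\<in>SU 2. L2_dist (translate (embed_SU2 d i w) f) f \<le> B \<and> op_dist g w \<le> 1 / 108"
    and B: "0 \<le> B"
  shows "sq_norm f \<le> ((real d)\<^sup>2 * (5 ^ n * B + exp (- ((3 / 2) ^ n)) / 9))\<^sup>2"
  unfolding sq_norm_def
proof (rule norm_le_displacement)
  interpret commutator_metric_group "SU_group 2" op_dist by (rule commutator_metric_group_SU_2)
  note bm = lipschitz_SU_bounded_measurable[OF f(1)]
  show "bdd_measurable d f" by (rule bm)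
  fix h assume h: "h \<in> SU d"
  show "L2_dist (translate h f) f \<le> (real d)\<^sup>2 * (5 ^ n * B + exp (- ((3 / 2) ^ n)) / 9)"
  proof (rule length_bound_SU[where p = "\<lambda>g. L2_dist (translate g f) f", OF _ _ _ _ d h])
    show "L2_dist (translate (x * y) f) f \<le> L2_dist (translate x f) f + L2_dist (translate y f) f" if "x \<in> SU d" "y \<in> SU d" for x y
      using displacement_mult[OF bm that] .
    have "L2_dist (translate (1\<^sub>m d) f) f = L2_dist f f"
      by (intro L2_dist_cong) (auto simp: translate_def dest: SU_carrier)
    then show "L2_dist (translate (1\<^sub>m d) f) f = 0" by (simp add: L2_dist_self)
    show "0 \<le> 5 ^ n * B + exp (- ((3 / 2) ^ n)) / 9" using B by simp
    fix i g assume i: "i < d" and g: "g \<in> SU 2"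
    define p where "p w = L2_dist (translate (embed_SU2 d i w) f) f" for w
    have "\<exists>w\<in>carrier (SU_group 2). p w \<le> 5 ^ n * B \<and> op_dist g w \<le> exp (- ((3/2) ^ n)) / 36"
    proof (rule solovay_kitaev)
      fix x y assume "x \<in> carrier (SU_group 2)" "y \<in> carrier (SU_group 2)"
      then have xy: "x \<in> SU 2" "y \<in> SU 2" by (auto simp: SU_group_def)
      then show "p (x \<otimes>\<^bsub>SU_group 2\<^esub> y) \<le> p x + p y"
        using displacement_mult[OF bm embed_in_SU[OF xy(1) i d] embed_in_SU[OF xy(2) i d]]
          embed_mult[OF SU_carrier[OF xy(1)] SU_carrier[OF xy(2)] i d]
        by (simp add: p_def SU_group_def)
    next
      fix x assume "x \<in> carrier (SU_group 2)"
      then have x: "x \<in> SU 2" by (auto simp: SU_group_def)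
      have "p (mat_adjoint x) = p x"
        using displacement_adjoint[OF bm bm embed_in_SU[OF x i d]] embed_adjoint[OF SU_carrier[OF x] i d]
        by (simp add: p_def)
      then show "p (inv\<^bsub>SU_group 2\<^esub> x) \<le> p x" using inv_SU_group[OF x] by simp
    next
      fix g assume "g \<in> carrier (SU_group 2)"
      then show "\<exists>w\<in>carrier (SU_group 2). p w \<le> B \<and> op_dist g w \<le> 1 / 108"
        using net[OF i, of g] by (simp add: p_def SU_group_def)
    next
      show "g \<in> carrier (SU_group 2)" using g by (simp add: SU_group_def)
    qed
    then obtain w where w: "w \<in> SU 2" "p w \<le> 5 ^ n * B" "op_dist g w \<le> exp (- ((3/2) ^ n)) / 36"
      by (auto simp: SU_group_def)
    let ?g = "embed_SU2 d i g" and ?w = "embed_SU2 d i w"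
    have S: "?g \<in> SU d" "?w \<in> SU d" using g w i d by (auto intro: embed_in_SU)
    have "L2_dist (translate ?g f) f \<le> L2_dist (translate ?g f) (translate ?w f) + L2_dist (translate ?w f) f"
      using S by (intro L2_dist_triangle bdd_measurable_translate bm)
    also have "L2_dist (translate ?g f) (translate ?w f) \<le> op_dist ?g ?w"
      by (rule translate_lipschitz_dist[OF f(1) S])
    also have "\<dots> \<le> 4 * op_dist g w" by (rule op_dist_embed[OF g w(1) i d])
    finally show "L2_dist (translate ?g f) f \<le> 5 ^ n * B + exp (- ((3/2) ^ n)) / 9"
      using w(2,3) by (simp add: p_def)
  qed
qed (use f in auto)

lemma bounded_measurable_displacement:
  assumes "bdd_measurable d f" "bdd_measurable d h"
  shows "bdd_measurable d (\<lambda>g. (L2_dist (translate g f) h)\<^sup>2)"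
proof -
  obtain A B where AB: "\<forall>x\<in>SU d. \<bar>f x\<bar> \<le> A" "\<forall>x\<in>SU d. \<bar>h x\<bar> \<le> B"
    using assms by (auto simp: bdd_measurable_def)
  have "0 \<le> A" "0 \<le> B" using AB SU_one[of d] by (meson abs_ge_zero order_trans)+
  have "\<bar>(L2_dist (translate g f) h)\<^sup>2\<bar> \<le> (A + B)\<^sup>2" if g: "g \<in> SU d" for g
  proof -
    have "L2_dist (translate g f) h \<le> A + B"
    proof (rule L2_dist_le_sup)
      fix x assume x: "x \<in> SU d"
      then have "\<bar>f (g * x)\<bar> \<le> A" "\<bar>h x\<bar> \<le> B" using AB SU_mult[OF g x] by auto
      then show "\<bar>translate g f x - h x\<bar> \<le> A + B" unfolding translate_def by linarith
    qed (use assms g \<open>0 \<le> A\<close> \<open>0 \<le> B\<close> in \<open>auto intro: bdd_measurable_translate\<close>)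
    then show ?thesis using L2_dist_nonneg by (simp add: power_mono)
  qed
  then show ?thesis using measurable_D_translate[OF assms] by (auto simp: bdd_measurable_def)
qed

lemma bdd_measurable_sum:
  "finite J \<Longrightarrow> (\<And>j. j \<in> J \<Longrightarrow> bdd_measurable d (f j)) \<Longrightarrow> bdd_measurable d (\<lambda>x. \<Sum>j\<in>J. f j x)"
proof (induction J rule: finite_induct)
  case empty
  show ?case by (auto simp: bdd_measurable_def)
next
  case (insert j J)
  have z: "bdd_measurable d (\<lambda>x. 0)" by (auto simp: bdd_measurable_def)
  have "bdd_measurable d (\<lambda>x. f j x - (0 - (\<Sum>j\<in>J. f j x)))"
    using insert by (intro bdd_measurable_diff z) auto
  then show ?case using insert by simp
qed

text \<open>
  The expected sum of squared increments over the block telescopes to the loss of norm. By Markov's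
  inequality it cannot be as large as \<open>\<kappa>\<^sup>2\<close> on all of \<open>U\<close>, whose embedded copy has \<open>\<nu>\<close>-measure at least
  \<open>c / d\<close>. Summing over \<open>j\<close> first makes one \<open>g\<close> work for the whole block.
\<close>

lemma small_increments:
  assumes \<eta>: "prob_space \<eta>" "sets \<eta> = sets (borel_SU 2)" and i: "i < d" "2 \<le> d"
    and \<nu>_ge: "\<And>Z. Z \<in> sets (borel_SU d) \<Longrightarrow> measure \<eta> (embed_SU2 d i -` Z \<inter> SU 2) / d \<le> measure \<nu> Z"
    and U: "c \<le> measure \<eta> U" "U \<subseteq> SU 2"
    and f: "lipschitz_SU d f" and \<kappa>: "0 < \<kappa>"
    and gap: "sq_norm f - sq_norm ((T ^^ k) f) < \<kappa>\<^sup>2 * c / d"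
  shows "\<exists>g\<in>U. \<forall>j<k. L2_dist (translate (embed_SU2 d i g) ((T ^^ j) f)) ((T ^^ Suc j) f) \<le> \<kappa>"
proof -
  interpret N: prob_space \<nu> by (rule prob_\<nu>)
  interpret E: prob_space \<eta> by fact
  define F where "F j = (T ^^ j) f" for j
  have F: "lipschitz_SU d (F j)" "F (Suc j) = T (F j)" for j
    using lipschitz_SU_iterate[OF f] by (auto simp: F_def)
  note bm = lipschitz_SU_bounded_measurable[OF F(1)]
  define G where "G g = (\<Sum>j<k. (L2_dist (translate g (F j)) (F (Suc j)))\<^sup>2)" for g
  have Gb: "bdd_measurable d G"
    unfolding G_def by (intro bdd_measurable_sum bounded_measurable_displacement bm) auto
  have "(\<integral>g. G g \<partial>\<nu>) = (\<Sum>j<k. \<integral>g. (L2_dist (translate g (F j)) (F (Suc j)))\<^sup>2 \<partial>\<nu>)"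
    unfolding G_def
    by (rule Bochner_Integration.integral_sum) (intro integrable_bounded_measurable bounded_measurable_displacement bm)
  also have "\<dots> = (\<Sum>j<k. sq_norm (F j) - sq_norm (F (Suc j)))"
    using variance_identity[OF F(1)] by (simp add: F(2) sq_norm_def)
  also have "\<dots> = sq_norm (F 0) - sq_norm (F k)" by (rule sum_lessThan_telescope')
  finally have intG: "(\<integral>g. G g \<partial>\<nu>) < \<kappa>\<^sup>2 * c / d" using gap by (simp add: F_def)
  define Z where "Z = {g \<in> space (borel_SU d). \<kappa>\<^sup>2 \<le> G g}"
  have Zs: "Z \<in> sets (borel_SU d)" unfolding Z_def
    using Gb by (intro borel_measurable_le) (auto simp: bdd_measurable_def)
  have "\<exists>g\<in>U. G (embed_SU2 d i g) < \<kappa>\<^sup>2"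
  proof (rule ccontr)
    assume "\<not> ?thesis"
    then have "U \<subseteq> embed_SU2 d i -` Z \<inter> SU 2"
      using U(2) embed_in_SU[OF _ i] by (force simp: Z_def space_borel_SU not_less)
    moreover have "embed_SU2 d i -` Z \<inter> SU 2 \<in> sets \<eta>"
      using measurable_sets[OF measurable_embed_SU[OF i] Zs] \<eta>(2) by (simp add: space_borel_SU)
    ultimately have "c \<le> measure \<eta> (embed_SU2 d i -` Z \<inter> SU 2)"
      by (intro order_trans[OF U(1)] E.finite_measure_mono)
    then have "c / d \<le> measure \<eta> (embed_SU2 d i -` Z \<inter> SU 2) / d" by (intro divide_right_mono) auto
    also have "\<dots> \<le> measure \<nu> Z" using \<nu>_ge[OF Zs] .
    finally have "\<kappa>\<^sup>2 * (c / d) \<le> \<kappa>\<^sup>2 * measure \<nu> Z" by (intro mult_left_mono) auto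
    also have "\<dots> = (\<integral>g. \<kappa>\<^sup>2 * indicator Z g \<partial>\<nu>)"
      using Zs sets_\<nu> by simp
    also have "\<dots> \<le> (\<integral>g. G g \<partial>\<nu>)"
    proof (rule integral_mono)
      show "integrable \<nu> (\<lambda>g. \<kappa>\<^sup>2 * indicator Z g)"
        using Zs sets_\<nu> by (intro integrable_mult_right integrable_real_indicator) (auto simp: N.emeasure_eq_measure)
      show "integrable \<nu> G" by (intro integrable_bounded_measurable Gb)
      show "\<kappa>\<^sup>2 * indicator Z g \<le> G g" for g
        by (cases "g \<in> Z") (auto simp: Z_def G_def intro!: sum_nonneg)
    qed
    finally show False using intG by simp
  qed
  then obtain g where g: "g \<in> U" "G (embed_SU2 d i g) < \<kappa>\<^sup>2" by blast
  have "L2_dist (translate (embed_SU2 d i g) (F j)) (F (Suc j)) \<le> \<kappa>" if "j < k" for j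
  proof -
    have "(L2_dist (translate (embed_SU2 d i g) (F j)) (F (Suc j)))\<^sup>2 \<le> G (embed_SU2 d i g)"
      unfolding G_def using that by (intro member_le_sum) auto
    then have "(L2_dist (translate (embed_SU2 d i g) (F j)) (F (Suc j)))\<^sup>2 \<le> \<kappa>\<^sup>2" using g by linarith
    then show ?thesis by (rule power2_le_imp_le[OF _ less_imp_le[OF \<kappa>]])
  qed
  then show ?thesis using g(1) by (intro bexI[of _ g]) (simp_all add: F_def)
qed

text \<open>
  The block has length \<open>2 k\<close> and the words start from its middle, so that a word of length at most \<open>k\<close>
  cannot leave it. The perturbed generators \<open>\<sigma>\<close> may depend on the coordinate pair \<open>i\<close>.
\<close>

lemma block_contraction:
  assumes \<eta>: "prob_space \<eta>" "sets \<eta> = sets (borel_SU 2)" and d: "2 \<le> d"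
    and \<nu>_ge: "\<And>i Z. i < d \<Longrightarrow> Z \<in> sets (borel_SU d) \<Longrightarrow> measure \<eta> (embed_SU2 d i -` Z \<inter> SU 2) / d \<le> measure \<nu> Z"
    and net: "robust_word_net A k \<delta>"
    and c: "\<And>a. a \<in> A \<Longrightarrow> c \<le> measure \<eta> {g \<in> SU 2. op_dist g a < \<delta>}"
    and f: "lipschitz_SU d f" "(\<integral>x. f x \<partial>m) = 0" and \<kappa>: "0 < \<kappa>"
    and gap: "sq_norm f - sq_norm ((T ^^ (2 * k)) f) < \<kappa>\<^sup>2 * c / d"
  shows "sq_norm ((T ^^ k) f) \<le> ((real d)\<^sup>2 * (5 ^ n * (k * \<kappa>) + exp (- ((3 / 2) ^ n)) / 9))\<^sup>2"
proof (rule norm_le_of_net[OF d])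
  show "lipschitz_SU d ((T ^^ k) f)" by (rule lipschitz_SU_iterate[OF f(1)])
  show "(\<integral>x. (T ^^ k) f x \<partial>m) = 0" using integral_iterate[OF f(1)] f(2) by simp
  show "0 \<le> real k * \<kappa>" using \<kappa> by simp
  fix i g assume i: "i < d" and g: "g \<in> SU 2"
  have "\<forall>a\<in>A. \<exists>s\<in>{g \<in> SU 2. op_dist g a < \<delta>}.
      \<forall>j<2 * k. L2_dist (translate (embed_SU2 d i s) ((T ^^ j) f)) ((T ^^ Suc j) f) \<le> \<kappa>"
    using small_increments[OF \<eta> i d \<nu>_ge[OF i] c _ f(1) \<kappa> gap] by blast
  then have "\<forall>a\<in>A. \<exists>s. s \<in> SU 2 \<and> op_dist s a < \<delta> \<and>
      (\<forall>j<2 * k. L2_dist (translate (embed_SU2 d i s) ((T ^^ j) f)) ((T ^^ Suc j) f) \<le> \<kappa>)" by blast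
  from bchoice[OF this] obtain \<sigma> where \<sigma>: "\<forall>a\<in>A. \<sigma> a \<in> SU 2 \<and> op_dist (\<sigma> a) a < \<delta> \<and>
      (\<forall>j<2 * k. L2_dist (translate (embed_SU2 d i (\<sigma> a)) ((T ^^ j) f)) ((T ^^ Suc j) f) \<le> \<kappa>)" ..
  obtain w where w: "snd ` set w \<subseteq> A" "length w \<le> k" "exponent_sum w = 0" "op_dist g (word_eval \<sigma> w) \<le> 1 / 108"
    using net[unfolded robust_word_net_def, rule_format, of \<sigma> g] \<sigma> g by blast
  have "L2_dist (translate (embed_SU2 d i (word_eval \<sigma> w)) ((T ^^ k) f)) ((T ^^ nat (int k + exponent_sum w)) f) \<le> length w * \<kappa>"
    by (rule word_displacement[where F = "\<lambda>j. (T ^^ j) f" and A = A and k = "2 * k", OF i d])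
      (use \<sigma> w lipschitz_SU_iterate[OF f(1)] in auto)
  also have "\<dots> \<le> k * \<kappa>" using w \<kappa> by (intro mult_right_mono) auto
  finally have "L2_dist (translate (embed_SU2 d i (word_eval \<sigma> w)) ((T ^^ k) f)) ((T ^^ k) f) \<le> k * \<kappa>"
    using w(3) by simp
  moreover have "word_eval \<sigma> w \<in> SU 2" using w \<sigma> by (intro word_eval_SU) auto
  ultimately show "\<exists>w\<in>SU 2. L2_dist (translate (embed_SU2 d i w) ((T ^^ k) f)) ((T ^^ k) f) \<le> real k * \<kappa> \<and> op_dist g w \<le> 1 / 108"
    using w(4) by blast
qed

text \<open>\<open>SU(d)\<close> is covered by balls around the points of a finite net, all of the same Haar measure.\<close>

lemma ball_measure_ge:
  assumes "0 < Q"
  shows "1 \<le> real ((2 * Q + 1) ^ (2 * d\<^sup>2)) * measure m {g \<in> SU d. op_dist g (1\<^sub>m d) \<le> 2 * (real d)\<^sup>2 / real Q}"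
proof -
  interpret M: prob_space m by (rule prob_m)
  interpret MS: Metric_space "SU d" op_dist by (rule Metric_space_SU)
  define r where "r = 2 * (real d)\<^sup>2 / real Q"
  obtain X where X: "X \<subseteq> SU d" "finite X" "card X \<le> (2 * Q + 1) ^ (2 * d\<^sup>2)"
    "\<And>g. g \<in> SU d \<Longrightarrow> \<exists>x\<in>X. op_dist g x \<le> r"
    using SU_finite_net[OF assms, of d] unfolding r_def by blast
  define C where "C x = {g \<in> SU d. op_dist g x \<le> r}" for x
  have C: "C x \<in> sets (borel_SU d)" if "x \<in> SU d" for x
  proof -
    have "(\<lambda>g. op_dist g x) \<in> borel_measurable (borel_SU d)"
    proof (rule lipschitz_measurable_SU)
      fix g h assume "g \<in> SU d" "h \<in> SU d"
      then show "dist (op_dist g x) (op_dist h x) \<le> op_dist g h"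
        using MS.triangle[of g h x] MS.triangle[of h g x] MS.commute[of g h] that by (auto simp: dist_real_def)
    qed
    then have "{g \<in> space (borel_SU d). op_dist g x \<le> r} \<in> sets (borel_SU d)" by (intro borel_measurable_le) auto
    then show ?thesis by (simp add: C_def space_borel_SU)
  qed
  have eq: "measure m (C x) = measure m (C (1\<^sub>m d))" if x: "x \<in> SU d" for x
  proof -
    have xa: "mat_adjoint x \<in> SU d" using x by (rule SU_adjoint)
    have meas: "(\<lambda>h. mat_adjoint x * h) \<in> measurable m (borel_SU d)"
      unfolding measurable_m using xa by (intro measurable_mult_SU) (auto simp: space_borel_SU)
    have "measure m (C (1\<^sub>m d)) = measure (distr m (borel_SU d) (\<lambda>h. mat_adjoint x * h)) (C (1\<^sub>m d))"
      using invariant_m[OF xa] by simp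
    also have "\<dots> = measure m ((\<lambda>h. mat_adjoint x * h) -` C (1\<^sub>m d) \<inter> space m)"
      by (rule measure_distr[OF meas C[OF SU_one]])
    also have "(\<lambda>h. mat_adjoint x * h) -` C (1\<^sub>m d) \<inter> space m = C x"
    proof -
      have "op_dist (mat_adjoint x * h) (1\<^sub>m d) = op_dist h x" if "h \<in> SU d" for h
        using op_dist_mult_left[OF xa that x] x by (simp add: SU_adjoint_left)
      then show ?thesis using xa by (auto simp: C_def space_m SU_mult)
    qed
    finally show ?thesis by simp
  qed
  have "SU d \<subseteq> (\<Union>x\<in>X. C x)" using X(4) by (auto simp: C_def)
  then have "1 \<le> measure m (\<Union>x\<in>X. C x)"
    using M.prob_space M.finite_measure_mono[of "space m" "\<Union>x\<in>X. C x"] sets.finite_UN[OF X(2), of C m] X(1) C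
    by (simp add: space_m sets_m subset_iff)
  also have "\<dots> \<le> (\<Sum>x\<in>X. measure m (C x))"
    using X C sets_m by (intro M.finite_measure_subadditive_finite) auto
  also have "\<dots> = real (card X) * measure m (C (1\<^sub>m d))" using eq X(1) by (simp add: subset_iff)
  also have "\<dots> \<le> real ((2 * Q + 1) ^ (2 * d\<^sup>2)) * measure m (C (1\<^sub>m d))"
    using X(3) by (intro mult_right_mono of_nat_mono) auto
  finally show ?thesis by (simp add: C_def r_def)
qed

lemma sup_le_of_sq_norm:
  assumes "0 < Q" and f: "lipschitz_SU d f"
    and small: "real ((2 * Q + 1) ^ (2 * d\<^sup>2)) * sq_norm f \<le> (2 * (real d)\<^sup>2 / real Q)\<^sup>2"
  shows "\<bar>f (1\<^sub>m d)\<bar> \<le> 2 * (2 * (real d)\<^sup>2 / real Q)"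
proof (rule ccontr)
  interpret M: prob_space m by (rule prob_m)
  define r where "r = 2 * (real d)\<^sup>2 / real Q"
  define K where "K = real ((2 * Q + 1) ^ (2 * d\<^sup>2))"
  define C where "C = {g \<in> SU d. op_dist g (1\<^sub>m d) \<le> r}"
  assume "\<not> ?thesis"
  then have big: "r < \<bar>f (1\<^sub>m d)\<bar> - r" by (simp add: r_def)
  have r: "0 \<le> r" by (simp add: r_def)
  define t where "t = \<bar>f (1\<^sub>m d)\<bar> - r"
  have K1: "1 \<le> K * measure m C" using ball_measure_ge[OF assms(1)] by (simp add: K_def C_def r_def)
  then have mC: "0 < measure m C" using measure_nonneg[of m C] by (cases "measure m C = 0") (simp_all add: less_le)
  have Cs: "C \<in> sets m"
    by (rule ccontr) (use mC measure_notin_sets in fastforce)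
  have "t\<^sup>2 * measure m C = (\<integral>g. t\<^sup>2 * indicator C g \<partial>m)" using Cs by simp
  also have "\<dots> \<le> sq_norm f" unfolding sq_norm_def
  proof (rule integral_mono)
    show "integrable m (\<lambda>g. t\<^sup>2 * indicator C g)"
      using Cs by (intro integrable_mult_right integrable_real_indicator) (auto simp: M.emeasure_eq_measure)
    show "integrable m (\<lambda>x. (f x)\<^sup>2)"
      by (intro integrable_bounded_measurable bdd_measurable_square lipschitz_SU_bounded_measurable f)
    fix g
    show "t\<^sup>2 * indicator C g \<le> (f g)\<^sup>2"
    proof (cases "g \<in> C")
      case True
      then have "\<bar>f g - f (1\<^sub>m d)\<bar> \<le> r" using f SU_one[of d] by (fastforce simp: C_def lipschitz_SU_def)
      then have "t \<le> \<bar>f g\<bar>" by (simp add: t_def)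
      then have "t\<^sup>2 \<le> \<bar>f g\<bar>\<^sup>2" using big r by (intro power_mono) (auto simp: t_def)
      then show ?thesis using True by simp
    qed simp
  qed
  finally have "t\<^sup>2 * measure m C \<le> sq_norm f" .
  then have "K * (t\<^sup>2 * measure m C) \<le> K * sq_norm f" by (intro mult_left_mono) (auto simp: K_def)
  moreover have "t\<^sup>2 * 1 \<le> t\<^sup>2 * (K * measure m C)" using K1 by (intro mult_left_mono) auto
  moreover have "t\<^sup>2 * (K * measure m C) = K * (t\<^sup>2 * measure m C)" by (rule mult.left_commute)
  moreover have "K * sq_norm f \<le> r\<^sup>2" using small unfolding K_def r_def .
  ultimately have "t\<^sup>2 \<le> r\<^sup>2" by linarith
  then have "t \<le> r" using r by (rule power2_le_imp_le)
  then show False using big by (simp add: t_def)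
qed

text \<open>
  Integrating out the left factor split off by the recursion replaces \<open>f\<close> by \<open>T f\<close>, so the induction runs
  over all \<open>f\<close>.
\<close>

lemma convolution_power:
  shows "prob_space (convolution_power_SU d \<nu> l)" "sets (convolution_power_SU d \<nu> l) = sets (borel_SU d)"
    "lipschitz_SU d f \<Longrightarrow> (\<integral>x. f x \<partial>convolution_power_SU d \<nu> l) = (T ^^ l) f (1\<^sub>m d)"
proof (induction l arbitrary: f)
  case 0
  {
    case 1
    show ?case by (auto intro!: prob_space_return simp: space_borel_SU SU_one)
  next
    case 2
    show ?case by simp
  next
    case 3
    then show ?case using lipschitz_SU_bounded_measurable[OF 3]
      by (simp add: integral_return space_borel_SU SU_one bdd_measurable_def)
  }
next
  case (Suc l)
  let ?\<mu> = "convolution_power_SU d \<nu> l"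
  interpret N: prob_space \<nu> by (rule prob_\<nu>)
  interpret C: prob_space ?\<mu> by (rule Suc(1))
  interpret pair_prob_space \<nu> ?\<mu> ..
  have meas: "(\<lambda>(g, h). g * h) \<in> measurable (\<nu> \<Otimes>\<^sub>M ?\<mu>) (borel_SU d)"
  proof -
    have "fst \<in> measurable (\<nu> \<Otimes>\<^sub>M ?\<mu>) (borel_SU d)" "snd \<in> measurable (\<nu> \<Otimes>\<^sub>M ?\<mu>) (borel_SU d)"
      using measurable_fst[of \<nu> ?\<mu>] measurable_snd[of \<nu> ?\<mu>] measurable_cong_sets[OF refl sets_\<nu>]
        measurable_cong_sets[OF refl Suc(2)] by blast+
    from measurable_mult_SU[OF this] show ?thesis by (simp add: case_prod_beta')
  qed
  {
    case 1
    show ?case using meas by (simp add: convolution_SU_def P.prob_space_distr)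
  next
    case 2
    show ?case by (simp add: convolution_SU_def)
  next
    case 3
    note bm = lipschitz_SU_bounded_measurable[OF 3]
    have fm: "f \<in> borel_measurable (borel_SU d)" using bm by (simp add: bdd_measurable_def)
    obtain B where B: "\<forall>x\<in>SU d. \<bar>f x\<bar> \<le> B" using bm by (auto simp: bdd_measurable_def)
    have sp: "space ?\<mu> = SU d" using sets_eq_imp_space_eq[OF Suc(2)] by (simp add: space_borel_SU)
    have int: "integrable (\<nu> \<Otimes>\<^sub>M ?\<mu>) (\<lambda>(g, h). f (g * h))"
      using B measurable_compose[OF meas fm]
      by (intro P.integrable_const_bound[of _ B]) (auto simp: space_pair_measure sp space_\<nu> SU_mult case_prod_beta')
    have "(\<integral>x. f x \<partial>convolution_power_SU d \<nu> (Suc l)) = (\<integral>z. f (case z of (g, h) \<Rightarrow> g * h) \<partial>(\<nu> \<Otimes>\<^sub>M ?\<mu>))"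
      unfolding convolution_power_SU.simps convolution_SU_def by (rule integral_distr[OF meas fm])
    also have "\<dots> = (\<integral>z. (\<lambda>(g, h). f (g * h)) z \<partial>(\<nu> \<Otimes>\<^sub>M ?\<mu>))" by (simp add: case_prod_beta')
    also have "\<dots> = (\<integral>h. T f h \<partial>?\<mu>)" unfolding T_def by (rule integral_snd[OF int, symmetric])
    also have "\<dots> = (T ^^ l) (T f) (1\<^sub>m d)" by (rule Suc(3)[OF lipschitz_SU_T[OF 3]])
    finally show ?case by (simp add: funpow_swap1)
  }
qed

end

lemma emeasure_pair_measure_SU:
  assumes "sets \<eta> = sets (borel_SU 2)" "i < d" "2 \<le> d" "Z \<in> sets (borel_SU d)"
  shows "emeasure (pair_measure_SU \<eta> d i) Z = emeasure \<eta> (embed_SU2 d i -` Z \<inter> SU 2)"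
proof -
  have "embed_SU2 d i \<in> measurable \<eta> (borel_SU d)"
    using measurable_embed_SU[OF assms(2,3)] measurable_cong_sets[OF assms(1) refl] by blast
  then show ?thesis
    using assms sets_eq_imp_space_eq[OF assms(1)] by (simp add: pair_measure_SU_def emeasure_distr space_borel_SU)
qed

lemma prob_space_walk_measure:
  assumes "prob_space \<eta>" "sets \<eta> = sets (borel_SU 2)" "2 \<le> d"
  shows "prob_space (walk_measure \<eta> d)"
proof (rule prob_spaceI)
  interpret E: prob_space \<eta> by fact
  have top: "SU d \<in> sets (borel_SU d)" using sets.top[of "borel_SU d"] by (simp add: space_borel_SU)
  have "emeasure (pair_measure_SU \<eta> d i) (SU d) = 1" if "i < d" for i
  proof -
    have "embed_SU2 d i -` SU d \<inter> SU 2 = space \<eta>"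
      using sets_eq_imp_space_eq[OF assms(2)] embed_in_SU[OF _ that assms(3)] by (auto simp: space_borel_SU)
    then show ?thesis using emeasure_pair_measure_SU[OF assms(2) that assms(3) top] E.emeasure_space_1 by simp
  qed
  then have "emeasure (walk_measure \<eta> d) (SU d) = ennreal (1 / real d) * of_nat d"
    by (simp add: emeasure_walk_measure[OF top])
  also have "\<dots> = ennreal (1 / real d * real d)" by (subst ennreal_mult) (auto simp: ennreal_of_nat_eq_real_of_nat)
  also have "\<dots> = 1" using assms(3) by simp
  finally show "emeasure (walk_measure \<eta> d) (space (walk_measure \<eta> d)) = 1" by (simp add: space_walk_measure)
qed

lemma walk_measure_ge:
  assumes "prob_space \<eta>" "sets \<eta> = sets (borel_SU 2)" "2 \<le> d" "i < d" "Z \<in> sets (borel_SU d)"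
  shows "measure \<eta> (embed_SU2 d i -` Z \<inter> SU 2) / d \<le> measure (walk_measure \<eta> d) Z"
proof -
  interpret E: prob_space \<eta> by fact
  interpret W: prob_space "walk_measure \<eta> d" using assms by (intro prob_space_walk_measure)
  have "ennreal (measure \<eta> (embed_SU2 d i -` Z \<inter> SU 2) / d) = ennreal (1 / real d) * emeasure (pair_measure_SU \<eta> d i) Z"
    using assms by (simp add: emeasure_pair_measure_SU E.emeasure_eq_measure ennreal_mult[symmetric])
  also have "\<dots> \<le> ennreal (1 / real d) * (\<Sum>i<d. emeasure (pair_measure_SU \<eta> d i) Z)"
    using assms(4) by (intro mult_left_mono member_le_sum) auto
  also have "\<dots> = ennreal (measure (walk_measure \<eta> d) Z)"
    using emeasure_walk_measure[OF assms(5), of \<eta>] W.emeasure_eq_measure[of Z] by simp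
  finally show ?thesis by (simp add: ennreal_le_iff)
qed


section \<open>Choice of parameters\<close>

lemma power_three_halves_between:
  assumes "1 \<le> (M::real)"
  obtains n where "M \<le> (3/2) ^ n" "(3/2) ^ n \<le> 3/2 * M"
proof -
  obtain n0 where "M < (3/2::real) ^ n0" using real_arch_pow[of "3/2" M] by auto
  then have ex: "M \<le> (3/2) ^ n0" by simp
  define n where "n = (LEAST n. M \<le> (3/2) ^ n)"
  have n: "M \<le> (3/2) ^ n" unfolding n_def by (rule LeastI, rule ex)
  have "(3/2) ^ n \<le> 3/2 * M"
  proof (cases n)
    case 0
    then show ?thesis using assms by simp
  next
    case (Suc j)
    then have "\<not> M \<le> (3/2) ^ j" using not_less_Least[of j "\<lambda>n. M \<le> (3/2) ^ n"] by (simp add: n_def)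
    then show ?thesis using Suc by simp
  qed
  with n show ?thesis using that by blast
qed

lemma exp_half_le:
  fixes t :: real
  assumes "0 \<le> t" "t \<le> 1"
  shows "exp (t / 2) \<le> 1 + t"
proof -
  have "exp (t / 2) \<le> 1 + t / 2 + (t / 2)\<^sup>2" using assms by (intro exp_bound) auto
  also have "\<dots> \<le> 1 + t"
  proof -
    have "t * t \<le> t * 1" using assms by (intro mult_left_mono) auto
    then show ?thesis using assms by (simp add: power2_eq_square)
  qed
  finally show ?thesis .
qed

lemma ln_inverse_ge_half:
  fixes \<epsilon> :: real
  assumes "0 < \<epsilon>" "\<epsilon> < 1 / 2"
  shows "1 / 2 \<le> ln (1 / \<epsilon>)"
proof -
  have "exp (1/2) \<le> (2::real)"
    using exp_half_le[of 1] by simp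
  also have "\<dots> < 1 / \<epsilon>" using assms by (simp add: field_simps)
  finally have "ln (exp (1/2)) < ln (1 / \<epsilon>)" using assms by (subst ln_less_cancel_iff) auto
  then show ?thesis by simp
qed

text \<open>
  With \<open>x = d ln (1 / \<epsilon>)\<close>, both \<open>d\<close> and \<open>ln (1 / \<epsilon>)\<close> are at most \<open>2 x\<close>. The mesh parameter \<open>Q\<close> is of
  order \<open>d\<^sup>2 / \<epsilon>\<close>. The target \<open>\<rho>\<close> for the L2 norm is the reciprocal of \<open>Q\<close> times the square root of the
  covering number, so \<open>ln (1 / \<rho>) \<le> 56 x\<^sup>3\<close>. The number \<open>n\<close> of Solovay-Kitaev rounds is the least one with
  \<open>(3/2)\<^sup>n \<ge> ln (1 / \<rho>) + 2 d\<close>, which makes \<open>exp (- (3/2)\<^sup>n)\<close> at most \<open>\<rho> / d\<^sup>2\<close>. Then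
  \<open>(3/2)\<^sup>n \<le> 90 x\<^sup>3\<close>, and \<open>25 \<le> (3/2)\<^sup>8\<close> gives \<open>25\<^sup>n \<le> (90 x\<^sup>3)\<^sup>8\<close>. The gain
  per block is then at least \<open>1 / (A x\<^bsup>29\<^esup>)\<close> with a constant \<open>A\<close>, and \<open>J\<close> of order \<open>A x\<^bsup>32\<^esup>\<close> blocks bring
  the squared norm from 4 below \<open>\<rho>\<^sup>2\<close>.
\<close>

lemma walk_parameters:
  fixes d k l :: nat and c \<epsilon> :: real
  assumes d: "3 \<le> d" and \<epsilon>: "0 < \<epsilon>" "\<epsilon> < 1 / 2" and k: "1 \<le> k" and c: "0 < c" "c \<le> 1"
    and l: "real l \<ge> 460 * k * (128 * 90 ^ 8 * (real k)\<^sup>2 / c) * (real d * ln (1 / \<epsilon>)) ^ 32"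
  shows "\<exists>Q n \<rho> J. 0 < Q \<and> 2 * (2 * (real d)\<^sup>2 / real Q) \<le> \<epsilon> \<and> 0 < \<rho> \<and>
    real ((2 * Q + 1) ^ (2 * d\<^sup>2)) * \<rho>\<^sup>2 \<le> (2 * (real d)\<^sup>2 / real Q)\<^sup>2 \<and>
    (real d)\<^sup>2 * (exp (- ((3 / 2) ^ n)) / 9) \<le> \<rho> / 4 \<and> 2 * k * J \<le> l \<and>
    4 < (1 + c / (4 * real d ^ 5 * 25 ^ n * (real k)\<^sup>2)) ^ J * \<rho>\<^sup>2"
proof -
  define \<Lambda> x where "\<Lambda> = ln (1 / \<epsilon>)" and "x = real d * \<Lambda>"
  have \<Lambda>: "1 / 2 \<le> \<Lambda>" using ln_inverse_ge_half[OF \<epsilon>] by (simp add: \<Lambda>_def)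
  have xd: "real d \<le> 2 * x"
    using mult_left_mono[OF \<Lambda>, of "real d"] by (simp add: x_def)
  have x\<Lambda>: "\<Lambda> \<le> x" using d \<Lambda> mult_right_mono[of 1 "real d" \<Lambda>] by (simp add: x_def)
  have x: "3 / 2 \<le> x" using xd d by simp
  have x1: "1 \<le> x" using x by simp
  define Q where "Q = nat \<lceil>4 * (real d)\<^sup>2 / \<epsilon>\<rceil>"
  have d2: "9 \<le> (real d)\<^sup>2" using d power_mono[of 3 "real d" 2] by simp
  have y: "1 \<le> (real d)\<^sup>2 / \<epsilon>" using d2 \<epsilon> by (simp add: field_simps)
  have Q: "4 * (real d)\<^sup>2 / \<epsilon> \<le> real Q" "real Q \<le> 4 * (real d)\<^sup>2 / \<epsilon> + 1"
    using \<epsilon> unfolding Q_def by (auto simp: of_nat_nat intro: real_nat_ceiling_ge)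
  have Q0: "0 < Q" using Q(1) y by (cases Q) auto
  have Qe: "2 * (2 * (real d)\<^sup>2 / real Q) \<le> \<epsilon>"
    using Q(1) \<epsilon> Q0 by (simp add: field_simps)
  define q where "q = 2 * real Q + 1"
  have q1: "1 \<le> q" by (simp add: q_def)
  have "q \<le> 11 * ((real d)\<^sup>2 / \<epsilon>)" using Q(2) y by (simp add: q_def)
  also have "\<dots> \<le> exp 3 * (exp (real d))\<^sup>2 * exp \<Lambda>"
  proof -
    have e3: "11 \<le> exp (3::real)"
    proof -
      have "(5/2::real) \<le> exp 1" using exp_lower_Taylor_quadratic[of "1::real"] by simp
      then have "(5/2) ^ 3 \<le> (exp 1 :: real) ^ 3" by (intro power_mono) auto
      also have "\<dots> = exp 3" by (simp flip: exp_of_nat_mult)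
      finally show ?thesis by (simp add: power3_eq_cube)
    qed
    have "real d \<le> exp (real d)" using exp_ge_add_one_self[of "real d"] by linarith
    then have "(real d)\<^sup>2 \<le> (exp (real d))\<^sup>2" by (intro power_mono) auto
    moreover have "exp \<Lambda> = 1 / \<epsilon>" using \<epsilon> by (simp add: \<Lambda>_def)
    ultimately have "11 * (real d)\<^sup>2 * exp \<Lambda> \<le> exp 3 * (exp (real d))\<^sup>2 * exp \<Lambda>"
      using e3 \<epsilon> by (intro mult_right_mono mult_mono) auto
    then show ?thesis using \<open>exp \<Lambda> = 1 / \<epsilon>\<close> by simp
  qed
  also have "\<dots> = exp (3 + 2 * real d + \<Lambda>)" by (simp add: exp_add exp_double)
  finally have "ln q \<le> ln (exp (3 + 2 * real d + \<Lambda>))" using q1 by (subst ln_le_cancel_iff) auto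
  then have "ln q \<le> 3 + 2 * real d + \<Lambda>" by simp
  then have lq: "ln q \<le> 7 * x" using xd x\<Lambda> x by linarith
  define \<rho> where "\<rho> = 1 / (q ^ d\<^sup>2 * real Q)"
  have \<rho>: "0 < \<rho>" using Q0 q1 by (simp add: \<rho>_def)
  define R where "R = ln (1 / \<rho>)"
  have "R = real (d\<^sup>2) * ln q + ln (real Q)"
    using q1 Q0 by (simp add: R_def \<rho>_def ln_mult ln_realpow)
  also have "\<dots> \<le> (real d)\<^sup>2 * ln q + (real d)\<^sup>2 * ln q"
  proof -
    have "ln (real Q) \<le> ln q" using Q0 by (simp add: q_def)
    also have "\<dots> \<le> (real d)\<^sup>2 * ln q" using q1 d2 mult_right_mono[of 1 "(real d)\<^sup>2" "ln q"] by simp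
    finally show ?thesis unfolding of_nat_power by linarith
  qed
  also have "\<dots> \<le> 2 * ((2 * x)\<^sup>2 * (7 * x))"
  proof -
    have "(real d)\<^sup>2 * ln q \<le> (2 * x)\<^sup>2 * (7 * x)"
      using xd lq q1 x1 by (intro mult_mono power_mono) auto
    then show ?thesis by linarith
  qed
  finally have R: "R \<le> 56 * x ^ 3" by (simp add: power2_eq_square power3_eq_cube)
  have "\<rho> \<le> 1"
  proof -
    have "1 * 1 \<le> q ^ d\<^sup>2 * real Q" using q1 Q0 by (intro mult_mono one_le_power) auto
    then show ?thesis using \<rho> by (simp add: \<rho>_def divide_le_eq)
  qed
  then have R0: "0 \<le> R" using \<rho> by (simp add: R_def)
  have eR: "exp (- R) = \<rho>" using \<rho> by (simp add: R_def ln_div)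
  define M where "M = R + 2 * real d"
  have M1: "1 \<le> M" using R0 d by (simp add: M_def)
  have x3: "x \<le> x ^ 3" using x1 self_le_power[of x 3] by simp
  have M: "M \<le> 60 * x ^ 3" using R xd x3 by (simp add: M_def)
  obtain n where n: "M \<le> (3/2) ^ n" "(3/2) ^ n \<le> 3/2 * M" using power_three_halves_between[OF M1] .
  have net: "(real d)\<^sup>2 * (exp (- ((3 / 2) ^ n)) / 9) \<le> \<rho> / 4"
  proof -
    have "exp (- ((3 / 2) ^ n)) \<le> exp (- R - 2 * real d)" using n(1) by (simp add: M_def)
    also have "\<dots> = \<rho> / (exp (real d))\<^sup>2" using eR by (simp add: exp_diff exp_double)
    also have "\<dots> \<le> \<rho> / (real d)\<^sup>2"
    proof -
      have "real d \<le> exp (real d)" using exp_ge_add_one_self[of "real d"] by linarith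
      then have "(real d)\<^sup>2 \<le> (exp (real d))\<^sup>2" by (intro power_mono) auto
      then show ?thesis using \<rho> d by (intro divide_left_mono) auto
    qed
    finally have "(real d)\<^sup>2 * exp (- ((3 / 2) ^ n)) \<le> \<rho>" using d by (simp add: field_simps)
    then show ?thesis using \<rho> by simp
  qed
  define A where "A = 128 * 90 ^ 8 * (real k)\<^sup>2 / c"
  have k2: "1 \<le> (real k)\<^sup>2" using k by simp
  have A1: "1 \<le> A"
  proof -
    have "c * 1 \<le> 1 * (128 * 90 ^ 8 * (real k)\<^sup>2)" using c k2 by (intro mult_mono) auto
    then show ?thesis using c by (simp add: A_def)
  qed
  define \<delta> where "\<delta> = c / (4 * real d ^ 5 * 25 ^ n * (real k)\<^sup>2)"
  have p25: "25 ^ n \<le> 90 ^ 8 * x ^ 24"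
  proof -
    have "(25::real) ^ n \<le> ((3/2) ^ 8) ^ n" by (intro power_mono) (auto simp: power_divide)
    also have "\<dots> = ((3/2) ^ n) ^ 8" by (simp add: mult.commute flip: power_mult)
    also have "\<dots> \<le> (90 * x ^ 3) ^ 8" using n(2) M by (intro power_mono) auto
    finally show ?thesis by (simp add: power_mult_distrib flip: power_mult)
  qed
  have d5: "real d ^ 5 \<le> 32 * x ^ 5"
    using power_mono[OF xd, of 5] by (simp add: power_mult_distrib)
  have "4 * real d ^ 5 * 25 ^ n * (real k)\<^sup>2 \<le> 4 * (32 * x ^ 5) * (90 ^ 8 * x ^ 24) * (real k)\<^sup>2"
    using p25 d5 x1 by (intro mult_mono) auto
  also have "\<dots> = c * (A * x ^ 29)"
    using c by (simp add: A_def flip: power_add)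
  finally have den: "4 * real d ^ 5 * 25 ^ n * (real k)\<^sup>2 \<le> c * (A * x ^ 29)" .
  have denpos: "0 < 4 * real d ^ 5 * 25 ^ n * (real k)\<^sup>2" using d k by simp
  have \<delta>pos: "0 < \<delta>" using c denpos by (simp add: \<delta>_def)
  have \<delta>1: "\<delta> \<le> 1"
  proof -
    have "1 * 1 * 1 * 1 \<le> 4 * real d ^ 5 * 25 ^ n * (real k)\<^sup>2"
      using d k2 by (intro mult_mono) (auto intro!: one_le_power)
    then show ?thesis using c denpos by (simp add: \<delta>_def divide_le_eq)
  qed
  have \<delta>A: "1 \<le> \<delta> * (A * x ^ 29)" using den denpos c by (simp add: \<delta>_def pos_le_divide_eq)
  define J where "J = l div (2 * k)"
  have J: "2 * k * J \<le> l" by (simp add: J_def)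
  have Jge: "230 * A * x ^ 32 - 1 \<le> real J"
  proof -
    have "l mod (2 * k) < 2 * k" using k by simp
    moreover have "l = 2 * k * J + l mod (2 * k)" by (simp add: J_def)
    ultimately have "l < 2 * k * J + 2 * k" by linarith
    then have "real l < real (2 * k * J + 2 * k)" by (simp only: of_nat_less_iff)
    then have "real l < 2 * real k * (real J + 1)" by (simp add: algebra_simps)
    moreover have "2 * real k * (230 * A * x ^ 32) \<le> real l"
      using l by (simp add: A_def x_def \<Lambda>_def mult_ac)
    ultimately have "2 * real k * (230 * A * x ^ 32) < 2 * real k * (real J + 1)" by linarith
    then have "230 * A * x ^ 32 < real J + 1" using k by (subst (asm) mult_less_cancel_left_pos) auto
    then show ?thesis by simp
  qed
  have big: "2 * R + 2 < \<delta> / 2 * real J"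
  proof -
    have "1 * 1 \<le> A * x ^ 32" using A1 x1 by (intro mult_mono one_le_power) auto
    then have "229 * (A * x ^ 32) \<le> real J" using Jge by linarith
    then have "\<delta> * (229 * (A * x ^ 32)) \<le> \<delta> * real J" using \<delta>pos by (intro mult_left_mono) auto
    moreover have "1 * (229 * x ^ 3) \<le> (\<delta> * (A * x ^ 29)) * (229 * x ^ 3)"
      using \<delta>A x1 by (intro mult_right_mono) auto
    moreover have "(\<delta> * (A * x ^ 29)) * (229 * x ^ 3) = \<delta> * (229 * (A * x ^ 32))"
    proof -
      have "x ^ 32 = x ^ 29 * x ^ 3" by (simp flip: power_add)
      then show ?thesis by simp
    qed
    ultimately have "229 * x ^ 3 \<le> \<delta> * real J" by linarith
    moreover have "4 + 4 * R < 229 * x ^ 3" using R x3 x by linarith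
    ultimately show ?thesis by linarith
  qed
  have "4 < exp (2 * R + 2) * \<rho>\<^sup>2"
  proof -
    have "\<rho>\<^sup>2 = exp (2 * (- R))" unfolding exp_double eR ..
    then have "exp (2 * R) * \<rho>\<^sup>2 = 1" by (simp flip: exp_add)
    then have "exp (2 * R + 2) * \<rho>\<^sup>2 = exp 2" by (simp add: exp_add)
    moreover have "(4::real) < exp 2"
    proof -
      have "(5/2::real) \<le> exp 1" using exp_lower_Taylor_quadratic[of "1::real"] by simp
      then have "(5/2)\<^sup>2 \<le> (exp 1 :: real)\<^sup>2" by (intro power_mono) auto
      also have "\<dots> = exp 2" by (simp flip: exp_double)
      finally show ?thesis by (simp add: power2_eq_square)
    qed
    ultimately show ?thesis by simp
  qed
  also have "\<dots> \<le> (1 + \<delta>) ^ J * \<rho>\<^sup>2"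
  proof (rule mult_right_mono)
    have "2 * R + 2 \<le> real J * (\<delta> / 2)" using big unfolding mult.commute[of "real J"] by (rule less_imp_le)
    then have "exp (2 * R + 2) \<le> exp (real J * (\<delta> / 2))" by simp
    also have "\<dots> = exp (\<delta> / 2) ^ J" by (rule exp_of_nat_mult)
    also have "\<dots> \<le> (1 + \<delta>) ^ J" using exp_half_le[of \<delta>] \<delta>pos \<delta>1 by (intro power_mono) auto
    finally show "exp (2 * R + 2) \<le> (1 + \<delta>) ^ J" .
  qed simp
  finally have main: "4 < (1 + \<delta>) ^ J * \<rho>\<^sup>2" .
  have cov: "real ((2 * Q + 1) ^ (2 * d\<^sup>2)) * \<rho>\<^sup>2 \<le> (2 * (real d)\<^sup>2 / real Q)\<^sup>2"
  proof -
    have "real ((2 * Q + 1) ^ (2 * d\<^sup>2)) = (q ^ d\<^sup>2)\<^sup>2"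
      by (simp add: q_def add.commute mult.commute flip: power_mult)
    then have "real ((2 * Q + 1) ^ (2 * d\<^sup>2)) * \<rho>\<^sup>2 = (1 / real Q)\<^sup>2"
      using q1 by (simp add: \<rho>_def power_divide power_mult_distrib)
    also have "\<dots> \<le> (2 * (real d)\<^sup>2 / real Q)\<^sup>2"
      using d2 by (intro power_mono divide_right_mono) auto
    finally show ?thesis .
  qed
  show ?thesis using Q0 Qe \<rho> cov net J main unfolding \<delta>_def by blast
qed


section \<open>Mixing of the walk\<close>

context SU_walk begin

lemma sq_norm_le_4:
  assumes f: "lipschitz_SU d f" and mean: "(\<integral>x. f x \<partial>m) = 0"
  shows "sq_norm f \<le> 4"
proof -
  interpret M: prob_space m by (rule prob_m)
  note bm = lipschitz_SU_bounded_measurable[OF f]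
  have le2: "(f x)\<^sup>2 \<le> 4" if x: "x \<in> SU d" for x
  proof -
    have i: "integrable m f" by (rule integrable_bounded_measurable(1)[OF bm])
    have "f x = (\<integral>y. f x - f y \<partial>m)" using i mean by (simp add: M.prob_space)
    also have "\<bar>\<dots>\<bar> \<le> (\<integral>y. \<bar>f x - f y\<bar> \<partial>m)" by (rule integral_abs_bound)
    also have "\<dots> \<le> (\<integral>y. 2 \<partial>m)"
    proof (rule integral_mono)
      fix y assume "y \<in> space m"
      then have y: "y \<in> SU d" by (simp add: space_m)
      show "\<bar>f x - f y\<bar> \<le> 2" using f x y op_dist_SU_le_2[OF x y] unfolding lipschitz_SU_def by fastforce
    qed (use i in auto)
    finally have "\<bar>f x\<bar> \<le> 2" by (simp add: M.prob_space)
    then have "\<bar>f x\<bar>\<^sup>2 \<le> 2\<^sup>2" by (intro power_mono) auto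
    then show ?thesis by simp
  qed
  have "sq_norm f \<le> (\<integral>x. 4 \<partial>m)" unfolding sq_norm_def
    using le2 integrable_bounded_measurable(1)[OF bdd_measurable_square[OF bm]]
    by (intro integral_mono) (auto simp: space_m)
  then show ?thesis by (simp add: M.prob_space)
qed

text \<open>
  The value of \<open>\<kappa>\<close> is chosen so that the word contribution \<open>d\<^sup>2 5\<^sup>n k \<kappa>\<close> in the block estimate is half of
  the norm \<open>s\<close> of the middle function, while the accuracy term is at most a quarter of it. A loss of norm
  below \<open>\<kappa>\<^sup>2 c / d\<close> would therefore give \<open>s \<le> 3 s / 4\<close>.
\<close>

lemma one_block_decay:
  fixes c \<rho> e :: real and n k :: nat
  assumes block: "\<And>\<kappa>::real. 0 < \<kappa> \<Longrightarrow> sq_norm f - sq_norm ((T ^^ (2 * k)) f) < \<kappa>\<^sup>2 * c / d \<Longrightarrow>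
      sq_norm ((T ^^ k) f) \<le> ((real d)\<^sup>2 * (5 ^ n * (k * \<kappa>) + e))\<^sup>2"
    and e: "0 \<le> e" "(real d)\<^sup>2 * e \<le> \<rho> / 4" and \<rho>: "0 < \<rho>" and k: "1 \<le> k" and c: "0 < c" and d: "2 \<le> d"
    and f: "lipschitz_SU d f" and large: "\<rho>\<^sup>2 \<le> sq_norm ((T ^^ (2 * k)) f)"
  shows "(1 + c / (4 * real d ^ 5 * 25 ^ n * (real k)\<^sup>2)) * sq_norm ((T ^^ (2 * k)) f) \<le> sq_norm f"
proof -
  define \<delta> where "\<delta> = c / (4 * real d ^ 5 * 25 ^ n * (real k)\<^sup>2)"
  have \<delta>: "0 \<le> \<delta>" using c by (simp add: \<delta>_def)
  define S s where "S = sq_norm ((T ^^ k) f)" and "s = sqrt S"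
  have mid: "sq_norm ((T ^^ (2 * k)) f) \<le> S"
    unfolding S_def by (rule sq_norm_iterate_antimono[OF f]) simp
  then have "\<rho>\<^sup>2 \<le> S" using large by linarith
  then have s: "\<rho> \<le> s" unfolding s_def by (rule real_le_rsqrt)
  have s2: "s\<^sup>2 = S" by (simp add: s_def S_def sq_norm_nonneg)
  have s0: "0 < s" using s \<rho> by linarith
  define \<kappa> where "\<kappa> = s / (2 * (real d)\<^sup>2 * 5 ^ n * real k)"
  have pos: "0 < real d" "0 < real k" using d k by auto
  have \<kappa>0: "0 < \<kappa>" using s0 pos by (simp add: \<kappa>_def)
  have "\<not> sq_norm f - sq_norm ((T ^^ (2 * k)) f) < \<kappa>\<^sup>2 * c / d"
  proof
    assume "sq_norm f - sq_norm ((T ^^ (2 * k)) f) < \<kappa>\<^sup>2 * c / d"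
    from block[OF \<kappa>0 this] have "s\<^sup>2 \<le> ((real d)\<^sup>2 * (5 ^ n * (k * \<kappa>) + e))\<^sup>2" unfolding s2 S_def .
    moreover have "0 \<le> (real d)\<^sup>2 * (5 ^ n * (k * \<kappa>) + e)" using e \<kappa>0 by simp
    ultimately have "s \<le> (real d)\<^sup>2 * (5 ^ n * (k * \<kappa>) + e)" by (rule power2_le_imp_le)
    also have "\<dots> = s / 2 + (real d)\<^sup>2 * e" using pos by (simp add: \<kappa>_def field_simps)
    finally show False using e(2) s s0 by linarith
  qed
  then have "\<kappa>\<^sup>2 * c / d \<le> sq_norm f - sq_norm ((T ^^ (2 * k)) f)" by simp
  moreover have "\<kappa>\<^sup>2 * c / d = \<delta> * S"
  proof -
    have "\<kappa>\<^sup>2 = S / (4 * real d ^ 4 * 25 ^ n * (real k)\<^sup>2)"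
    proof -
      have "(5 ^ n)\<^sup>2 = (25::real) ^ n" by (simp add: power2_eq_square flip: power_mult_distrib)
      then show ?thesis
        by (simp add: \<kappa>_def power_divide power_mult_distrib s2 flip: power_mult)
    qed
    moreover have "real d ^ 5 = real d ^ 4 * real d" by (simp add: eval_nat_numeral)
    ultimately show ?thesis by (simp add: \<delta>_def mult_ac)
  qed
  moreover have "\<delta> * sq_norm ((T ^^ (2 * k)) f) \<le> \<delta> * S" by (rule mult_left_mono[OF mid \<delta>])
  ultimately show ?thesis unfolding \<delta>_def[symmetric] by (simp add: distrib_right)
qed

lemma geometric_decay:
  fixes c \<rho> e :: real and n k :: nat
  assumes block: "\<And>f (\<kappa>::real). lipschitz_SU d f \<Longrightarrow> (\<integral>x. f x \<partial>m) = 0 \<Longrightarrow> 0 < \<kappa> \<Longrightarrow>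
      sq_norm f - sq_norm ((T ^^ (2 * k)) f) < \<kappa>\<^sup>2 * c / d \<Longrightarrow>
      sq_norm ((T ^^ k) f) \<le> ((real d)\<^sup>2 * (5 ^ n * (k * \<kappa>) + e))\<^sup>2"
    and e: "0 \<le> e" "(real d)\<^sup>2 * e \<le> \<rho> / 4" and \<rho>: "0 < \<rho>" and k: "1 \<le> k" and c: "0 < c" and d: "2 \<le> d"
    and f: "lipschitz_SU d f" "(\<integral>x. f x \<partial>m) = 0" and large: "\<rho>\<^sup>2 \<le> sq_norm ((T ^^ (2 * k * J)) f)"
  shows "(1 + c / (4 * real d ^ 5 * 25 ^ n * (real k)\<^sup>2)) ^ J * sq_norm ((T ^^ (2 * k * J)) f) \<le> sq_norm f"
  using large
proof (induction J)
  case 0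
  show ?case by simp
next
  case (Suc J)
  define \<delta> where "\<delta> = c / (4 * real d ^ 5 * 25 ^ n * (real k)\<^sup>2)"
  have \<delta>: "0 \<le> \<delta>" using c by (simp add: \<delta>_def)
  define h where "h = (T ^^ (2 * k * J)) f"
  have h: "lipschitz_SU d h" "(\<integral>x. h x \<partial>m) = 0"
    using lipschitz_SU_iterate[OF f(1)] integral_iterate[OF f(1)] f(2) by (auto simp: h_def)
  have next_block: "(T ^^ (2 * k * Suc J)) f = (T ^^ (2 * k)) h"
    by (simp add: h_def funpow_add)
  have "sq_norm ((T ^^ (2 * k * Suc J)) f) \<le> sq_norm h"
    unfolding h_def by (rule sq_norm_iterate_antimono[OF f(1)]) simp
  then have IH: "(1 + \<delta>) ^ J * sq_norm h \<le> sq_norm f"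
    using Suc unfolding \<delta>_def h_def by linarith
  have "(1 + \<delta>) * sq_norm ((T ^^ (2 * k)) h) \<le> sq_norm h"
    unfolding \<delta>_def
    by (rule one_block_decay[OF block[OF h] e \<rho> k c d h(1)]) (use Suc.prems in \<open>simp_all add: next_block del: mult_Suc_right\<close>)
  then have "(1 + \<delta>) ^ J * ((1 + \<delta>) * sq_norm ((T ^^ (2 * k)) h)) \<le> (1 + \<delta>) ^ J * sq_norm h"
    using \<delta> by (intro mult_left_mono) auto
  also note IH
  finally show ?case unfolding next_block \<delta>_def[symmetric] by (simp add: mult_ac)
qed

end

theorem proposition2:
  fixes \<eta> :: "complex mat measure"
  assumes "prob_space \<eta>"
    and "sets \<eta> = sets (borel_SU 2)"
    and "SU_topology 2 closure_of
           generate (SU_group 2) (measure_support (SU_topology 2) \<eta>) = SU 2"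
  shows "\<exists>C::real. C > 0 \<and>
    (\<forall>d::nat. d \<ge> 3 \<longrightarrow>
    (\<forall>\<epsilon>::real. 0 < \<epsilon> \<and> \<epsilon> < 1/2 \<longrightarrow>
    (\<forall>l::nat. real l \<ge> C * (real d * ln (1/\<epsilon>)) powr C \<longrightarrow>
    (\<forall>m f. normalized_haar_SU d m \<longrightarrow>
       (\<forall>g\<in>SU d. \<forall>h\<in>SU d. \<bar>f g - f h\<bar> \<le> op_norm (g - h)) \<longrightarrow>
       \<bar>(\<integral>g. f g \<partial>(convolution_power_SU d (walk_measure \<eta> d) l)) - (\<integral>g. f g \<partial>m)\<bar> \<le> \<epsilon>))))"
proof -
  interpret E: prob_space \<eta> by fact
  interpret M2: Metric_space "SU 2" op_dist by (rule Metric_space_SU)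
  let ?S = "measure_support (SU_topology 2) \<eta>"
  have S: "?S \<subseteq> SU 2" by (auto simp: measure_support_def topspace_SU_topology)
  obtain A k0 \<delta> where A: "finite A" "A \<subseteq> ?S" "0 < \<delta>" and net: "robust_word_net A k0 \<delta>"
    using balanced_word_net[OF S assms(3)] by blast
  \<comment> \<open>The successor makes the block length positive.\<close>
  define k where "k = Suc k0"
  define U where "U a = {g \<in> SU 2. op_dist g a < \<delta>}" for a
  have U: "0 < measure \<eta> (U a)" if "a \<in> A" for a
  proof -
    have a: "a \<in> ?S" "a \<in> SU 2" using that A S by auto
    have "U a = M2.mball a \<delta>" using a M2.commute by (auto simp: U_def)
    then have "openin (SU_topology 2) (U a) \<and> a \<in> U a"
      using a A(3) by (simp add: SU_topology_def M2.openin_mball)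
    then have "0 < emeasure \<eta> (U a)" using a by (simp add: measure_support_def)
    then show ?thesis by (simp add: E.emeasure_eq_measure)
  qed
  \<comment> \<open>Inserting 1 covers empty \<open>A\<close> and ensures \<open>c \<le> 1\<close>.\<close>
  define c where "c = Min (insert 1 ((\<lambda>a. measure \<eta> (U a)) ` A))"
  have c: "0 < c" "c \<le> 1" and cU: "\<And>a. a \<in> A \<Longrightarrow> c \<le> measure \<eta> (U a)"
    using A(1) U by (auto simp: c_def)
  define C where "C = max 32 (460 * k * (128 * 90 ^ 8 * (real k)\<^sup>2 / c))"
  show ?thesis
  proof (intro exI[of _ C] conjI allI impI)
    show "C > 0" by (simp add: C_def)
    fix d l :: nat and \<epsilon> :: real and m f
    assume d: "d \<ge> 3" and \<epsilon>: "0 < \<epsilon> \<and> \<epsilon> < 1 / 2" and l: "real l \<ge> C * (real d * ln (1 / \<epsilon>)) powr C"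
      and haar: "normalized_haar_SU d m" and f: "\<forall>g\<in>SU d. \<forall>h\<in>SU d. \<bar>f g - f h\<bar> \<le> op_norm (g - h)"
    have d2: "2 \<le> d" using d by simp
    interpret SU_walk d m "walk_measure \<eta> d"
      by (rule SU_walk.intro[OF haar prob_space_walk_measure[OF assms(1,2) d2] sets_walk_measure])
    interpret M: prob_space m by (rule prob_m)
    define x where "x = real d * ln (1 / \<epsilon>)"
    have x1: "1 \<le> x"
    proof -
      have "3 * (1 / 2) \<le> real d * ln (1 / \<epsilon>)" using d ln_inverse_ge_half[of \<epsilon>] \<epsilon> by (intro mult_mono) auto
      then show ?thesis by (simp add: x_def)
    qed
    have "460 * k * (128 * 90 ^ 8 * (real k)\<^sup>2 / c) * x ^ 32 \<le> C * x powr C"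
    proof (rule mult_mono)
      have "x ^ 32 = x powr 32" using x1 by (simp add: powr_numeral)
      also have "\<dots> \<le> x powr C" using x1 by (intro powr_mono) (auto simp: C_def)
      finally show "x ^ 32 \<le> x powr C" .
    qed (use x1 in \<open>auto simp: C_def\<close>)
    then have l': "460 * k * (128 * 90 ^ 8 * (real k)\<^sup>2 / c) * (real d * ln (1 / \<epsilon>)) ^ 32 \<le> real l"
      using l by (simp add: x_def)
    obtain Q n \<rho> J where P: "0 < Q" "2 * (2 * (real d)\<^sup>2 / real Q) \<le> \<epsilon>" "0 < \<rho>"
      "real ((2 * Q + 1) ^ (2 * d\<^sup>2)) * \<rho>\<^sup>2 \<le> (2 * (real d)\<^sup>2 / real Q)\<^sup>2"
      "(real d)\<^sup>2 * (exp (- ((3 / 2) ^ n)) / 9) \<le> \<rho> / 4" "2 * k * J \<le> l"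
      "4 < (1 + c / (4 * real d ^ 5 * 25 ^ n * (real k)\<^sup>2)) ^ J * \<rho>\<^sup>2"
      using walk_parameters[OF d _ _ _ c l'] \<epsilon> k_def by auto
    define \<mu> where "\<mu> = (\<integral>g. f g \<partial>m)"
    have flip: "lipschitz_SU d f" using f by (simp add: lipschitz_SU_def op_dist_SU)
    define f0 where "f0 x = f x - \<mu>" for x
    have f0: "lipschitz_SU d f0" "(\<integral>x. f0 x \<partial>m) = 0"
    proof -
      show "lipschitz_SU d f0" using flip by (simp add: lipschitz_SU_def f0_def)
      show "(\<integral>x. f0 x \<partial>m) = 0"
        using integrable_bounded_measurable(1)[OF lipschitz_SU_bounded_measurable[OF flip]]
        by (simp add: f0_def \<mu>_def M.prob_space)
    qed
    have block: "sq_norm ((T ^^ k) h) \<le> ((real d)\<^sup>2 * (5 ^ n * (k * \<kappa>) + exp (- ((3 / 2) ^ n)) / 9))\<^sup>2"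
      if "lipschitz_SU d h" "(\<integral>x. h x \<partial>m) = 0" "0 < \<kappa>"
        "sq_norm h - sq_norm ((T ^^ (2 * k)) h) < \<kappa>\<^sup>2 * c / d" for h and \<kappa> :: real
    proof (rule block_contraction[where A = A and \<delta> = \<delta>, OF assms(1,2) d2 _ _ _ that])
      show "measure \<eta> (embed_SU2 d i -` Z \<inter> SU 2) / d \<le> measure (walk_measure \<eta> d) Z"
        if "i < d" "Z \<in> sets (borel_SU d)" for i Z
        by (rule walk_measure_ge[OF assms(1,2) d2 that])
      show "robust_word_net A k \<delta>" using robust_word_net_mono[OF net, of k] by (simp add: k_def)
      show "c \<le> measure \<eta> {g \<in> SU 2. op_dist g a < \<delta>}" if "a \<in> A" for a
        using cU[OF that] by (simp add: U_def)
    qed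
    have "sq_norm ((T ^^ (2 * k * J)) f0) < \<rho>\<^sup>2"
    proof (rule ccontr)
      assume "\<not> ?thesis"
      then have large: "\<rho>\<^sup>2 \<le> sq_norm ((T ^^ (2 * k * J)) f0)" by simp
      let ?q = "(1 + c / (4 * real d ^ 5 * 25 ^ n * (real k)\<^sup>2)) ^ J"
      have "?q * \<rho>\<^sup>2 \<le> ?q * sq_norm ((T ^^ (2 * k * J)) f0)"
        using large c by (intro mult_left_mono) auto
      also have "\<dots> \<le> sq_norm f0"
        by (rule geometric_decay[where e = "exp (- ((3 / 2) ^ n)) / 9", OF block _ P(5) P(3) _ c(1) d2 f0 large])
          (auto simp: k_def)
      also have "\<dots> \<le> 4" by (rule sq_norm_le_4[OF f0])
      finally show False using P(7) by linarith
    qed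
    moreover have "sq_norm ((T ^^ l) f0) \<le> sq_norm ((T ^^ (2 * k * J)) f0)"
      by (rule sq_norm_iterate_antimono[OF f0(1) P(6)])
    ultimately have "real ((2 * Q + 1) ^ (2 * d\<^sup>2)) * sq_norm ((T ^^ l) f0) \<le> real ((2 * Q + 1) ^ (2 * d\<^sup>2)) * \<rho>\<^sup>2"
      by (intro mult_left_mono) auto
    also note P(4)
    finally have "\<bar>(T ^^ l) f0 (1\<^sub>m d)\<bar> \<le> 2 * (2 * (real d)\<^sup>2 / real Q)"
      by (rule sup_le_of_sq_norm[OF P(1) lipschitz_SU_iterate[OF f0(1)]])
    then have small: "\<bar>(T ^^ l) f0 (1\<^sub>m d)\<bar> \<le> \<epsilon>" using P(2) by linarith
    let ?\<nu>l = "convolution_power_SU d (walk_measure \<eta> d) l"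
    interpret L: prob_space ?\<nu>l by (rule convolution_power(1))
    have "integrable ?\<nu>l f"
    proof -
      obtain B where B: "\<forall>x\<in>SU d. \<bar>f x\<bar> \<le> B" and fm: "f \<in> borel_measurable (borel_SU d)"
        using lipschitz_SU_bounded_measurable[OF flip] by (auto simp: bdd_measurable_def)
      have "space ?\<nu>l = SU d" using sets_eq_imp_space_eq[OF convolution_power(2)] by (simp add: space_borel_SU)
      moreover have "f \<in> borel_measurable ?\<nu>l"
        using fm measurable_cong_sets[OF convolution_power(2)[of l] refl, of borel] by blast
      ultimately show ?thesis using B by (intro L.integrable_const_bound[of _ B]) auto
    qed
    then have "(\<integral>g. f g \<partial>?\<nu>l) - \<mu> = (\<integral>g. f0 g \<partial>?\<nu>l)"
      by (simp add: f0_def L.prob_space)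
    also have "\<dots> = (T ^^ l) f0 (1\<^sub>m d)" by (rule convolution_power(3)[OF f0(1)])
    finally show "\<bar>(\<integral>g. f g \<partial>?\<nu>l) - (\<integral>g. f g \<partial>m)\<bar> \<le> \<epsilon>" using small by (simp add: \<mu>_def)
  qed
qed

end
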